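(* Let $\Gamma$ be a cocompact discrete subgroup of $\mathrm{PSL}_2(\mathbb{C})$ and $p\in\Gamma\backslash\mathcal{H}$. Suppose $X>1$, $T>1$, and $x_1,\dots,x_R\in[X,2X]$ with $|x_k-x_l|>\epsilon>0$ for all $k\ne l$. Then for all complex numbers $a_j$, \[\sum_{k=1}^R\Big|\sum_{|t_j|\le T}a_jx_k^{it_j}u_j(p)\Big|^2\ll\big(T^3+XT^2\epsilon^{-1}\big)\sum_{|t_j|\le T}|a_j|^2.\]
   Context: $\mathcal{H}$ is hyperbolic $3$-space (upper half-space) with Laplacian $\Delta=y^2(\partial_{x_1}^2+\partial_{x_2}^2+\partial_y^2)-y\partial_y$. $\{u_j\}$ is a complete orthonormal system of eigenfunctions of $-\Delta$ on $L^2(\Gamma\backslash\mathcal{H})$ with eigenvalues $\lambda_j=1+t_j^2$, where $t_j\in\mathbb{R}$ or $t_j\in i\mathbb{R}$. The implied constant depends on $\Gamma$ and $p$.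
   Formalization: For purely imaginary t_j the root of λ_j = 1 + t_j² with Im t_j ≥ 0 is taken; with t_0 = -i the bound fails (R = 1, T = 2, a_0 = 1, other a_j = 0, ε = X, X → ∞). *)

theory Defs
  imports "HOL-Analysis.Analysis" "HOL-Algebra.Coset"
begin

definition quot_topology :: "'a topology \<Rightarrow> ('a \<Rightarrow> 'b) \<Rightarrow> 'b topology" where
  "quot_topology X q =
     topology (\<lambda>U. U \<subseteq> q ` topspace X \<and> openin X {x \<in> topspace X. q x \<in> U})"

lemma openin_quot_topology:
  "openin (quot_topology X q) U \<longleftrightarrow>
     U \<subseteq> q ` topspace X \<and> openin X {x \<in> topspace X. q x \<in> U}"
proof -
  have "istopology (\<lambda>U. U \<subseteq> q ` topspace X \<and> openin X {x \<in> topspace X. q x \<in> U})"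
    unfolding istopology_def
  proof (intro conjI allI impI; (elim conjE)?)
    fix S T
    assume "openin X {x \<in> topspace X. q x \<in> S}" "openin X {x \<in> topspace X. q x \<in> T}"
    then have "openin X ({x \<in> topspace X. q x \<in> S} \<inter> {x \<in> topspace X. q x \<in> T})"
      by (rule openin_Int)
    moreover have "{x \<in> topspace X. q x \<in> S} \<inter> {x \<in> topspace X. q x \<in> T}
      = {x \<in> topspace X. q x \<in> S \<inter> T}" by auto
    ultimately show "openin X {x \<in> topspace X. q x \<in> S \<inter> T}" by simp
  next
    fix K
    assume K: "\<forall>U\<in>K. U \<subseteq> q ` topspace X \<and> openin X {x \<in> topspace X. q x \<in> U}"
    have "openin X (\<Union>U\<in>K. {x \<in> topspace X. q x \<in> U})"
      using K by (intro openin_Union) auto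
    moreover have "(\<Union>U\<in>K. {x \<in> topspace X. q x \<in> U}) = {x \<in> topspace X. q x \<in> \<Union>K}" by auto
    ultimately show "openin X {x \<in> topspace X. q x \<in> \<Union>K}" by simp
  qed auto
  then show ?thesis
    by (simp add: quot_topology_def topology_inverse')
qed

lemma topspace_quot_topology [simp]: "topspace (quot_topology X q) = q ` topspace X"
proof
  show "topspace (quot_topology X q) \<subseteq> q ` topspace X"
    using openin_quot_topology[of X q "topspace (quot_topology X q)"] by auto
  have "{x \<in> topspace X. q x \<in> q ` topspace X} = topspace X" by auto
  then have "openin (quot_topology X q) (q ` topspace X)"
    by (simp add: openin_quot_topology)
  then show "q ` topspace X \<subseteq> topspace (quot_topology X q)"
    by (rule openin_subset)
qed

lemma quotient_map_quot_topology: "quotient_map X (quot_topology X q) q"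
  by (auto simp: quotient_map_def openin_quot_topology)

definition borel_of_topology :: "'a topology \<Rightarrow> 'a measure" where
  "borel_of_topology X = sigma (topspace X) {U. openin X U}"


definition SL2C :: "(complex^2^2) monoid" where
  "SL2C = \<lparr>carrier = {A. det A = 1}, mult = (**), one = mat 1\<rparr>"

lemma group_SL2C: "group SL2C"
proof (rule groupI)
  fix A assume "A \<in> carrier SL2C"
  then have A: "det A = 1" by (simp add: SL2C_def)
  then obtain B where B: "B ** A = mat 1"
    by (metis invertible_det_nz invertible_left_inverse one_neq_zero)
  then have "det B = 1" using A by (metis det_I det_mul mult.right_neutral)
  with B show "\<exists>B\<in>carrier SL2C. B \<otimes>\<^bsub>SL2C\<^esub> A = \<one>\<^bsub>SL2C\<^esub>"
    by (auto simp: SL2C_def)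
qed (auto simp: SL2C_def det_mul matrix_mul_assoc)

definition PSL2C :: "(complex^2^2) set monoid" where
  "PSL2C = SL2C Mod {mat 1, - mat 1}"

definition PSL2C_topology :: "(complex^2^2) set topology" where
  "PSL2C_topology =
     quot_topology (top_of_set (carrier SL2C)) (\<lambda>A. {mat 1, - mat 1} #>\<^bsub>SL2C\<^esub> A)"

definition discrete_subgroup :: "(complex^2^2) set set \<Rightarrow> bool" where
  "discrete_subgroup \<Gamma> \<longleftrightarrow>
     subgroup \<Gamma> PSL2C \<and> subtopology PSL2C_topology \<Gamma> = discrete_topology \<Gamma>"

text \<open>A point \<open>(x\<^sub>1, x\<^sub>2, y)\<close> of the upper half-space is the pair \<open>(x\<^sub>1 + i x\<^sub>2, y)\<close>.\<close>

definition hyp3 :: "(complex \<times> real) set" where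
  "hyp3 = {P. snd P > 0}"

text \<open>In quaternion notation \<open>P = z + y j\<close> this is \<open>(a P + b) (c P + d)\<^sup>-\<^sup>1\<close>.\<close>

definition sl2_act :: "complex^2^2 \<Rightarrow> complex \<times> real \<Rightarrow> complex \<times> real" where
  "sl2_act A P =
     (let a = A $ 1 $ 1; b = A $ 1 $ 2; c = A $ 2 $ 1; d = A $ 2 $ 2;
          z = fst P; y = snd P;
          N = (cmod (c * z + d))\<^sup>2 + (cmod c)\<^sup>2 * y\<^sup>2
      in (((a * z + b) * cnj (c * z + d) + a * cnj c * of_real (y\<^sup>2)) / of_real N, y / N))"

lemma sl2_act_uminus: "sl2_act (- A) P = sl2_act A P"
proof -
  have "cmod (- (A $ 2 $ 1 * fst P) - A $ 2 $ 2) = cmod (A $ 2 $ 1 * fst P + A $ 2 $ 2)"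
    by (metis minus_add_distrib norm_minus_cancel uminus_add_conv_diff add.commute)
  then show ?thesis
    by (simp add: sl2_act_def Let_def) (simp add: algebra_simps)
qed

lemma sl2_act_mem_hyp3:
  assumes "det A = 1" "P \<in> hyp3"
  shows "sl2_act A P \<in> hyp3"
proof -
  have y: "snd P > 0" using assms(2) by (simp add: hyp3_def)
  have "(cmod (A $ 2 $ 1 * fst P + A $ 2 $ 2))\<^sup>2 + (cmod (A $ 2 $ 1))\<^sup>2 * (snd P)\<^sup>2 > 0"
  proof (cases "A $ 2 $ 1 = 0")
    case True
    then have "A $ 2 $ 2 \<noteq> 0" using assms(1) by (auto simp: det_2)
    with True show ?thesis by simp
  next
    case False
    then show ?thesis using y by (intro add_nonneg_pos mult_pos_pos) auto
  qed
  then show ?thesis using y by (simp add: sl2_act_def Let_def hyp3_def)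
qed

lemma sl2_act_one: "sl2_act (mat 1) P = P"
  by (simp add: sl2_act_def Let_def mat_def)

lemma PSL2C_carrier: "carrier PSL2C = (\<lambda>A. {A, - A}) ` {A. det A = 1}"
proof -
  have "- mat 1 ** A = - A" for A :: "complex^2^2"
    by (simp add: vec_eq_iff forall_2 matrix_matrix_mult_def sum_2 mat_def)
  then have "{mat 1, - mat 1} #>\<^bsub>SL2C\<^esub> A = {A, - A}" for A
    by (auto simp: r_coset_def SL2C_def)
  then show ?thesis
    by (auto simp: PSL2C_def FactGroup_def RCOSETS_def SL2C_def)
qed

text \<open>Elements of \<open>\<Gamma>\<close> are cosets \<open>{A, -A}\<close>, so \<open>\<Union>\<Gamma>\<close> is the preimage of \<open>\<Gamma>\<close> in
  \<open>SL\<^sub>2(\<complex>)\<close>; the two representatives of a coset act in the same way.\<close>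

definition hyp_orbit :: "(complex^2^2) set set \<Rightarrow> complex \<times> real \<Rightarrow> (complex \<times> real) set" where
  "hyp_orbit \<Gamma> P = (\<lambda>A. sl2_act A P) ` \<Union>\<Gamma>"

definition orbit_space :: "(complex^2^2) set set \<Rightarrow> (complex \<times> real) set set" where
  "orbit_space \<Gamma> = hyp_orbit \<Gamma> ` hyp3"

definition orbit_topology :: "(complex^2^2) set set \<Rightarrow> (complex \<times> real) set topology" where
  "orbit_topology \<Gamma> = quot_topology (top_of_set hyp3) (hyp_orbit \<Gamma>)"

definition cocompact :: "(complex^2^2) set set \<Rightarrow> bool" where
  "cocompact \<Gamma> \<longleftrightarrow> compact_space (orbit_topology \<Gamma>)"

definition hyp_vol :: "(complex \<times> real) measure" where
  "hyp_vol = density lborel (\<lambda>P. ennreal (indicator hyp3 P / (snd P) ^ 3))"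

definition fundamental_domain ::
  "(complex^2^2) set set \<Rightarrow> (complex \<times> real) set \<Rightarrow> bool" where
  "fundamental_domain \<Gamma> F \<longleftrightarrow>
     F \<in> sets borel \<and> F \<subseteq> hyp3 \<and> (\<forall>P\<in>hyp3. \<exists>!Q. Q \<in> F \<inter> hyp_orbit \<Gamma> P)"

text \<open>The measure induced on \<open>\<Gamma>\<close>-orbits by the hyperbolic volume. For discrete \<open>\<Gamma>\<close> a
  fundamental domain exists (a Dirichlet domain with a measurable choice of boundary points),
  and the measure does not depend on which one is chosen.\<close>

definition orbit_vol :: "(complex^2^2) set set \<Rightarrow> (complex \<times> real) set measure" where
  "orbit_vol \<Gamma> =
     distr (restrict_space hyp_vol (SOME F. fundamental_domain \<Gamma> F))
       (borel_of_topology (orbit_topology \<Gamma>)) (hyp_orbit \<Gamma>)"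

definition square_integrable :: "'a measure \<Rightarrow> ('a \<Rightarrow> complex) \<Rightarrow> bool" where
  "square_integrable M f \<longleftrightarrow> f \<in> borel_measurable M \<and> integrable M (\<lambda>x. (cmod (f x))\<^sup>2)"

definition complete_orthonormal :: "'a measure \<Rightarrow> (nat \<Rightarrow> 'a \<Rightarrow> complex) \<Rightarrow> bool" where
  "complete_orthonormal M u \<longleftrightarrow>
     (\<forall>j. square_integrable M (u j)) \<and>
     (\<forall>i j. (LINT x|M. u i x * cnj (u j x)) = (if i = j then 1 else 0)) \<and>
     (\<forall>f e. square_integrable M f \<and> e > 0 \<longrightarrow>
        (\<exists>n c. (LINT x|M. (cmod (f x - (\<Sum>j<n. c j * u j x)))\<^sup>2) < e))"


definition partial :: "'a::real_normed_vector \<Rightarrow> ('a \<Rightarrow> complex) \<Rightarrow> 'a \<Rightarrow> complex" where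
  "partial v f P = vector_derivative (\<lambda>s. f (P + s *\<^sub>R v)) (at 0)"

definition C2_on :: "'a::euclidean_space set \<Rightarrow> ('a \<Rightarrow> complex) \<Rightarrow> bool" where
  "C2_on S f \<longleftrightarrow>
     f differentiable_on S \<and>
     (\<forall>v\<in>Basis. partial v f differentiable_on S) \<and>
     (\<forall>v\<in>Basis. \<forall>w\<in>Basis. continuous_on S (partial w (partial v f)))"

definition hyp_laplacian :: "(complex \<times> real \<Rightarrow> complex) \<Rightarrow> complex \<times> real \<Rightarrow> complex" where
  "hyp_laplacian f P =
     (let y = snd P; e\<^sub>1 = (1, 0); e\<^sub>2 = (\<i>, 0); e\<^sub>3 = (0, 1)
      in of_real (y\<^sup>2) * (partial e\<^sub>1 (partial e\<^sub>1 f) P + partial e\<^sub>2 (partial e\<^sub>2 f) P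
           + partial e\<^sub>3 (partial e\<^sub>3 f) P) - of_real y * partial e\<^sub>3 f P)"

text \<open>A function \<open>u\<close> on the orbit space is regarded, as usual, as the \<open>\<Gamma>\<close>-invariant
  function \<open>u \<circ> hyp_orbit \<Gamma>\<close> on the half-space. Eigenfunctions are taken to be of class
  \<open>C\<^sup>2\<close>, so that the eigenvalue equation and point values make sense.\<close>

definition laplace_eigenfunction ::
  "(complex^2^2) set set \<Rightarrow> complex \<Rightarrow> ((complex \<times> real) set \<Rightarrow> complex) \<Rightarrow> bool" where
  "laplace_eigenfunction \<Gamma> ev u \<longleftrightarrow>
     C2_on hyp3 (u \<circ> hyp_orbit \<Gamma>) \<and>
     (\<forall>P\<in>hyp3. - hyp_laplacian (u \<circ> hyp_orbit \<Gamma>) P = ev * u (hyp_orbit \<Gamma> P))"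

text \<open>The equation \<open>\<lambda>\<^sub>j = 1 + t\<^sub>j\<^sup>2\<close> determines \<open>t\<^sub>j\<close> up to sign. For the purely imaginary
  ones (\<open>\<lambda>\<^sub>j < 1\<close>) the root with nonnegative imaginary part is meant: then
  \<open>\<bar>x powr (i t\<^sub>j)\<bar> \<le> 1\<close> for \<open>x > 1\<close>, whereas for \<open>\<lambda>\<^sub>0 = 0\<close> and \<open>t\<^sub>0 = -i\<close> one has
  \<open>x powr (i t\<^sub>0) = x\<close>.\<close>

definition spectral_system ::
  "(complex^2^2) set set \<Rightarrow> (nat \<Rightarrow> (complex \<times> real) set \<Rightarrow> complex) \<Rightarrow> (nat \<Rightarrow> complex) \<Rightarrow> bool"
  where
  "spectral_system \<Gamma> u t \<longleftrightarrow>
     complete_orthonormal (orbit_vol \<Gamma>) u \<and>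
     (\<forall>j. laplace_eigenfunction \<Gamma> (1 + (t j)\<^sup>2) (u j)) \<and>
     (\<forall>j. Im (t j) = 0 \<or> Re (t j) = 0 \<and> Im (t j) \<ge> 0)"

end

theory Submission
  imports Defs "HOL-Library.List_Lexorder"
begin

text \<open>
  With \<open>y = ln x\<close> the points become \<open>\<delta>\<close>-separated with \<open>\<delta> \<approx> \<epsilon> / X\<close> in an interval of bounded length, and
  \<open>x\<^sup>i\<^sup>t = e\<^sup>i\<^sup>t\<^sup>y\<close>. For \<open>S(y) = \<Sum>\<^sub>j a\<^sub>j u\<^sub>j(p) e\<^sup>i\<^sup>t\<^sup>y\<close>, Gallagher's inequality bounds the sum over the points of
  \<open>\<bar>S(y)\<bar>\<^sup>2\<close> by \<open>(1/\<delta> + T) \<integral>\<bar>S\<bar>\<^sup>2 + T\<^sup>-\<^sup>1 \<integral>\<bar>S'\<bar>\<^sup>2\<close>. Expanding the square against the weight \<open>e\<^sup>-\<^sup>\<bar>\<^sup>y\<^sup>\<bar>\<close>, whose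
  Fourier transform is \<open>2 / (1 + \<tau>\<^sup>2)\<close>, and applying Schur's test,
  \<open>\<integral>\<bar>S\<bar>\<^sup>2 \<lless> sup\<^sub>j \<Sum>\<^sub>l \<bar>u\<^sub>l(p)\<bar>\<^sup>2 / (1 + (t\<^sub>j - t\<^sub>l)\<^sup>2) \<cdot> \<Sum>\<bar>a\<^sub>j\<bar>\<^sup>2\<close>, and everything follows from the local Weyl bound:
  \<open>\<Sum>\<bar>u\<^sub>j(p)\<bar>\<^sup>2\<close> over \<open>\<tau> \<le> \<bar>t\<^sub>j\<bar> \<le> \<tau> + 1\<close> is \<open>O((1 + \<tau>)\<^sup>2)\<close>. The eigenfunctions with \<open>t\<^sub>j\<close> imaginary are handled by
  \<open>\<Sum>\<bar>u\<^sub>j(p)\<bar>\<^sup>2 = O(1)\<close> and the number of points.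

  The local Weyl bound is Bessel's inequality for an automorphic kernel supported in a ball of radius \<open>1\<close>
  around \<open>p\<close>. By the mean value property, a radial kernel \<open>\<kappa>(r) / sinh r\<close> acts on an eigenfunction by
  \<open>4 \<pi> \<integral> \<kappa>(r) sin (t r) / t dr\<close> and has squared norm \<open>4 \<pi> \<integral> \<bar>\<kappa>\<bar>\<^sup>2\<close>; the choice \<open>\<kappa>(r) = \<tau> sin (\<tau> r) (1 - r)\<close> gives
  eigenvalues bounded below for \<open>\<bar>t\<bar>\<close> near \<open>\<tau>\<close> at the cost of norm \<open>O(\<tau>\<^sup>2)\<close>.
\<close>


section \<open>Calculus\<close>

lemma norm_add_power2_le:
  fixes a b :: "'a::real_normed_vector"
  shows "(norm (a + b))\<^sup>2 \<le> 2 * (norm a)\<^sup>2 + 2 * (norm b)\<^sup>2"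
proof -
  have "(norm (a + b))\<^sup>2 \<le> (norm a + norm b)\<^sup>2" by (intro power_mono norm_triangle_ineq) auto
  also have "\<dots> \<le> 2 * (norm a)\<^sup>2 + 2 * (norm b)\<^sup>2"
    using zero_le_power2[of "norm a - norm b"] by (simp add: power2_eq_square algebra_simps)
  finally show ?thesis .
qed

lemma continuous_on_UNIV_zero_extension:
  fixes f :: "'a::topological_space \<Rightarrow> 'b::real_normed_vector"
  assumes "open S" "closed K" "K \<subseteq> S" "continuous_on S f" "\<And>x. x \<notin> K \<Longrightarrow> f x = 0"
  shows "continuous_on UNIV f"
proof -
  have "continuous_on (- K) f"
    using assms(5) by (subst continuous_on_cong[of _ "- K" _ "\<lambda>_. 0"]) auto
  then have "continuous_on (S \<union> - K) f"
    using assms by (intro continuous_on_open_Un) auto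
  moreover have "S \<union> - K = UNIV" using assms(3) by auto
  ultimately show ?thesis by simp
qed

lemma has_vector_derivative_imp_continuous_on_UNIV:
  assumes "\<And>x. (f has_vector_derivative f' x) (at x)"
  shows "continuous_on UNIV f"
  using assms by (meson continuous_at_imp_continuous_on has_vector_derivative_continuous)

lemma integrable_lborel_compact_support:
  fixes f :: "'a::euclidean_space \<Rightarrow> 'b::{banach, second_countable_topology}"
  assumes "continuous_on UNIV f" "compact K" "\<And>x. x \<notin> K \<Longrightarrow> f x = 0"
  shows "integrable lborel f"
proof -
  have "integrable lborel (\<lambda>x. indicator K x *\<^sub>R f x)"
    using assms by (intro borel_integrable_compact) (auto intro: continuous_on_subset)
  moreover have "(\<lambda>x. indicator K x *\<^sub>R f x) = f"
    using assms(3) by (auto simp: indicator_def)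
  ultimately show ?thesis by simp
qed

lemma lborel_integral_translate:
  fixes f :: "'a::euclidean_space \<Rightarrow> 'b::{banach, second_countable_topology}"
  assumes "f \<in> borel_measurable borel"
  shows "(\<integral>x. f (x + c) \<partial>lborel) = (\<integral>x. f x \<partial>lborel)"
proof -
  have "(\<integral>x. f x \<partial>lborel) = (\<integral>x. f x \<partial>distr lborel borel ((+) c))"
    by (simp add: lborel_distr_plus)
  also have "\<dots> = (\<integral>x. f (x + c) \<partial>lborel)"
    using assms by (subst integral_distr) (auto simp: add.commute)
  finally show ?thesis ..
qed

lemma has_vector_derivative_line:
  fixes f :: "'a::real_normed_vector \<Rightarrow> 'b::real_normed_vector"
  assumes "((\<lambda>s. f ((x + t *\<^sub>R v) + s *\<^sub>R v)) has_vector_derivative D) (at 0)"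
  shows "((\<lambda>s. f (x + s *\<^sub>R v)) has_vector_derivative D) (at t)"
proof -
  have "((\<lambda>s. f ((x + t *\<^sub>R v) + s *\<^sub>R v)) has_vector_derivative D) (at (t - t))"
    using assms by simp
  then have "((\<lambda>s. f ((x + t *\<^sub>R v) + s *\<^sub>R v)) \<circ> (\<lambda>s. s - t) has_vector_derivative 1 *\<^sub>R D) (at t)"
    by (intro vector_diff_chain_at) (auto intro!: derivative_eq_intros)
  then show ?thesis
    by (simp add: o_def algebra_simps)
qed

lemma has_vector_derivative_line_outside:
  fixes f :: "'a::real_normed_vector \<Rightarrow> 'b::real_normed_vector"
  assumes "closed K" "\<And>x. x \<notin> K \<Longrightarrow> f x = 0" "x \<notin> K"
  shows "((\<lambda>s. f (x + s *\<^sub>R v)) has_vector_derivative 0) (at 0)"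
proof (rule has_vector_derivative_transform_within_open[OF has_vector_derivative_const])
  have "open ((\<lambda>s. x + s *\<^sub>R v) -` (- K))"
    using assms(1) by (intro open_vimage continuous_intros) auto
  then show "open {s. x + s *\<^sub>R v \<notin> K}" by (simp add: vimage_def)
qed (use assms in auto)

lemma integral_translation_difference_eq_0:
  fixes f :: "'a::euclidean_space \<Rightarrow> 'b::{banach, second_countable_topology}"
  assumes "integrable lborel f"
  shows "(\<integral>x. f (x + c) - f x \<partial>lborel) = 0"
proof -
  have "integrable (distr lborel borel ((+) c)) f" using assms by (simp add: lborel_distr_plus)
  then have "integrable lborel (\<lambda>x. f (x + c))"
    using assms by (subst (asm) integrable_distr_eq) (auto simp: add.commute)
  then show ?thesis using assms by (simp add: lborel_integral_translate)
qed

lemma integral_derivative_along_segment: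
  fixes f f' :: "'a::real_normed_vector \<Rightarrow> 'b::euclidean_space"
  assumes deriv: "\<And>x. ((\<lambda>s. f (x + s *\<^sub>R v)) has_vector_derivative f' x) (at 0)"
    and f': "continuous_on UNIV f'"
  shows "(\<integral>t. indicator {0..1} t *\<^sub>R f' (x + t *\<^sub>R v) \<partial>lborel) = f (x + v) - f x"
proof -
  have "(\<integral>t. indicator {0..1} t *\<^sub>R f' (x + t *\<^sub>R v) \<partial>lborel) = f (x + 1 *\<^sub>R v) - f (x + 0 *\<^sub>R v)"
  proof (rule integral_FTC_Icc)
    show "((\<lambda>t. f (x + t *\<^sub>R v)) has_vector_derivative f' (x + t *\<^sub>R v)) (at t within {0..1})" for t
      by (rule has_vector_derivative_at_within, rule has_vector_derivative_line, rule deriv)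
    show "continuous_on {0..1} (\<lambda>t. f' (x + t *\<^sub>R v))"
      by (intro continuous_on_compose2[OF f'] continuous_intros) auto
  qed simp
  then show ?thesis by simp
qed

text \<open>By the fundamental theorem of calculus and Fubini's theorem, \<open>\<integral> f' = \<integral>\<^sub>0\<^sup>1 \<integral> f'(x + t v) dx dt
  = \<integral> (f(x + v) - f(x)) dx = 0\<close>.\<close>

lemma integral_directional_derivative_eq_0:
  fixes f f' :: "'a::euclidean_space \<Rightarrow> 'b::euclidean_space"
  assumes deriv: "\<And>x. ((\<lambda>s. f (x + s *\<^sub>R v)) has_vector_derivative f' x) (at 0)"
    and f: "continuous_on UNIV f" and f': "continuous_on UNIV f'"
    and K: "compact K" and supp: "\<And>x. x \<notin> K \<Longrightarrow> f x = 0"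
  shows "(\<integral>x. f' x \<partial>lborel) = 0"
proof -
  have supp': "f' x = 0" if "x \<notin> K" for x
    using has_vector_derivative_line_outside[OF compact_imp_closed[OF K] supp that] deriv
    by (rule vector_derivative_unique_at[symmetric])
  define h where "h = (\<lambda>x t :: real. indicator {0..1} t *\<^sub>R f' (x + t *\<^sub>R v))"
  define K' where "K' = (\<lambda>(x, t). x - t *\<^sub>R v) ` (K \<times> {0..1::real})"
  have K': "compact (K' \<times> {0..1::real})"
    unfolding K'_def using K
    by (intro compact_continuous_image compact_Times) (auto intro!: continuous_intros simp: case_prod_beta)
  have "x \<in> K'" if "x + t *\<^sub>R v \<in> K" "t \<in> {0..1}" for x t
    unfolding K'_def using that by (intro image_eqI[where x = "(x + t *\<^sub>R v, t)"]) auto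
  then have "case_prod h = (\<lambda>p. indicator (K' \<times> {0..1}) p *\<^sub>R f' (fst p + snd p *\<^sub>R v))"
    using supp' by (auto simp: h_def indicator_def fun_eq_iff)
  moreover have "integrable lborel (\<lambda>p. indicator (K' \<times> {0..1}) p *\<^sub>R f' (fst p + snd p *\<^sub>R v))"
    by (intro borel_integrable_compact K' continuous_on_compose2[OF f'] continuous_intros) auto
  ultimately have "integrable (lborel \<Otimes>\<^sub>M lborel) (case_prod h)" by (simp add: lborel_prod)
  then have "(\<integral>t. \<integral>x. h x t \<partial>lborel \<partial>lborel) = (\<integral>x. \<integral>t. h x t \<partial>lborel \<partial>lborel)"
    by (rule lborel_pair.Fubini_integral)
  moreover have "(\<integral>x. h x t \<partial>lborel) = indicator {0..1} t *\<^sub>R (\<integral>x. f' x \<partial>lborel)" for t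
    unfolding h_def using f' by (simp add: lborel_integral_translate borel_measurable_continuous_onI)
  moreover have "(\<integral>t. h x t \<partial>lborel) = f (x + v) - f x" for x
    unfolding h_def using deriv f' by (rule integral_derivative_along_segment)
  moreover have "(\<integral>x. f (x + v) - f x \<partial>lborel) = 0"
    using integrable_lborel_compact_support[OF f K supp] by (rule integral_translation_difference_eq_0)
  ultimately show ?thesis by simp
qed

lemma partial_eq:
  assumes "(f has_derivative f') (at x)"
  shows "partial v f x = f' v"
proof -
  have "((\<lambda>s. x + s *\<^sub>R v) has_derivative (\<lambda>s. s *\<^sub>R v)) (at 0)"
    by (auto intro!: derivative_eq_intros)
  then have "((\<lambda>s. f (x + s *\<^sub>R v)) has_derivative (\<lambda>s. f' (s *\<^sub>R v))) (at 0)"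
    using has_derivative_compose[of "\<lambda>s. x + s *\<^sub>R v" _ 0 UNIV f f'] assms by simp
  moreover have "f' (s *\<^sub>R v) = s *\<^sub>R f' v" for s
    using has_derivative_linear[OF assms] by (simp add: linear_scale)
  ultimately show ?thesis
    by (simp add: partial_def vector_derivative_at has_vector_derivative_def)
qed

lemma has_vector_derivative_partial:
  assumes "f differentiable at x"
  shows "((\<lambda>s. f (x + s *\<^sub>R v)) has_vector_derivative partial v f x) (at 0)"
proof -
  have "f \<circ> (\<lambda>s. x + s *\<^sub>R v) differentiable at 0"
    using assms by (intro differentiable_chain_at) auto
  then show ?thesis
    by (simp add: partial_def vector_derivative_works o_def)
qed

lemma partial_eq_0_outside:
  assumes "closed K" "\<And>x. x \<notin> K \<Longrightarrow> f x = 0" "x \<notin> K"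
  shows "partial v f x = 0"
  unfolding partial_def
  by (rule vector_derivative_at, rule has_vector_derivative_line_outside[OF assms])

lemma partial_const [simp]: "partial v (\<lambda>_. c) = (\<lambda>_. 0)"
  by (rule ext) (simp add: partial_def vector_derivative_const_at)

lemma C2_on_const: "C2_on S (\<lambda>_. c)"
  by (simp add: C2_on_def)

lemma hyp_laplacian_const: "hyp_laplacian (\<lambda>_. c) P = 0"
  by (simp add: hyp_laplacian_def)

lemma C2_on_continuous:
  assumes "C2_on S f"
  shows "continuous_on S f"
    and "v \<in> Basis \<Longrightarrow> continuous_on S (partial v f)"
    and "v \<in> Basis \<Longrightarrow> continuous_on S (partial v (partial v f))"
  using assms differentiable_imp_continuous_on unfolding C2_on_def by blast+

lemma C2_on_line_derivatives:
  assumes "C2_on S f" "open S" "x \<in> S" "v \<in> Basis"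
  shows "((\<lambda>s. f (x + s *\<^sub>R v)) has_vector_derivative partial v f x) (at 0)"
    and "((\<lambda>s. partial v f (x + s *\<^sub>R v)) has_vector_derivative partial v (partial v f) x) (at 0)"
proof -
  have "f differentiable_on S" "partial v f differentiable_on S"
    using assms unfolding C2_on_def by blast+
  then have "f differentiable at x" "partial v f differentiable at x"
    using assms(2,3) differentiable_on_eq_differentiable_at by blast+
  then show "((\<lambda>s. f (x + s *\<^sub>R v)) has_vector_derivative partial v f x) (at 0)"
    "((\<lambda>s. partial v f (x + s *\<^sub>R v)) has_vector_derivative partial v (partial v f) x) (at 0)"
    by (simp_all add: has_vector_derivative_partial)
qed

section \<open>The upper half-space\<close>

lemma open_hyp3: "open hyp3"
proof -
  have eq: "hyp3 = snd -` {0<..}" by (auto simp: hyp3_def)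
  show ?thesis unfolding eq by (rule open_vimage_snd) simp
qed

lemma Basis_complex_real: "(Basis :: (complex \<times> real) set) = {(1, 0), (\<i>, 0), (0, 1)}"
  by (auto simp: Basis_prod_def Basis_complex_def)

definition hcosh :: "complex \<times> real \<Rightarrow> complex \<times> real \<Rightarrow> real" where
  "hcosh P Q = ((cmod (fst P - fst Q))\<^sup>2 + (snd P)\<^sup>2 + (snd Q)\<^sup>2) / (2 * snd P * snd Q)"

lemma hcosh_commute: "hcosh P Q = hcosh Q P"
  by (simp add: hcosh_def norm_minus_commute algebra_simps)

lemma hcosh_refl: "P \<in> hyp3 \<Longrightarrow> hcosh P P = 1"
  by (simp add: hcosh_def hyp3_def power2_eq_square)

lemma dist_power2_eq_hcosh:
  assumes "P \<in> hyp3" "Q \<in> hyp3"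
  shows "(dist P Q)\<^sup>2 = 2 * snd P * snd Q * (hcosh P Q - 1)"
proof -
  have "(dist P Q)\<^sup>2 = (cmod (fst P - fst Q))\<^sup>2 + (snd P - snd Q)\<^sup>2"
    by (simp add: dist_prod_def) (simp add: dist_norm)
  moreover have "2 * snd P * snd Q * hcosh P Q = (cmod (fst P - fst Q))\<^sup>2 + (snd P)\<^sup>2 + (snd Q)\<^sup>2"
    using assms by (simp add: hcosh_def hyp3_def)
  ultimately show ?thesis
    by (simp add: power2_diff right_diff_distrib)
qed

lemma hcosh_ge_1:
  assumes "P \<in> hyp3" "Q \<in> hyp3" shows "hcosh P Q \<ge> 1"
proof -
  have "0 \<le> 2 * snd P * snd Q * (hcosh P Q - 1)"
    unfolding dist_power2_eq_hcosh[OF assms, symmetric] by simp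
  moreover have "2 * snd P * snd Q > 0" using assms by (simp add: hyp3_def)
  ultimately show ?thesis by (simp add: zero_le_mult_iff)
qed

lemma hcosh_nonpos_outside:
  assumes "P \<in> hyp3" "Q \<notin> hyp3" shows "hcosh P Q \<le> 0"
  unfolding hcosh_def
  using assms by (intro divide_nonneg_nonpos) (auto simp: hyp3_def mult_nonneg_nonpos)

lemma snd_le_hcosh:
  assumes "P \<in> hyp3" "Q \<in> hyp3"
  shows "snd Q \<le> 2 * hcosh P Q * snd P"
proof -
  have "(cmod (fst P - fst Q))\<^sup>2 + (snd P)\<^sup>2 + (snd Q)\<^sup>2 = 2 * hcosh P Q * snd P * snd Q"
    using assms by (simp add: hcosh_def hyp3_def)
  then have "(snd Q)\<^sup>2 \<le> 2 * hcosh P Q * snd P * snd Q"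
    using zero_le_power2[of "cmod (fst P - fst Q)"] zero_le_power2[of "snd P"] by linarith
  then show ?thesis using assms by (simp add: power2_eq_square hyp3_def)
qed

lemma dist_power2_le_hcosh:
  assumes "P \<in> hyp3" "Q \<in> hyp3" "hcosh P Q \<le> c"
  shows "(dist P Q)\<^sup>2 \<le> 4 * c * (snd P)\<^sup>2 * (c - 1)"
proof -
  have c: "1 \<le> hcosh P Q" using assms by (simp add: hcosh_ge_1)
  have "snd Q \<le> 2 * c * snd P"
    using snd_le_hcosh[OF assms(1,2)] assms c
    by (elim order_trans) (auto intro!: mult_right_mono simp: hyp3_def)
  then have "2 * snd P * snd Q * (hcosh P Q - 1) \<le> 2 * snd P * (2 * c * snd P) * (c - 1)"
    using assms c by (intro mult_mono mult_left_mono) (auto simp: hyp3_def)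
  also have "\<dots> = 4 * c * (snd P)\<^sup>2 * (c - 1)" by (simp add: power2_eq_square)
  finally show ?thesis unfolding dist_power2_eq_hcosh[OF assms(1,2)] .
qed

lemma continuous_on_hcosh [continuous_intros]:
  assumes "P \<in> hyp3" shows "continuous_on hyp3 (hcosh P)"
  unfolding hcosh_def using assms by (auto intro!: continuous_intros simp: hyp3_def)

lemma hcosh_triangle:
  assumes "P \<in> hyp3" "Q \<in> hyp3" "R \<in> hyp3"
  shows "hcosh P R \<le> 8 * hcosh P Q * hcosh Q R"
proof -
  define p q where pq: "p = hcosh P Q" "q = hcosh Q R"
  have y: "snd P > 0" "snd Q > 0" "snd R > 0" using assms by (simp_all add: hyp3_def)
  have p: "(cmod (fst P - fst Q))\<^sup>2 + (snd P)\<^sup>2 + (snd Q)\<^sup>2 = 2 * p * snd P * snd Q"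
    and q: "(cmod (fst Q - fst R))\<^sup>2 + (snd Q)\<^sup>2 + (snd R)\<^sup>2 = 2 * q * snd Q * snd R"
    using y by (simp_all add: pq hcosh_def)
  have "(cmod (fst P - fst R))\<^sup>2 \<le> 2 * (cmod (fst P - fst Q))\<^sup>2 + 2 * (cmod (fst Q - fst R))\<^sup>2"
    using norm_add_power2_le[of "fst P - fst Q" "fst Q - fst R"] by simp
  then have "(cmod (fst P - fst R))\<^sup>2 + (snd P)\<^sup>2 + (snd R)\<^sup>2
      \<le> 4 * p * snd P * snd Q + 4 * q * snd Q * snd R"
    using p q zero_le_power2[of "snd P"] zero_le_power2[of "snd Q"] zero_le_power2[of "snd R"]
    by linarith
  also have "\<dots> \<le> 4 * p * snd P * (2 * q * snd R) + 4 * q * (2 * p * snd P) * snd R"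
    using snd_le_hcosh[of P Q] snd_le_hcosh[of R Q] hcosh_ge_1[of P Q] hcosh_ge_1[of Q R] y assms
    unfolding hcosh_commute[of R Q] pq[symmetric]
    by (intro add_mono mult_left_mono mult_right_mono) auto
  also have "\<dots> = 8 * p * q * (2 * snd P * snd R)" by simp
  finally show ?thesis
    using y by (simp add: hcosh_def[of P R] pos_divide_le_eq flip: pq)
qed

text \<open>The truncation at \<open>1\<close> makes the distance to points outside the half-space \<open>0\<close>, so that
  kernels of the form \<open>f (hdist P Q) /\<^sub>R sinh (hdist P Q)\<close> vanish there.\<close>

definition hdist :: "complex \<times> real \<Rightarrow> complex \<times> real \<Rightarrow> real" where
  "hdist P Q = arcosh (max 1 (hcosh P Q))"

lemma hdist_nonneg [simp]: "hdist P Q \<ge> 0"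
  unfolding hdist_def by (simp add: arcosh_nonneg_real)

lemma hdist_commute: "hdist P Q = hdist Q P"
  by (simp add: hdist_def hcosh_commute)

lemma hdist_outside: "P \<in> hyp3 \<Longrightarrow> Q \<notin> hyp3 \<Longrightarrow> hdist P Q = 0"
  using hcosh_nonpos_outside[of P Q] unfolding hdist_def by (simp add: max_absorb1)

lemma cosh_hdist: "P \<in> hyp3 \<Longrightarrow> Q \<in> hyp3 \<Longrightarrow> cosh (hdist P Q) = hcosh P Q"
  unfolding hdist_def by (simp add: hcosh_ge_1 max_absorb2)

lemma hdist_less_iff:
  assumes "P \<in> hyp3" "Q \<in> hyp3" "r \<ge> 0"
  shows "hdist P Q < r \<longleftrightarrow> hcosh P Q < cosh r"
  using assms cosh_real_nonneg_less_iff[of "hdist P Q" r] by (simp add: cosh_hdist)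

lemma hdist_le_iff:
  assumes "P \<in> hyp3" "Q \<in> hyp3" "r \<ge> 0"
  shows "hdist P Q \<le> r \<longleftrightarrow> hcosh P Q \<le> cosh r"
  using assms cosh_real_nonneg_le_iff[of "hdist P Q" r] by (simp add: cosh_hdist)

definition hyp_ball :: "complex \<times> real \<Rightarrow> real \<Rightarrow> (complex \<times> real) set" where
  "hyp_ball P r = {Q \<in> hyp3. hdist P Q < r}"

definition hyp_cball :: "complex \<times> real \<Rightarrow> real \<Rightarrow> (complex \<times> real) set" where
  "hyp_cball P r = {Q \<in> hyp3. hdist P Q \<le> r}"

lemma hyp_cball_subset_hyp3: "hyp_cball P r \<subseteq> hyp3"
  by (auto simp: hyp_cball_def)

lemma center_in_hyp_cball: "P \<in> hyp3 \<Longrightarrow> 0 \<le> r \<Longrightarrow> P \<in> hyp_cball P r"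
  by (simp add: hyp_cball_def hdist_def hcosh_refl)

lemma hyp_ball_eq_hcosh: "P \<in> hyp3 \<Longrightarrow> r \<ge> 0 \<Longrightarrow> hyp_ball P r = {Q \<in> hyp3. hcosh P Q < cosh r}"
  by (auto simp: hyp_ball_def hdist_less_iff)

lemma hyp_cball_eq_hcosh: "P \<in> hyp3 \<Longrightarrow> r \<ge> 0 \<Longrightarrow> hyp_cball P r = {Q \<in> hyp3. hcosh P Q \<le> cosh r}"
  by (auto simp: hyp_cball_def hdist_le_iff)

lemma open_hyp_ball:
  assumes "P \<in> hyp3" shows "open (hyp_ball P r)"
proof -
  have "continuous_on hyp3 (hdist P)"
    unfolding hdist_def
    by (rule continuous_on_compose2[OF continuous_on_arcosh[OF order_refl]])
       (use assms in \<open>auto intro!: continuous_intros\<close>)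
  then have "open (hdist P -` {..<r} \<inter> hyp3)"
    using continuous_on_open_vimage[OF open_hyp3, of "hdist P"] by simp
  moreover have "hyp_ball P r = hdist P -` {..<r} \<inter> hyp3" by (auto simp: hyp_ball_def)
  ultimately show ?thesis by simp
qed

lemma compact_hyp_cball:
  assumes P: "P \<in> hyp3"
  shows "compact (hyp_cball P r)"
proof (cases "r \<ge> 0")
  case True
  define c where "c = cosh r"
  have c: "c \<ge> 1" by (simp add: c_def cosh_real_ge_1)
  have y: "snd P > 0" using P by (simp add: hyp3_def)
  define S where "S = {Q :: complex \<times> real. snd P / (2 * c) \<le> snd Q}"
  have S: "S \<subseteq> hyp3"
    using y c by (auto simp: S_def hyp3_def intro: less_le_trans[of 0 "snd P / (2 * c)"])
  have B: "hyp_cball P r = {Q \<in> hyp3. hcosh P Q \<le> c}"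
    using P True by (simp add: hyp_cball_eq_hcosh c_def)
  have "Q \<in> S" if "Q \<in> hyp_cball P r" for Q
  proof -
    have "snd P \<le> 2 * hcosh Q P * snd Q" using that P by (intro snd_le_hcosh) (auto simp: B)
    also have "\<dots> \<le> 2 * c * snd Q"
      using that by (intro mult_right_mono) (auto simp: B hcosh_commute hyp3_def)
    finally show ?thesis using c by (simp add: S_def field_simps)
  qed
  then have "hyp_cball P r = {Q \<in> S. hcosh P Q \<le> c}" using S by (auto simp: B)
  moreover have "closed {Q \<in> S. hcosh P Q \<le> c}"
  proof (rule continuous_on_closed_Collect_le)
    show "continuous_on S (hcosh P)"
      using continuous_on_subset[OF continuous_on_hcosh[OF P] S] .
    show "closed S" unfolding S_def by (intro closed_Collect_le continuous_intros)
  qed auto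
  moreover have "bounded (hyp_cball P r)"
  proof (rule bounded_subset[OF bounded_cball])
    show "hyp_cball P r \<subseteq> cball P (sqrt (4 * c * (snd P)\<^sup>2 * (c - 1)))"
      using dist_power2_le_hcosh[OF P] by (auto simp: B intro!: real_le_rsqrt)
  qed
  ultimately show ?thesis by (simp add: compact_eq_bounded_closed)
next
  case False
  have "Q \<notin> hyp_cball P r" for Q
    using False hdist_nonneg[of P Q] unfolding hyp_cball_def by (simp del: hdist_nonneg)
  then have "hyp_cball P r = {}" by blast
  then show ?thesis by (simp only: compact_empty)
qed

lemma open_contains_hyp_cball:
  assumes P: "P \<in> hyp3" and U: "open U" "P \<in> U"
  obtains r where "r > 0" "hyp_cball P r \<subseteq> U"
proof -
  obtain e where e: "e > 0" "ball P e \<subseteq> U" using U open_contains_ball by blast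
  have y: "snd P > 0" using P by (simp add: hyp3_def)
  define c where "c = 1 + min 1 (e\<^sup>2 / (16 * (snd P)\<^sup>2))"
  have c: "1 < c" "c \<le> 2" "c - 1 \<le> e\<^sup>2 / (16 * (snd P)\<^sup>2)" using e y by (auto simp: c_def)
  have "hyp_cball P (arcosh c) \<subseteq> U"
  proof
    fix Q assume "Q \<in> hyp_cball P (arcosh c)"
    then have Q: "Q \<in> hyp3" "hcosh P Q \<le> c" using P c by (auto simp: hyp_cball_eq_hcosh)
    have "(dist P Q)\<^sup>2 \<le> 4 * c * (snd P)\<^sup>2 * (c - 1)" using P Q by (rule dist_power2_le_hcosh)
    also have "\<dots> \<le> 4 * 2 * (snd P)\<^sup>2 * (e\<^sup>2 / (16 * (snd P)\<^sup>2))"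
      using c by (intro mult_mono) auto
    also have "\<dots> < e\<^sup>2" using y e by (simp add: field_simps)
    finally have "dist P Q < e" using e by (simp add: power2_less_imp_less)
    then show "Q \<in> U" using e by auto
  qed
  moreover have "arcosh c > 0" using c by simp
  ultimately show ?thesis using that by blast
qed

section \<open>The hyperbolic Laplacian\<close>

lemma sets_hyp_vol [simp, measurable_cong]: "sets hyp_vol = sets borel"
  by (simp add: hyp_vol_def)

lemma space_hyp_vol [simp]: "space hyp_vol = UNIV"
  by (simp add: hyp_vol_def)

lemma hyp3_borel [measurable]: "hyp3 \<in> sets borel"
  using open_hyp3 by simp

lemma fst_borel [measurable]:
  "(fst :: 'a::second_countable_topology \<times> 'b::second_countable_topology \<Rightarrow> 'a) \<in> borel_measurable borel"
  by (auto simp: borel_prod[symmetric])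

lemma snd_borel [measurable]:
  "(snd :: 'a::second_countable_topology \<times> 'b::second_countable_topology \<Rightarrow> 'b) \<in> borel_measurable borel"
  by (auto simp: borel_prod[symmetric])

lemma integral_hyp_vol:
  fixes f :: "complex \<times> real \<Rightarrow> 'b::{banach, second_countable_topology}"
  assumes [measurable]: "f \<in> borel_measurable borel"
  shows "(\<integral>Q. f Q \<partial>hyp_vol) = (\<integral>Q. (indicator hyp3 Q / snd Q ^ 3) *\<^sub>R f Q \<partial>lborel)"
  unfolding hyp_vol_def by (subst integral_density) (auto split: split_indicator simp: hyp3_def)

lemma hyp_laplacian_eq_0_outside:
  assumes "closed K" "\<And>Q. Q \<notin> K \<Longrightarrow> f Q = 0" "Q \<notin> K"
  shows "hyp_laplacian f Q = 0"
proof -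
  have partial: "partial v f Q = 0" if "Q \<notin> K" for v Q
    using assms(1,2) that by (rule partial_eq_0_outside)
  have "partial v (partial v f) Q = 0" if "Q \<notin> K" for v Q
    using assms(1) partial that by (rule partial_eq_0_outside)
  then show ?thesis
    using partial assms(3) by (simp add: hyp_laplacian_def Let_def)
qed

definition green_field ::
  "(complex \<times> real \<Rightarrow> complex) \<Rightarrow> (complex \<times> real \<Rightarrow> complex) \<Rightarrow> complex \<times> real \<Rightarrow> complex \<times> real \<Rightarrow> complex"
  where "green_field u \<phi> v Q = (\<phi> Q * partial v u Q - u Q * partial v \<phi> Q) /\<^sub>R snd Q"

definition green_field_partial ::
  "(complex \<times> real \<Rightarrow> complex) \<Rightarrow> (complex \<times> real \<Rightarrow> complex) \<Rightarrow> complex \<times> real \<Rightarrow> complex \<times> real \<Rightarrow> complex"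
  where "green_field_partial u \<phi> v Q
    = (\<phi> Q * partial v (partial v u) Q - u Q * partial v (partial v \<phi>) Q) /\<^sub>R snd Q
      - (snd v / (snd Q)\<^sup>2) *\<^sub>R (\<phi> Q * partial v u Q - u Q * partial v \<phi> Q)"

lemma has_vector_derivative_green_field:
  assumes u: "C2_on hyp3 u" and \<phi>: "C2_on hyp3 \<phi>" and Q: "Q \<in> hyp3" and v: "v \<in> Basis"
  shows "((\<lambda>s. green_field u \<phi> v (Q + s *\<^sub>R v)) has_vector_derivative green_field_partial u \<phi> v Q) (at 0)"
proof -
  have dy: "((\<lambda>s. inverse (snd (Q + s *\<^sub>R v))) has_real_derivative - (snd v / (snd Q)\<^sup>2)) (at 0)"
    using Q by (auto intro!: derivative_eq_intros simp: hyp3_def power2_eq_square divide_inverse)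
  show ?thesis
    unfolding green_field_def green_field_partial_def
    by (rule derivative_eq_intros dy C2_on_line_derivatives[OF u open_hyp3 Q v]
          C2_on_line_derivatives[OF \<phi> open_hyp3 Q v] refl)+
       (simp add: algebra_simps)
qed

lemma continuous_on_green_field:
  assumes u: "C2_on hyp3 u" and \<phi>: "C2_on hyp3 \<phi>" and v: "v \<in> Basis"
  shows "continuous_on hyp3 (green_field u \<phi> v)" "continuous_on hyp3 (green_field_partial u \<phi> v)"
proof -
  have y: "\<forall>Q\<in>hyp3. snd Q \<noteq> 0" by (auto simp: hyp3_def)
  note cont = C2_on_continuous(1)[OF u] C2_on_continuous(2,3)[OF u v]
    C2_on_continuous(1)[OF \<phi>] C2_on_continuous(2,3)[OF \<phi> v]
  show "continuous_on hyp3 (green_field u \<phi> v)" "continuous_on hyp3 (green_field_partial u \<phi> v)"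
    unfolding green_field_def green_field_partial_def using y by (auto intro!: continuous_intros cont)
qed

lemma green_field_divergence:
  assumes "Q \<in> hyp3"
  shows "(\<Sum>v\<in>Basis. green_field_partial u \<phi> v Q)
    = (1 / snd Q ^ 3) *\<^sub>R (\<phi> Q * hyp_laplacian u Q - u Q * hyp_laplacian \<phi> Q)"
proof -
  have "complex_of_real (snd Q) \<noteq> 0" using assms by (simp add: hyp3_def)
  then show ?thesis
    unfolding Basis_complex_real green_field_partial_def hyp_laplacian_def Let_def
    by (simp add: scaleR_conv_of_real field_simps power2_eq_square power3_eq_cube)
qed

lemma green_field_eq_0_outside:
  assumes "closed K" "\<And>Q. Q \<notin> K \<Longrightarrow> \<phi> Q = 0" "Q \<notin> K"
  shows "green_field u \<phi> v Q = 0" "green_field_partial u \<phi> v Q = 0"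
proof -
  have partial: "partial v \<phi> Q = 0" if "Q \<notin> K" for Q
    using assms(1,2) that by (rule partial_eq_0_outside)
  have "partial v (partial v \<phi>) Q = 0"
    using assms(1) partial assms(3) by (rule partial_eq_0_outside)
  then show "green_field u \<phi> v Q = 0" "green_field_partial u \<phi> v Q = 0"
    using assms(2,3) partial by (simp_all add: green_field_def green_field_partial_def)
qed

lemma integral_hyp_laplacian_symmetric:
  assumes u: "C2_on hyp3 u" and \<phi>: "C2_on hyp3 \<phi>"
    and K: "compact K" "K \<subseteq> hyp3" and supp: "\<And>Q. Q \<notin> K \<Longrightarrow> \<phi> Q = 0"
  shows "(\<integral>Q. \<phi> Q * hyp_laplacian u Q - u Q * hyp_laplacian \<phi> Q \<partial>hyp_vol) = 0"
proof -
  define E where "E = (\<lambda>Q. \<phi> Q * hyp_laplacian u Q - u Q * hyp_laplacian \<phi> Q)"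
  let ?W = "green_field u \<phi>" and ?D = "green_field_partial u \<phi>"
  note closed = compact_imp_closed[OF K(1)]
  have outside: "?W v Q = 0" "?D v Q = 0" "E Q = 0" if "Q \<notin> K" for v Q
    using green_field_eq_0_outside[OF closed supp that] hyp_laplacian_eq_0_outside[OF closed supp that] supp[OF that]
    by (simp_all add: E_def)
  note extend = continuous_on_UNIV_zero_extension[OF open_hyp3 closed K(2)]
  have D: "continuous_on UNIV (?D v)" if "v \<in> Basis" for v
    using continuous_on_green_field(2)[OF u \<phi> that] outside(2) by (rule extend)
  have int_D: "(\<integral>Q. ?D v Q \<partial>lborel) = 0" if v: "v \<in> Basis" for v
  proof (rule integral_directional_derivative_eq_0[OF _ _ D[OF v] K(1) outside(1)])
    show "continuous_on UNIV (?W v)"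
      using continuous_on_green_field(1)[OF u \<phi> v] outside(1) by (rule extend)
    show "((\<lambda>s. ?W v (Q + s *\<^sub>R v)) has_vector_derivative ?D v Q) (at 0)" for Q
    proof (cases "Q \<in> K")
      case True
      then show ?thesis using has_vector_derivative_green_field[OF u \<phi> _ v] K(2) by blast
    next
      case False
      then show ?thesis using has_vector_derivative_line_outside[OF closed outside(1)] outside(2) by simp
    qed
  qed
  have "(indicator hyp3 Q / snd Q ^ 3) *\<^sub>R E Q = (\<Sum>v\<in>Basis. ?D v Q)" for Q
  proof (cases "Q \<in> hyp3")
    case False
    then have "Q \<notin> K" using K(2) by blast
    then show ?thesis by (simp add: outside)
  qed (simp add: green_field_divergence E_def)
  moreover have "continuous_on UNIV E"
  proof (rule extend)
    show "continuous_on hyp3 E"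
      unfolding E_def hyp_laplacian_def Let_def
      using C2_on_continuous[OF u] C2_on_continuous[OF \<phi>]
      by (intro continuous_intros) (simp_all add: Basis_complex_real)
  qed (rule outside)
  ultimately have "(\<integral>Q. E Q \<partial>hyp_vol) = (\<integral>Q. (\<Sum>v\<in>Basis. ?D v Q) \<partial>lborel)"
    by (simp only: integral_hyp_vol borel_measurable_continuous_onI)
  also have "\<dots> = (\<Sum>v\<in>Basis. \<integral>Q. ?D v Q \<partial>lborel)"
    using D outside(2) K(1) by (intro Bochner_Integration.integral_sum integrable_lborel_compact_support)
  finally show ?thesis using int_D by (simp add: E_def)
qed

lemma integral_hyp_laplacian_eigenfunction_eq_0:
  assumes u: "C2_on hyp3 u" and ev: "\<And>Q. Q \<in> hyp3 \<Longrightarrow> - hyp_laplacian u Q = ev * u Q"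
    and \<phi>: "C2_on hyp3 \<phi>" and K: "compact K" "K \<subseteq> hyp3" and supp: "\<And>Q. Q \<notin> K \<Longrightarrow> \<phi> Q = 0"
  shows "(\<integral>Q. u Q * (hyp_laplacian \<phi> Q + ev * \<phi> Q) \<partial>hyp_vol) = 0"
proof -
  have "\<phi> Q * hyp_laplacian u Q - u Q * hyp_laplacian \<phi> Q = - (u Q * (hyp_laplacian \<phi> Q + ev * \<phi> Q))" for Q
  proof (cases "Q \<in> hyp3")
    case True
    then have "hyp_laplacian u Q = - (ev * u Q)" using ev[OF True] by (metis minus_minus)
    then show ?thesis by (simp add: algebra_simps)
  next
    case False
    then have "Q \<notin> K" using K(2) by blast
    then have "\<phi> Q = 0" by (rule supp)
    then show ?thesis by (simp add: algebra_simps)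
  qed
  then have "(\<integral>Q. - (u Q * (hyp_laplacian \<phi> Q + ev * \<phi> Q)) \<partial>hyp_vol) = 0"
    using integral_hyp_laplacian_symmetric[OF u \<phi> K supp] by simp
  then show ?thesis unfolding Bochner_Integration.integral_minus by simp
qed

section \<open>Radial functions\<close>

definition hcosh_partial :: "complex \<times> real \<Rightarrow> complex \<times> real \<Rightarrow> complex \<times> real \<Rightarrow> real" where
  "hcosh_partial P v Q = ((fst Q - fst P) \<bullet> fst v + snd Q * snd v) / (snd P * snd Q)
     - hcosh P Q * snd v / snd Q"

definition hcosh_partial2 ::
  "complex \<times> real \<Rightarrow> complex \<times> real \<Rightarrow> complex \<times> real \<Rightarrow> complex \<times> real \<Rightarrow> real" where
  "hcosh_partial2 P v w Q = (fst w \<bullet> fst v + snd w * snd v) / (snd P * snd Q)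
     - ((fst Q - fst P) \<bullet> fst v + snd Q * snd v) * snd w / (snd P * (snd Q)\<^sup>2)
     - hcosh_partial P w Q * snd v / snd Q + hcosh P Q * snd v * snd w / (snd Q)\<^sup>2"

lemma has_derivative_hcosh:
  assumes "P \<in> hyp3" "Q \<in> hyp3"
  shows "(hcosh P has_derivative (\<lambda>v. hcosh_partial P v Q)) (at Q)"
proof -
  have y: "snd P \<noteq> 0" "snd Q \<noteq> 0" using assms by (auto simp: hyp3_def)
  have num: "((\<lambda>Q. (fst P - fst Q) \<bullet> (fst P - fst Q) + (snd P)\<^sup>2 + (snd Q)\<^sup>2) has_derivative
      (\<lambda>v. 2 * ((fst Q - fst P) \<bullet> fst v + snd Q * snd v))) (at Q)"
    by (auto intro!: derivative_eq_intros simp: fun_eq_iff inner_diff_left inner_diff_right inner_commute)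
  have den: "((\<lambda>Q. 2 * snd P * snd Q) has_derivative (\<lambda>v. 2 * snd P * snd v)) (at Q)"
    by (auto intro!: derivative_eq_intros)
  have "((\<lambda>Q. ((fst P - fst Q) \<bullet> (fst P - fst Q) + (snd P)\<^sup>2 + (snd Q)\<^sup>2) / (2 * snd P * snd Q)) has_derivative
      (\<lambda>v. hcosh_partial P v Q)) (at Q)"
  proof (rule has_derivative_eq_rhs[OF has_derivative_divide'[OF num den]])
    show "(\<lambda>v. (2 * ((fst Q - fst P) \<bullet> fst v + snd Q * snd v) * (2 * snd P * snd Q)
        - ((fst P - fst Q) \<bullet> (fst P - fst Q) + (snd P)\<^sup>2 + (snd Q)\<^sup>2) * (2 * snd P * snd v))
        / (2 * snd P * snd Q * (2 * snd P * snd Q))) = (\<lambda>v. hcosh_partial P v Q)"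
      using y unfolding hcosh_partial_def hcosh_def power2_norm_eq_inner
      by (simp add: fun_eq_iff divide_simps) (simp add: algebra_simps)
  qed (use y in simp)
  then show ?thesis by (simp add: hcosh_def[abs_def] power2_norm_eq_inner)
qed

lemma has_derivative_hcosh_partial:
  assumes "P \<in> hyp3" "Q \<in> hyp3"
  shows "(hcosh_partial P v has_derivative (\<lambda>w. hcosh_partial2 P v w Q)) (at Q)"
proof -
  have y: "snd P \<noteq> 0" "snd Q \<noteq> 0" using assms by (auto simp: hyp3_def)
  have num: "((\<lambda>Q. (fst Q - fst P) \<bullet> fst v + snd Q * snd v) has_derivative
      (\<lambda>w. fst w \<bullet> fst v + snd w * snd v)) (at Q)"
    by (auto intro!: derivative_eq_intros)
  have den: "((\<lambda>Q. snd P * snd Q) has_derivative (\<lambda>w. snd P * snd w)) (at Q)"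
    "(snd has_derivative (\<lambda>w. snd w)) (at Q)"
    by (auto intro!: derivative_eq_intros)
  have hcosh: "((\<lambda>Q. hcosh P Q * snd v) has_derivative (\<lambda>w. hcosh_partial P w Q * snd v)) (at Q)"
    by (intro has_derivative_mult_left has_derivative_hcosh assms)
  show ?thesis
    unfolding hcosh_partial_def[abs_def]
  proof (rule has_derivative_eq_rhs[OF has_derivative_diff[OF
          has_derivative_divide'[OF num den(1)] has_derivative_divide'[OF hcosh den(2)]]])
    show "(\<lambda>w. ((fst w \<bullet> fst v + snd w * snd v) * (snd P * snd Q)
          - ((fst Q - fst P) \<bullet> fst v + snd Q * snd v) * (snd P * snd w)) / (snd P * snd Q * (snd P * snd Q))
        - (hcosh_partial P w Q * snd v * snd Q - hcosh P Q * snd v * snd w) / (snd Q * snd Q))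
      = (\<lambda>w. hcosh_partial2 P v w Q)"
      using y unfolding hcosh_partial2_def
      by (simp add: fun_eq_iff divide_simps power2_eq_square) (simp add: algebra_simps)
  qed (use y in auto)
qed

lemma hcosh_gradient:
  assumes "P \<in> hyp3" "Q \<in> hyp3"
  shows "(snd Q)\<^sup>2 * (\<Sum>v\<in>Basis. (hcosh_partial P v Q)\<^sup>2) = (hcosh P Q)\<^sup>2 - 1"
proof -
  define a b h y where defs: "a = Re (fst Q) - Re (fst P)" "b = Im (fst Q) - Im (fst P)"
    "h = snd P" "y = snd Q"
  have y: "h > 0" "y > 0" using assms by (simp_all add: defs hyp3_def)
  have hcosh: "hcosh P Q = (a\<^sup>2 + b\<^sup>2 + h\<^sup>2 + y\<^sup>2) / (2 * h * y)"
    unfolding hcosh_def cmod_power2 defs by (simp add: power2_commute)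
  show ?thesis
    unfolding hcosh_partial_def hcosh inner_complex_def Basis_complex_real
    by (simp add: defs[symmetric]) (use y in \<open>simp add: divide_simps\<close>, algebra)
qed

lemma hcosh_laplacian:
  assumes "P \<in> hyp3" "Q \<in> hyp3"
  shows "(snd Q)\<^sup>2 * (\<Sum>v\<in>Basis. hcosh_partial2 P v v Q) - snd Q * hcosh_partial P (0, 1) Q = 3 * hcosh P Q"
proof -
  define a b h y where defs: "a = Re (fst Q) - Re (fst P)" "b = Im (fst Q) - Im (fst P)"
    "h = snd P" "y = snd Q"
  have y: "h > 0" "y > 0" using assms by (simp_all add: defs hyp3_def)
  have hcosh: "hcosh P Q = (a\<^sup>2 + b\<^sup>2 + h\<^sup>2 + y\<^sup>2) / (2 * h * y)"
    unfolding hcosh_def cmod_power2 defs by (simp add: power2_commute)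
  show ?thesis
    unfolding hcosh_partial2_def hcosh_partial_def hcosh inner_complex_def Basis_complex_real
    by (simp add: defs[symmetric]) (use y in \<open>simp add: divide_simps\<close>, algebra)
qed

lemma has_derivative_hcosh_compose:
  fixes f f' :: "real \<Rightarrow> complex"
  assumes "P \<in> hyp3" "Q \<in> hyp3" "\<And>x. (f has_vector_derivative f' x) (at x)"
  shows "((\<lambda>Q. f (hcosh P Q)) has_derivative (\<lambda>v. hcosh_partial P v Q *\<^sub>R f' (hcosh P Q))) (at Q)"
  using has_derivative_compose[OF has_derivative_hcosh[OF assms(1,2)]] assms(3)
  unfolding has_vector_derivative_def by blast

context
  fixes P :: "complex \<times> real" and g g1 g2 :: "real \<Rightarrow> complex"
  assumes P: "P \<in> hyp3"
    and g: "\<And>x. (g has_vector_derivative g1 x) (at x)"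
    and g1: "\<And>x. (g1 has_vector_derivative g2 x) (at x)"
    and g2: "continuous_on UNIV g2"
begin

lemma partial_hcosh_compose:
  assumes "Q \<in> hyp3"
  shows "partial v (\<lambda>Q. g (hcosh P Q)) Q = hcosh_partial P v Q *\<^sub>R g1 (hcosh P Q)"
  by (rule partial_eq[OF has_derivative_hcosh_compose[OF P assms g]])

lemma has_derivative_partial_hcosh_compose:
  assumes Q: "Q \<in> hyp3"
  shows "(partial v (\<lambda>Q. g (hcosh P Q)) has_derivative
    (\<lambda>w. hcosh_partial2 P v w Q *\<^sub>R g1 (hcosh P Q)
      + (hcosh_partial P v Q * hcosh_partial P w Q) *\<^sub>R g2 (hcosh P Q))) (at Q)"
proof (rule has_derivative_transform_within_open[OF _ open_hyp3 Q])
  show "((\<lambda>Q. hcosh_partial P v Q *\<^sub>R g1 (hcosh P Q)) has_derivative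
      (\<lambda>w. hcosh_partial2 P v w Q *\<^sub>R g1 (hcosh P Q)
        + (hcosh_partial P v Q * hcosh_partial P w Q) *\<^sub>R g2 (hcosh P Q))) (at Q)"
    by (rule has_derivative_eq_rhs[OF has_derivative_scaleR[OF
          has_derivative_hcosh_partial[OF P Q] has_derivative_hcosh_compose[OF P Q g1]]])
       (simp add: fun_eq_iff)
qed (simp add: partial_hcosh_compose)

lemma partial_partial_hcosh_compose:
  assumes "Q \<in> hyp3"
  shows "partial w (partial v (\<lambda>Q. g (hcosh P Q))) Q = hcosh_partial2 P v w Q *\<^sub>R g1 (hcosh P Q)
    + (hcosh_partial P v Q * hcosh_partial P w Q) *\<^sub>R g2 (hcosh P Q)"
  by (rule partial_eq[OF has_derivative_partial_hcosh_compose[OF assms]])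

lemma C2_on_hcosh_compose: "C2_on hyp3 (\<lambda>Q. g (hcosh P Q))"
  unfolding C2_on_def
proof (intro conjI ballI)
  show "(\<lambda>Q. g (hcosh P Q)) differentiable_on hyp3" "partial v (\<lambda>Q. g (hcosh P Q)) differentiable_on hyp3" for v
    unfolding differentiable_on_eq_differentiable_at[OF open_hyp3] differentiable_def
    using has_derivative_hcosh_compose[OF P _ g] has_derivative_partial_hcosh_compose by blast+
  have y: "snd P \<noteq> 0" "\<forall>Q\<in>hyp3. snd Q \<noteq> 0" using P by (auto simp: hyp3_def)
  note compose_cont = continuous_on_compose2[OF _ continuous_on_hcosh[OF P] subset_UNIV]
  have "continuous_on hyp3 (hcosh_partial P v)" for v
    unfolding hcosh_partial_def using y P by (intro continuous_intros) simp_all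
  moreover have "continuous_on hyp3 (hcosh_partial2 P v w)" for v w
    unfolding hcosh_partial2_def hcosh_partial_def using y P by (intro continuous_intros) simp_all
  ultimately have "continuous_on hyp3 (\<lambda>Q. hcosh_partial2 P v w Q *\<^sub>R g1 (hcosh P Q)
      + (hcosh_partial P v Q * hcosh_partial P w Q) *\<^sub>R g2 (hcosh P Q))" for v w
    using has_vector_derivative_imp_continuous_on_UNIV[OF g1] g2
    by (intro continuous_intros compose_cont)
  then show "continuous_on hyp3 (partial w (partial v (\<lambda>Q. g (hcosh P Q))))" for v w
    by (subst continuous_on_cong[OF refl partial_partial_hcosh_compose])
qed

lemma hyp_laplacian_hcosh_compose:
  assumes Q: "Q \<in> hyp3"
  shows "hyp_laplacian (\<lambda>Q. g (hcosh P Q)) Q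
    = ((hcosh P Q)\<^sup>2 - 1) *\<^sub>R g2 (hcosh P Q) + (3 * hcosh P Q) *\<^sub>R g1 (hcosh P Q)"
proof -
  have "hyp_laplacian (\<lambda>Q. g (hcosh P Q)) Q
    = ((snd Q)\<^sup>2 * (\<Sum>v\<in>Basis. (hcosh_partial P v Q)\<^sup>2)) *\<^sub>R g2 (hcosh P Q)
      + ((snd Q)\<^sup>2 * (\<Sum>v\<in>Basis. hcosh_partial2 P v v Q) - snd Q * hcosh_partial P (0, 1) Q) *\<^sub>R g1 (hcosh P Q)"
    unfolding hyp_laplacian_def Let_def Basis_complex_real
      partial_hcosh_compose[OF Q] partial_partial_hcosh_compose[OF Q]
    by (simp add: scaleR_conv_of_real power2_eq_square algebra_simps)
  then show ?thesis unfolding hcosh_gradient[OF P Q] hcosh_laplacian[OF P Q] .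
qed

end

lemma has_vector_derivative_arcosh_compose:
  fixes f f' :: "real \<Rightarrow> 'a::real_normed_vector"
  assumes f: "\<And>r. (f has_vector_derivative f' r) (at r)"
    and a: "a > 0" and zero: "\<And>r. r < a \<Longrightarrow> f r = 0 \<and> f' r = 0"
  shows "((\<lambda>x. f (arcosh (max 1 x))) has_vector_derivative
    f' (arcosh (max 1 x)) /\<^sub>R sinh (arcosh (max 1 x))) (at x)"
proof (cases "x < cosh a")
  case True
  have small: "arcosh (max 1 y) < a" if "y < cosh a" for y
  proof -
    have "1 < cosh a" using a cosh_real_nonneg_less_iff[of 0 a] by simp
    then have "arcosh (max 1 y) < arcosh (cosh a)"
      using that by (subst arcosh_less_iff_real) auto
    then show ?thesis using a by (simp add: arcosh_cosh_real)
  qed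
  have "((\<lambda>x. f (arcosh (max 1 x))) has_vector_derivative 0) (at x)"
    by (rule has_vector_derivative_transform_within_open[OF has_vector_derivative_const, where S = "{..<cosh a}"])
       (use True zero small in auto)
  then show ?thesis using zero small[OF True] by simp
next
  case False
  then have x: "x > 1" using a cosh_real_nonneg_less_iff[of 0 a] by simp
  have "(arcosh has_real_derivative 1 / sinh (arcosh x)) (at x)"
    using x by (auto intro!: derivative_eq_intros simp: sinh_arcosh_real)
  then have "(arcosh has_vector_derivative 1 / sinh (arcosh x)) (at x)"
    by (simp add: has_real_derivative_iff_has_vector_derivative)
  from vector_diff_chain_at[OF this f]
  have "((\<lambda>x. f (arcosh x)) has_vector_derivative f' (arcosh x) /\<^sub>R sinh (arcosh x)) (at x)"
    by (simp add: o_def divide_inverse)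
  then have "((\<lambda>x. f (arcosh (max 1 x))) has_vector_derivative f' (arcosh x) /\<^sub>R sinh (arcosh x)) (at x)"
    by (rule has_vector_derivative_transform_within_open[where S = "{1<..}"]) (use x in auto)
  then show ?thesis using x by simp
qed

lemma has_vector_derivative_scaleR_inverse_sinh:
  fixes f f' :: "real \<Rightarrow> 'a::real_normed_vector"
  assumes f: "\<And>r. (f has_vector_derivative f' r) (at r)"
    and a: "a > 0" and zero: "\<And>r. r < a \<Longrightarrow> f r = 0 \<and> f' r = 0"
  shows "((\<lambda>r. f r /\<^sub>R sinh r) has_vector_derivative (f' r - cosh r *\<^sub>R (f r /\<^sub>R sinh r)) /\<^sub>R sinh r) (at r)"
proof (cases "r < a")
  case True
  have "((\<lambda>r. f r /\<^sub>R sinh r) has_vector_derivative 0) (at r)"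
    by (rule has_vector_derivative_transform_within_open[OF has_vector_derivative_const, where S = "{..<a}"])
       (use True zero in auto)
  then show ?thesis using True zero by simp
next
  case False
  then have "sinh r \<noteq> 0" using a by simp
  then have "((\<lambda>r. inverse (sinh r)) has_real_derivative - (cosh r / (sinh r)\<^sup>2)) (at r)"
    by (auto intro!: derivative_eq_intros simp: power2_eq_square divide_inverse)
  from has_vector_derivative_scaleR[OF this f[of r]] show ?thesis
    by (simp add: power2_eq_square divide_inverse scaleR_diff_right algebra_simps)
qed

lemma ex_derivatives_radial_profile:
  fixes F F1 F2 :: "real \<Rightarrow> complex"
  assumes F: "\<And>r. (F has_vector_derivative F1 r) (at r)"
    and F1: "\<And>r. (F1 has_vector_derivative F2 r) (at r)"
    and F2: "continuous_on UNIV F2"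
    and a: "a > 0" and zero: "\<And>r. r < a \<Longrightarrow> F r = 0 \<and> F1 r = 0 \<and> F2 r = 0"
  shows "\<exists>g1 g2.
    (\<forall>x. ((\<lambda>x. F (arcosh (max 1 x)) /\<^sub>R sinh (arcosh (max 1 x))) has_vector_derivative g1 x) (at x))
    \<and> (\<forall>x. (g1 has_vector_derivative g2 x) (at x)) \<and> continuous_on UNIV g2
    \<and> (\<forall>r\<ge>0. (sinh r)\<^sup>2 *\<^sub>R g2 (cosh r) + (3 * cosh r) *\<^sub>R g1 (cosh r) = (F2 r - F r) /\<^sub>R sinh r)"
proof -
  define \<Phi> where "\<Phi> r = F r /\<^sub>R sinh r" for r
  define \<Phi>' where "\<Phi>' r = (F1 r - cosh r *\<^sub>R \<Phi> r) /\<^sub>R sinh r" for r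
  define \<Phi>'' where "\<Phi>'' r = (F2 r - sinh r *\<^sub>R \<Phi> r - (2 * cosh r) *\<^sub>R \<Phi>' r) /\<^sub>R sinh r" for r
  define \<Psi> where "\<Psi> r = (\<Phi>'' r - cosh r *\<^sub>R (\<Phi>' r /\<^sub>R sinh r)) /\<^sub>R sinh r" for r
  let ?arcosh = "\<lambda>x :: real. arcosh (max 1 x)"
  define g1 where "g1 x = \<Phi>' (?arcosh x) /\<^sub>R sinh (?arcosh x)" for x
  define g2 where "g2 x = \<Psi> (?arcosh x) /\<^sub>R sinh (?arcosh x)" for x
  have zero': "\<Phi> r = 0" "\<Phi>' r = 0" "\<Phi>'' r = 0" "\<Psi> r = 0" if "r < a" for r
    using zero[OF that] by (simp_all add: \<Phi>_def \<Phi>'_def \<Phi>''_def \<Psi>_def)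
  have \<Phi>: "(\<Phi> has_vector_derivative \<Phi>' r) (at r)" for r
    using has_vector_derivative_scaleR_inverse_sinh[OF F a] zero unfolding \<Phi>_def \<Phi>'_def by blast
  have "((\<lambda>r. F1 r - cosh r *\<^sub>R \<Phi> r) has_vector_derivative F2 r - (sinh r *\<^sub>R \<Phi> r + cosh r *\<^sub>R \<Phi>' r)) (at r)" for r
    by (rule derivative_eq_intros F1 \<Phi> refl)+ simp
  from has_vector_derivative_scaleR_inverse_sinh[OF this a]
  have \<Phi>': "(\<Phi>' has_vector_derivative \<Phi>'' r) (at r)" for r
    using zero zero' unfolding \<Phi>'_def[abs_def, symmetric] \<Phi>'_def[symmetric] \<Phi>''_def
    by (simp add: scaleR_conv_of_real algebra_simps)
  have \<Psi>: "((\<lambda>r. \<Phi>' r /\<^sub>R sinh r) has_vector_derivative \<Psi> r) (at r)" for r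
    using has_vector_derivative_scaleR_inverse_sinh[OF \<Phi>' a] zero' unfolding \<Psi>_def by blast
  have g: "((\<lambda>x. \<Phi> (?arcosh x)) has_vector_derivative g1 x) (at x)" for x
    unfolding g1_def using zero' by (intro has_vector_derivative_arcosh_compose[OF \<Phi> a]) auto
  have g1: "(g1 has_vector_derivative g2 x) (at x)" for x
    unfolding g1_def g2_def using zero' by (intro has_vector_derivative_arcosh_compose[OF \<Psi> a]) auto
  have "continuous_on UNIV (\<lambda>r. \<Psi> r /\<^sub>R sinh r)"
  proof (rule continuous_on_UNIV_zero_extension[where S = "{0<..}" and K = "{a..}"])
    show "continuous_on {0<..} (\<lambda>r. \<Psi> r /\<^sub>R sinh r)"
      unfolding \<Psi>_def \<Phi>''_def
      by (intro continuous_intros; (rule continuous_on_subset[OF _ subset_UNIV],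
          intro F2 has_vector_derivative_imp_continuous_on_UNIV[OF \<Phi>] has_vector_derivative_imp_continuous_on_UNIV[OF \<Phi>'])?) auto
  qed (use a zero' in auto)
  then have g2: "continuous_on UNIV g2"
    unfolding g2_def by (rule continuous_on_compose2) (auto intro!: continuous_intros)
  have "(sinh r)\<^sup>2 *\<^sub>R g2 (cosh r) + (3 * cosh r) *\<^sub>R g1 (cosh r) = (F2 r - F r) /\<^sub>R sinh r" if "r \<ge> 0" for r
    using zero[of 0] a that
    by (cases "r = 0") (simp_all add: g1_def g2_def \<Psi>_def \<Phi>''_def \<Phi>_def cosh_real_ge_1 arcosh_cosh_real
        scaleR_conv_of_real field_simps power2_eq_square)
  then show ?thesis using g g1 g2 unfolding \<Phi>_def by blast
qed

text \<open>In dimension three the substitution \<open>F / sinh r\<close> turns the radial part of \<open>\<Delta> + 1\<close> into \<open>F''\<close>.\<close>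

lemma
  fixes F F1 F2 :: "real \<Rightarrow> complex"
  assumes P: "P \<in> hyp3"
    and F: "\<And>r. (F has_vector_derivative F1 r) (at r)"
    and F1: "\<And>r. (F1 has_vector_derivative F2 r) (at r)"
    and F2: "continuous_on UNIV F2"
    and a: "a > 0" and zero: "\<And>r. r < a \<Longrightarrow> F r = 0 \<and> F1 r = 0 \<and> F2 r = 0"
  shows C2_on_radial: "C2_on hyp3 (\<lambda>Q. F (hdist P Q) /\<^sub>R sinh (hdist P Q))"
    and hyp_laplacian_radial: "Q \<in> hyp3 \<Longrightarrow>
      hyp_laplacian (\<lambda>Q. F (hdist P Q) /\<^sub>R sinh (hdist P Q)) Q
        = (F2 (hdist P Q) - F (hdist P Q)) /\<^sub>R sinh (hdist P Q)"
proof -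
  let ?g = "\<lambda>x. F (arcosh (max 1 x)) /\<^sub>R sinh (arcosh (max 1 x))"
  obtain g1 g2 where g: "\<And>x. (?g has_vector_derivative g1 x) (at x)"
    and g1: "\<And>x. (g1 has_vector_derivative g2 x) (at x)" and g2: "continuous_on UNIV g2"
    and laplacian: "\<And>r. r \<ge> 0 \<Longrightarrow>
      (sinh r)\<^sup>2 *\<^sub>R g2 (cosh r) + (3 * cosh r) *\<^sub>R g1 (cosh r) = (F2 r - F r) /\<^sub>R sinh r"
    using ex_derivatives_radial_profile[OF F F1 F2 a zero] by blast
  have g_hcosh: "(\<lambda>Q. F (hdist P Q) /\<^sub>R sinh (hdist P Q)) = (\<lambda>Q. ?g (hcosh P Q))"
    by (simp only: hdist_def)
  show "C2_on hyp3 (\<lambda>Q. F (hdist P Q) /\<^sub>R sinh (hdist P Q))"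
    unfolding g_hcosh using P g g1 g2 by (rule C2_on_hcosh_compose)
  assume Q: "Q \<in> hyp3"
  have "hyp_laplacian (\<lambda>Q. F (hdist P Q) /\<^sub>R sinh (hdist P Q)) Q
      = ((hcosh P Q)\<^sup>2 - 1) *\<^sub>R g2 (hcosh P Q) + (3 * hcosh P Q) *\<^sub>R g1 (hcosh P Q)"
    unfolding g_hcosh by (rule hyp_laplacian_hcosh_compose[OF P g g1 g2 Q])
  also have "\<dots> = (F2 (hdist P Q) - F (hdist P Q)) /\<^sub>R sinh (hdist P Q)"
    using laplacian[OF hdist_nonneg, of P Q] by (simp only: sinh_square_eq cosh_hdist[OF P Q])
  finally show "hyp_laplacian (\<lambda>Q. F (hdist P Q) /\<^sub>R sinh (hdist P Q)) Q
      = (F2 (hdist P Q) - F (hdist P Q)) /\<^sub>R sinh (hdist P Q)" .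
qed

section \<open>The hyperbolic volume in polar coordinates\<close>

lemma hcosh_borel [measurable]:
  assumes [measurable]: "f \<in> borel_measurable M" "g \<in> borel_measurable M"
  shows "(\<lambda>x. hcosh (f x) (g x)) \<in> borel_measurable M"
  unfolding hcosh_def by measurable

lemma hdist_borel [measurable]:
  assumes [measurable]: "f \<in> borel_measurable M" "g \<in> borel_measurable M"
  shows "(\<lambda>x. hdist (f x) (g x)) \<in> borel_measurable M"
  unfolding hdist_def arcosh_def by measurable

lemma sinh_borel [measurable]: "(sinh :: real \<Rightarrow> real) \<in> borel_measurable borel"
  by (intro borel_measurable_continuous_onI continuous_intros)

lemma hyp_ball_borel [measurable]: "hyp_ball P r \<in> sets borel"
  unfolding hyp_ball_def by measurable

lemma hyp_cball_borel [measurable]: "hyp_cball P r \<in> sets borel"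
  unfolding hyp_cball_def by measurable

lemma AE_hyp_vol_hyp3: "AE Q in hyp_vol. Q \<in> hyp3"
  unfolding hyp_vol_def by (subst AE_density) (auto simp: indicator_def)

lemma nn_integral_hyp_vol:
  assumes [measurable]: "f \<in> borel_measurable borel"
  shows "(\<integral>\<^sup>+Q. f Q \<partial>hyp_vol)
    = (\<integral>\<^sup>+y. ennreal (indicator {0<..} y / y ^ 3) * (\<integral>\<^sup>+z. f (z, y) \<partial>lborel) \<partial>lborel)"
proof -
  have [measurable]: "(\<lambda>z. f (z, y)) \<in> borel_measurable borel" for y
    by (rule measurable_compose[OF _ assms]) (auto intro!: borel_measurable_continuous_onI continuous_intros)
  have "(\<integral>\<^sup>+Q. f Q \<partial>hyp_vol) = (\<integral>\<^sup>+Q. ennreal (indicator hyp3 Q / snd Q ^ 3) * f Q \<partial>(lborel \<Otimes>\<^sub>M lborel))"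
    unfolding hyp_vol_def by (subst nn_integral_density) (auto simp: lborel_prod)
  also have "\<dots> = (\<integral>\<^sup>+y. \<integral>\<^sup>+z. ennreal (indicator hyp3 (z, y) / y ^ 3) * f (z, y) \<partial>lborel \<partial>lborel)"
    by (subst lborel_pair.nn_integral_snd[symmetric]) (auto simp: borel_prod lborel_prod)
  also have "\<dots> = (\<integral>\<^sup>+y. ennreal (indicator {0<..} y / y ^ 3) * (\<integral>\<^sup>+z. f (z, y) \<partial>lborel) \<partial>lborel)"
    by (intro nn_integral_cong, subst nn_integral_cmult[symmetric]) (auto simp: hyp3_def indicator_def)
  finally show ?thesis .
qed

lemma emeasure_disc_complex:
  "emeasure lborel {z :: complex. (cmod (w - z))\<^sup>2 < a} = ennreal (pi * a)"
proof (cases "a > 0")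
  case True
  have "(cmod (w - z))\<^sup>2 < a \<longleftrightarrow> cmod (w - z) < sqrt a" for z
    by (metis real_sqrt_less_iff real_sqrt_abs abs_norm_cancel)
  then have "{z :: complex. (cmod (w - z))\<^sup>2 < a} = ball w (sqrt a)"
    unfolding ball_def dist_norm by (simp only:)
  then show ?thesis using True by (simp add: emeasure_ball unit_ball_vol_2)
next
  case False
  then have "{z :: complex. (cmod (w - z))\<^sup>2 < a} = {}"
    by (auto simp: not_less intro: order_trans)
  then show ?thesis using False by (simp add: ennreal_neg mult_nonneg_nonpos)
qed

lemma hyp_ball_slice_eq:
  fixes h r y :: real
  shows "2 * cosh r * h * y - y\<^sup>2 - h\<^sup>2 = (y - h * exp (- r)) * (h * exp r - y)"
proof -
  have "(y - h * exp (- r)) * (h * exp r - y)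
      = h * y * (exp r + exp (- r)) - y\<^sup>2 - h\<^sup>2 * (exp (- r) * exp r)"
    by (simp add: algebra_simps power2_eq_square)
  also have "exp (- r) * exp r = 1" by (simp add: exp_minus)
  finally show ?thesis by (simp add: cosh_def)
qed

lemma emeasure_hyp_ball_slice:
  assumes P: "P \<in> hyp3" and y: "y > 0" and r: "r \<ge> 0"
  shows "(\<integral>\<^sup>+z. indicator (hyp_ball P r) (z, y) \<partial>lborel)
    = ennreal (pi * ((y - snd P * exp (- r)) * (snd P * exp r - y)))"
proof -
  let ?a = "(y - snd P * exp (- r)) * (snd P * exp r - y)"
  have "(z, y) \<in> hyp_ball P r \<longleftrightarrow> (cmod (fst P - z))\<^sup>2 < ?a" for z
    using P y unfolding hyp_ball_eq_hcosh[OF P r] hyp_ball_slice_eq[symmetric]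
    by (simp add: hyp3_def hcosh_def pos_divide_less_eq algebra_simps)
  then have "(\<integral>\<^sup>+z. indicator (hyp_ball P r) (z, y) \<partial>lborel)
      = (\<integral>\<^sup>+z. indicator {z. (cmod (fst P - z))\<^sup>2 < ?a} z \<partial>lborel)"
    by (intro nn_integral_cong) (simp add: indicator_def)
  then show ?thesis
    by (subst (asm) nn_integral_indicator) (simp_all add: emeasure_disc_complex)
qed

lemma nn_integral_hyp_ball_slices:
  fixes h r :: real
  assumes h: "h > 0" and r: "r \<ge> 0"
  shows "(\<integral>\<^sup>+y. ennreal (pi * ((y - h * exp (- r)) * (h * exp r - y)) / y ^ 3)
      * indicator {h * exp (- r)..h * exp r} y \<partial>lborel) = ennreal (pi * (sinh (2 * r) - 2 * r))"
proof -
  let ?F = "\<lambda>y. pi * (- 2 * cosh r * h / y - ln y + h\<^sup>2 / (2 * y\<^sup>2))"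
  have "(\<integral>\<^sup>+y. ennreal (pi * ((y - h * exp (- r)) * (h * exp r - y)) / y ^ 3)
      * indicator {h * exp (- r)..h * exp r} y \<partial>lborel) = ennreal (?F (h * exp r) - ?F (h * exp (- r)))"
  proof (rule nn_integral_FTC_Icc)
    fix y assume y: "y \<in> {h * exp (- r)..h * exp r}"
    moreover have "h * exp (- r) > 0" using h by simp
    ultimately have pos: "y > 0" by (simp add: less_le_trans)
    show "0 \<le> pi * ((y - h * exp (- r)) * (h * exp r - y)) / y ^ 3" using y pos by simp
    show "(?F has_real_derivative pi * ((y - h * exp (- r)) * (h * exp r - y)) / y ^ 3) (at y)"
      unfolding hyp_ball_slice_eq[symmetric] using pos
      by (auto intro!: derivative_eq_intros simp: power2_eq_square power3_eq_cube field_simps)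
  qed (use h r in auto)
  also have "?F (h * exp r) - ?F (h * exp (- r)) = pi * (sinh (2 * r) - 2 * r)"
  proof -
    have exp: "exp (2 * r) = exp r * exp r" "exp (- 2 * r) = 1 / (exp r * exp r)" "exp (- r) = 1 / exp r"
      by (simp_all add: exp_minus exp_double power2_eq_square divide_inverse)
    have endpoints: "- 2 * cosh r * h / (h * exp r) = - 1 - exp (- 2 * r)"
      "- 2 * cosh r * h / (h * exp (- r)) = - 1 - exp (2 * r)"
      "h\<^sup>2 / (2 * (h * exp r)\<^sup>2) = exp (- 2 * r) / 2" "h\<^sup>2 / (2 * (h * exp (- r))\<^sup>2) = exp (2 * r) / 2"
      using h unfolding cosh_def exp by (simp_all add: field_simps power2_eq_square)
    have ln: "ln (h * exp r) = ln h + r" "ln (h * exp (- r)) = ln h - r"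
      using h by (simp_all add: ln_mult)
    show ?thesis unfolding endpoints ln by (simp add: sinh_def algebra_simps)
  qed
  finally show ?thesis .
qed

lemma emeasure_hyp_ball:
  assumes P: "P \<in> hyp3" and r: "r \<ge> 0"
  shows "emeasure hyp_vol (hyp_ball P r) = ennreal (pi * (sinh (2 * r) - 2 * r))"
proof -
  define h where "h = snd P"
  have h: "h > 0" using P by (simp add: h_def hyp3_def)
  have "emeasure hyp_vol (hyp_ball P r) = (\<integral>\<^sup>+Q. indicator (hyp_ball P r) Q \<partial>hyp_vol)"
    by (subst nn_integral_indicator) auto
  also have "\<dots> = (\<integral>\<^sup>+y. ennreal (indicator {0<..} y / y ^ 3)
      * (\<integral>\<^sup>+z. indicator (hyp_ball P r) (z, y) \<partial>lborel) \<partial>lborel)"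
    by (rule nn_integral_hyp_vol) measurable
  also have "\<dots> = (\<integral>\<^sup>+y. ennreal (pi * ((y - h * exp (- r)) * (h * exp r - y)) / y ^ 3)
      * indicator {h * exp (- r)..h * exp r} y \<partial>lborel)"
  proof (rule nn_integral_cong)
    fix y :: real
    have ends: "0 < h * exp (- r)" "h * exp (- r) \<le> h * exp r" using h r by auto
    consider (nonpos) "y \<le> 0" | (outside) "0 < y" "y \<notin> {h * exp (- r)..h * exp r}"
      | (inside) "0 < y" "y \<in> {h * exp (- r)..h * exp r}"
      by linarith
    then show "ennreal (indicator {0<..} y / y ^ 3) * (\<integral>\<^sup>+z. indicator (hyp_ball P r) (z, y) \<partial>lborel)
      = ennreal (pi * ((y - h * exp (- r)) * (h * exp r - y)) / y ^ 3) * indicator {h * exp (- r)..h * exp r} y"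
    proof cases
      case nonpos
      then show ?thesis using ends(1) by simp
    next
      case outside
      then consider "y < h * exp (- r)" | "y > h * exp r" by auto
      then have "(y - h * exp (- r)) * (h * exp r - y) \<le> 0"
        using ends(2) by cases (auto intro: mult_nonpos_nonneg mult_nonneg_nonpos)
      then show ?thesis
        using outside by (simp add: emeasure_hyp_ball_slice[OF P _ r] h_def ennreal_neg mult_nonneg_nonpos)
    next
      case inside
      then show ?thesis
        by (simp add: emeasure_hyp_ball_slice[OF P _ r] h_def ennreal_mult[symmetric])
    qed
  qed
  finally show ?thesis using nn_integral_hyp_ball_slices[OF h r] by simp
qed

lemma nn_integral_sinh_power2:
  assumes "x \<ge> 0"
  shows "(\<integral>\<^sup>+r. ennreal (4 * pi * (sinh r)\<^sup>2) * indicator {0..x} r \<partial>lborel) = ennreal (pi * (sinh (2 * x) - 2 * x))"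
proof -
  let ?F = "\<lambda>r :: real. pi * (sinh (2 * r) - 2 * r)"
  have "(\<integral>\<^sup>+r. ennreal (4 * pi * (sinh r)\<^sup>2) * indicator {0..x} r \<partial>lborel) = ennreal (?F x - ?F 0)"
  proof (rule nn_integral_FTC_Icc)
    fix r :: real
    have "(?F has_real_derivative pi * (cosh (2 * r) * 2 - 2)) (at r)"
      by (auto intro!: derivative_eq_intros)
    also have "pi * (cosh (2 * r) * 2 - 2) = 4 * pi * (sinh r)\<^sup>2"
      by (simp add: cosh_double cosh_square_eq)
    finally show "(?F has_real_derivative 4 * pi * (sinh r)\<^sup>2) (at r)" .
  qed (use assms in auto)
  then show ?thesis by simp
qed

text \<open>The area of the sphere of radius \<open>r\<close> is \<open>4 \<pi> sinh\<^sup>2 r\<close>.\<close>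

lemma distr_hdist_hyp_vol:
  assumes P: "P \<in> hyp3"
  shows "distr hyp_vol borel (hdist P) = density lborel (\<lambda>r. ennreal (indicator {0..} r * (4 * pi * (sinh r)\<^sup>2)))"
    (is "?M = ?N")
proof -
  let ?F = "\<lambda>r :: real. pi * (sinh (2 * r) - 2 * r)"
  have M: "emeasure ?M {..<x} = (if x \<ge> 0 then ennreal (?F x) else 0)" for x
  proof -
    have "emeasure ?M {..<x} = emeasure hyp_vol {Q. hdist P Q < x}"
      by (subst emeasure_distr) (auto intro!: arg_cong[where f = "emeasure hyp_vol"])
    also have "\<dots> = emeasure hyp_vol (hyp_ball P x)"
      using AE_hyp_vol_hyp3 by (intro emeasure_eq_AE) (auto simp: hyp_ball_def)
    moreover have "hyp_ball P x = {}" if "x < 0"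
      using that by (auto simp: hyp_ball_def not_less intro: order_trans[OF less_imp_le hdist_nonneg])
    ultimately show ?thesis using emeasure_hyp_ball[OF P, of x] by auto
  qed
  have N: "emeasure ?N {..<x} = (if x \<ge> 0 then ennreal (?F x) else 0)" for x
  proof -
    have "emeasure ?N {..<x} = (\<integral>\<^sup>+r. ennreal (indicator {0..} r * (4 * pi * (sinh r)\<^sup>2)) * indicator {..<x} r \<partial>lborel)"
      by (subst emeasure_density) auto
    also have "\<dots> = (\<integral>\<^sup>+r. ennreal (4 * pi * (sinh r)\<^sup>2) * indicator {0..x} r \<partial>lborel)"
      using AE_lborel_singleton[of x] by (intro nn_integral_cong_AE) (auto split: split_indicator)
    also have "\<dots> = (if x \<ge> 0 then ennreal (?F x) else 0)"
      by (simp add: nn_integral_sinh_power2)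
    finally show ?thesis .
  qed
  show ?thesis
  proof (rule measure_eqI_generator_eq[where E = "range lessThan" and \<Omega> = UNIV and A = "\<lambda>n. {..<real n}"])
    show "Int_stable (range (lessThan :: real \<Rightarrow> real set))" by (auto simp: Int_stable_def greaterThan_Int_greaterThan)
    show "sets ?M = sigma_sets UNIV (range lessThan)" "sets ?N = sigma_sets UNIV (range lessThan)"
      by (simp_all add: borel_Iio)
    show "(\<Union>n. {..<real n}) = UNIV" using reals_Archimedean2 by auto
    show "emeasure ?M {..<real n} \<noteq> \<infinity>" for n by (simp add: M)
    show "emeasure ?M X = emeasure ?N X" if "X \<in> range lessThan" for X
      using that by (auto simp: M N)
  qed auto
qed

lemma nn_integral_radial:
  assumes P: "P \<in> hyp3" and [measurable]: "f \<in> borel_measurable borel"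
  shows "(\<integral>\<^sup>+Q. f (hdist P Q) \<partial>hyp_vol) = (\<integral>\<^sup>+r. ennreal (indicator {0..} r * (4 * pi * (sinh r)\<^sup>2)) * f r \<partial>lborel)"
proof -
  have "(\<integral>\<^sup>+Q. f (hdist P Q) \<partial>hyp_vol) = (\<integral>\<^sup>+r. f r \<partial>distr hyp_vol borel (hdist P))"
    by (subst nn_integral_distr) auto
  also have "\<dots> = (\<integral>\<^sup>+r. ennreal (indicator {0..} r * (4 * pi * (sinh r)\<^sup>2)) * f r \<partial>lborel)"
    unfolding distr_hdist_hyp_vol[OF P] by (subst nn_integral_density) auto
  finally show ?thesis .
qed

lemma
  fixes f :: "real \<Rightarrow> 'b::{banach, second_countable_topology}"
  assumes P: "P \<in> hyp3" and [measurable]: "f \<in> borel_measurable borel"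
  shows integrable_radial_div_sinh: "integrable lborel (\<lambda>r. indicator {0..} r *\<^sub>R (sinh r *\<^sub>R f r)) \<Longrightarrow>
      integrable hyp_vol (\<lambda>Q. f (hdist P Q) /\<^sub>R sinh (hdist P Q))"
    and integral_radial_div_sinh: "(\<integral>Q. f (hdist P Q) /\<^sub>R sinh (hdist P Q) \<partial>hyp_vol) =
      (4 * pi) *\<^sub>R (\<integral>r. indicator {0..} r *\<^sub>R (sinh r *\<^sub>R f r) \<partial>lborel)"
proof -
  let ?w = "\<lambda>r. indicator {0..} r * (4 * pi * (sinh r)\<^sup>2)"
  have [measurable]: "(\<lambda>r. f r /\<^sub>R sinh r) \<in> borel_measurable borel" by measurable
  have weight: "?w r *\<^sub>R (f r /\<^sub>R sinh r) = (4 * pi) *\<^sub>R (indicator {0..} r *\<^sub>R (sinh r *\<^sub>R f r))" for r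
    by (cases "r = 0") (auto simp: power2_eq_square indicator_def)
  have "integrable hyp_vol (\<lambda>Q. f (hdist P Q) /\<^sub>R sinh (hdist P Q)) \<longleftrightarrow>
      integrable (distr hyp_vol borel (hdist P)) (\<lambda>r. f r /\<^sub>R sinh r)"
    by (subst integrable_distr_eq) auto
  also have "\<dots> \<longleftrightarrow> integrable lborel (\<lambda>r. ?w r *\<^sub>R (f r /\<^sub>R sinh r))"
    unfolding distr_hdist_hyp_vol[OF P] by (subst integrable_density) auto
  finally have "integrable hyp_vol (\<lambda>Q. f (hdist P Q) /\<^sub>R sinh (hdist P Q)) \<longleftrightarrow>
      integrable lborel (\<lambda>r. (4 * pi) *\<^sub>R (indicator {0..} r *\<^sub>R (sinh r *\<^sub>R f r)))"
    unfolding weight .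
  then show "integrable hyp_vol (\<lambda>Q. f (hdist P Q) /\<^sub>R sinh (hdist P Q))"
    if "integrable lborel (\<lambda>r. indicator {0..} r *\<^sub>R (sinh r *\<^sub>R f r))"
    using integrable_scaleR_right[OF that] by simp
  have "(\<integral>Q. f (hdist P Q) /\<^sub>R sinh (hdist P Q) \<partial>hyp_vol)
      = (\<integral>r. f r /\<^sub>R sinh r \<partial>distr hyp_vol borel (hdist P))"
    by (subst integral_distr) auto
  also have "\<dots> = (\<integral>r. ?w r *\<^sub>R (f r /\<^sub>R sinh r) \<partial>lborel)"
    unfolding distr_hdist_hyp_vol[OF P] by (subst integral_density) auto
  finally show "(\<integral>Q. f (hdist P Q) /\<^sub>R sinh (hdist P Q) \<partial>hyp_vol) =
      (4 * pi) *\<^sub>R (\<integral>r. indicator {0..} r *\<^sub>R (sinh r *\<^sub>R f r) \<partial>lborel)"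
    unfolding weight Bochner_Integration.integral_scaleR_right .
qed

section \<open>The mean value property of eigenfunctions\<close>

definition radial_integral ::
  "complex \<times> real \<Rightarrow> (complex \<times> real \<Rightarrow> complex) \<Rightarrow> (real \<Rightarrow> complex) \<Rightarrow> complex" where
  "radial_integral P u f = (\<integral>Q. u Q * (f (hdist P Q) /\<^sub>R sinh (hdist P Q)) \<partial>hyp_vol)"

lemma bounded_on_compact:
  fixes f :: "'a::topological_space \<Rightarrow> 'b::real_normed_vector"
  assumes "continuous_on S f" "compact K" "K \<subseteq> S"
  obtains B where "B \<ge> 0" "\<And>x. x \<in> K \<Longrightarrow> norm (f x) \<le> B"
proof -
  have "compact (f ` K)" using assms by (intro compact_continuous_image) (auto intro: continuous_on_subset)
  then obtain B where B: "\<forall>y\<in>f ` K. norm y \<le> B" using compact_imp_bounded bounded_iff by metis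
  then show ?thesis by (intro that[of "max 0 B"]) (auto simp: le_max_iff_disj)
qed

lemma
  assumes P: "P \<in> hyp3" and b: "b \<ge> 0"
  shows integrable_hyp_cball_div_sinh:
      "integrable hyp_vol (\<lambda>Q. indicator {..b} (hdist P Q) /\<^sub>R sinh (hdist P Q) :: real)"
    and integral_hyp_cball_div_sinh:
      "(\<integral>Q. indicator {..b} (hdist P Q) /\<^sub>R sinh (hdist P Q) \<partial>hyp_vol) = 4 * pi * (cosh b - 1)"
proof -
  have "has_bochner_integral lborel (\<lambda>r. sinh r * indicator {0..b} r) (cosh b - cosh 0)"
    using b by (intro has_bochner_integral_FTC_Icc_real) (auto intro!: derivative_eq_intros continuous_intros)
  moreover have "(\<lambda>r. sinh r * indicator {0..b} r) = (\<lambda>r. indicator {0..} r *\<^sub>R (sinh r *\<^sub>R indicator {..b} r))"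
    by (auto simp: indicator_def fun_eq_iff)
  ultimately have int: "integrable lborel (\<lambda>r. indicator {0..} r *\<^sub>R (sinh r *\<^sub>R indicator {..b} r) :: real)"
    "(\<integral>r. indicator {0..} r *\<^sub>R (sinh r *\<^sub>R indicator {..b} r) \<partial>lborel) = cosh b - 1"
    by (simp_all add: has_bochner_integral_iff)
  show "integrable hyp_vol (\<lambda>Q. indicator {..b} (hdist P Q) /\<^sub>R sinh (hdist P Q) :: real)"
    using int(1) by (intro integrable_radial_div_sinh P) auto
  show "(\<integral>Q. indicator {..b} (hdist P Q) /\<^sub>R sinh (hdist P Q) \<partial>hyp_vol) = 4 * pi * (cosh b - 1)"
    using integral_radial_div_sinh[OF P, of "indicator {..b} :: real \<Rightarrow> real"] int(2) by simp
qed

lemma radial_kernel_borel: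
  assumes u: "continuous_on hyp3 u" and P: "P \<in> hyp3" and [measurable]: "f \<in> borel_measurable borel"
  shows "(\<lambda>Q. u Q * (f (hdist P Q) /\<^sub>R sinh (hdist P Q)) :: complex) \<in> borel_measurable borel"
proof -
  have [measurable]: "(\<lambda>Q. indicator hyp3 Q *\<^sub>R u Q) \<in> borel_measurable borel"
    using u by (rule borel_measurable_continuous_on_indicator[OF hyp3_borel])
  have "(\<lambda>Q. (indicator hyp3 Q *\<^sub>R u Q) * (f (hdist P Q) /\<^sub>R sinh (hdist P Q))) \<in> borel_measurable borel"
    by measurable
  moreover have "(\<lambda>Q. (indicator hyp3 Q *\<^sub>R u Q) * (f (hdist P Q) /\<^sub>R sinh (hdist P Q)))
      = (\<lambda>Q. u Q * (f (hdist P Q) /\<^sub>R sinh (hdist P Q)))"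
    using hdist_outside[OF P] by (auto simp: fun_eq_iff indicator_def)
  ultimately show ?thesis by simp
qed

lemma
  fixes u :: "complex \<times> real \<Rightarrow> complex" and f :: "real \<Rightarrow> complex"
  assumes u: "continuous_on hyp3 u" and P: "P \<in> hyp3" and b: "b \<ge> 0"
    and f: "f \<in> borel_measurable borel" and zero: "\<And>r. r > b \<Longrightarrow> f r = 0"
    and B: "\<And>Q. Q \<in> hyp_cball P b \<Longrightarrow> cmod (u Q) \<le> B"
    and M: "\<And>r. 0 \<le> r \<Longrightarrow> r \<le> b \<Longrightarrow> cmod (f r) \<le> M"
  shows integrable_radial_kernel_bounded: "integrable hyp_vol (\<lambda>Q. u Q * (f (hdist P Q) /\<^sub>R sinh (hdist P Q)))"
    and norm_radial_integral_le: "cmod (radial_integral P u f) \<le> B * M * (4 * pi * (cosh b - 1))"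
proof -
  let ?k = "\<lambda>Q. u Q * (f (hdist P Q) /\<^sub>R sinh (hdist P Q))"
  let ?w = "\<lambda>Q. B * M * (indicator {..b} (hdist P Q) /\<^sub>R sinh (hdist P Q))"
  have "P \<in> hyp_cball P b" using P b by (rule center_in_hyp_cball)
  then have BM: "B \<ge> 0" "M \<ge> 0"
    using order_trans[OF norm_ge_zero B] order_trans[OF norm_ge_zero M[of 0]] b by auto
  have w: "integrable hyp_vol ?w"
    by (intro integrable_mult_right integrable_hyp_cball_div_sinh P b)
  have bound: "cmod (?k Q) \<le> ?w Q" for Q
  proof (cases "Q \<in> hyp_cball P b")
    case True
    have "cmod (?k Q) = cmod (u Q) * cmod (f (hdist P Q)) * (1 / sinh (hdist P Q))"
      by (simp add: norm_mult divide_inverse)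
    also have "\<dots> \<le> B * M * (1 / sinh (hdist P Q))"
      using True B M BM by (intro mult_right_mono mult_mono) (auto simp: hyp_cball_def)
    finally show ?thesis using True by (simp add: hyp_cball_def divide_inverse)
  next
    case False
    then have "hdist P Q = 0 \<or> hdist P Q > b"
      using hdist_outside[OF P, of Q] by (auto simp: hyp_cball_def)
    then show ?thesis using zero BM by auto
  qed
  show k: "integrable hyp_vol ?k"
  proof (rule Bochner_Integration.integrable_bound[OF w])
    show "?k \<in> borel_measurable hyp_vol"
      using radial_kernel_borel[OF u P f] by simp
    show "AE Q in hyp_vol. norm (?k Q) \<le> norm (?w Q)"
      using bound by (intro AE_I2) (metis abs_ge_self order_trans real_norm_def)
  qed
  have "cmod (radial_integral P u f) \<le> (\<integral>Q. ?w Q \<partial>hyp_vol)"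
    unfolding radial_integral_def by (rule Bochner_Integration.integral_norm_bound_integral[OF k w bound])
  then show "cmod (radial_integral P u f) \<le> B * M * (4 * pi * (cosh b - 1))"
    unfolding integral_mult_right_zero integral_hyp_cball_div_sinh[OF P b] .
qed

lemma integrable_radial_kernel:
  fixes u :: "complex \<times> real \<Rightarrow> complex" and f :: "real \<Rightarrow> complex"
  assumes "continuous_on hyp3 u" "P \<in> hyp3" "continuous_on UNIV f" "b \<ge> 0" "\<And>r. r > b \<Longrightarrow> f r = 0"
  shows "integrable hyp_vol (\<lambda>Q. u Q * (f (hdist P Q) /\<^sub>R sinh (hdist P Q)))"
proof -
  obtain B where "\<And>Q. Q \<in> hyp_cball P b \<Longrightarrow> cmod (u Q) \<le> B"
    using bounded_on_compact[OF assms(1) compact_hyp_cball[OF assms(2)] hyp_cball_subset_hyp3] by blast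
  moreover obtain M where "\<And>r. r \<in> {0..b} \<Longrightarrow> cmod (f r) \<le> M"
    using bounded_on_compact[OF assms(3) compact_Icc subset_UNIV] by blast
  ultimately show ?thesis
    using assms by (intro integrable_radial_kernel_bounded borel_measurable_continuous_onI) auto
qed

lemma radial_integral_add:
  assumes "continuous_on hyp3 u" "P \<in> hyp3" "b \<ge> 0" "continuous_on UNIV f" "continuous_on UNIV g"
    "\<And>r. r > b \<Longrightarrow> f r = 0" "\<And>r. r > b \<Longrightarrow> g r = 0"
  shows "radial_integral P u (\<lambda>r. f r + g r) = radial_integral P u f + radial_integral P u g"
  unfolding radial_integral_def scaleR_add_right distrib_left
  using assms by (intro Bochner_Integration.integral_add integrable_radial_kernel)

lemma radial_integral_diff_const:
  assumes "continuous_on hyp3 u" "P \<in> hyp3" "b \<ge> 0" "continuous_on UNIV f" "\<And>r. r > b \<Longrightarrow> f r = 0"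
  shows "radial_integral P (\<lambda>Q. u Q - c) f = radial_integral P u f - c * radial_integral P (\<lambda>_. 1) f"
proof -
  have int: "integrable hyp_vol (\<lambda>Q. v Q * (f (hdist P Q) /\<^sub>R sinh (hdist P Q)))" if "continuous_on hyp3 v" for v
    using that assms(2,4,3,5) by (rule integrable_radial_kernel)
  have "radial_integral P (\<lambda>Q. u Q - c) f
      = (\<integral>Q. u Q * (f (hdist P Q) /\<^sub>R sinh (hdist P Q)) - c * (1 * (f (hdist P Q) /\<^sub>R sinh (hdist P Q))) \<partial>hyp_vol)"
    by (simp add: radial_integral_def left_diff_distrib scaleR_diff_right)
  also have "\<dots> = radial_integral P u f - c * radial_integral P (\<lambda>_. 1) f"
    unfolding radial_integral_def integral_mult_right_zero[symmetric]
    by (intro Bochner_Integration.integral_diff integrable_mult_right int assms(1) continuous_on_const)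
  finally show ?thesis .
qed

lemma radial_integral_one:
  fixes F F1 F2 :: "real \<Rightarrow> complex"
  assumes P: "P \<in> hyp3"
    and F: "\<And>r. (F has_vector_derivative F1 r) (at r)"
    and F1: "\<And>r. (F1 has_vector_derivative F2 r) (at r)"
    and F2: "continuous_on UNIV F2"
    and zero: "\<And>r. r \<ge> 1 \<Longrightarrow> F r = 0 \<and> F1 r = 0 \<and> F2 r = 0"
  shows "radial_integral P (\<lambda>_. 1) (\<lambda>r. F2 r - F r) = 4 * pi * F 0"
proof -
  have cont: "continuous_on UNIV (\<lambda>r. F2 r - F r)"
    using has_vector_derivative_imp_continuous_on_UNIV[OF F] F2 by (intro continuous_intros)
  have "radial_integral P (\<lambda>_. 1) (\<lambda>r. F2 r - F r)
      = (4 * pi) *\<^sub>R (\<integral>r. indicator {0..} r *\<^sub>R (sinh r *\<^sub>R (F2 r - F r)) \<partial>lborel)"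
    unfolding radial_integral_def mult_1
    by (rule integral_radial_div_sinh[OF P borel_measurable_continuous_onI[OF cont]])
  also have "(\<integral>r. indicator {0..} r *\<^sub>R (sinh r *\<^sub>R (F2 r - F r)) \<partial>lborel)
      = (\<integral>r. indicator {0..1} r *\<^sub>R (sinh r *\<^sub>R (F2 r - F r)) \<partial>lborel)"
    using zero by (intro Bochner_Integration.integral_cong refl) (auto simp: indicator_def)
  also have "\<dots> = (sinh 1 *\<^sub>R F1 1 - cosh 1 *\<^sub>R F 1) - (sinh 0 *\<^sub>R F1 0 - cosh 0 *\<^sub>R F 0)"
  proof (rule integral_FTC_Icc)
    show "((\<lambda>r. sinh r *\<^sub>R F1 r - cosh r *\<^sub>R F r) has_vector_derivative sinh r *\<^sub>R (F2 r - F r))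
        (at r within {0..1})" for r
      by (rule has_vector_derivative_at_within,
          (rule derivative_eq_intros has_field_derivative_sinh has_field_derivative_cosh F F1 refl)+)
         (simp add: scaleR_diff_right)
    show "continuous_on {0..1} (\<lambda>r. sinh r *\<^sub>R (F2 r - F r))"
      by (intro continuous_intros continuous_on_subset[OF cont]) auto
  qed simp
  finally show ?thesis using zero[of 1] by (simp add: scaleR_conv_of_real)
qed

lemma radial_integral_ode_eq_0:
  fixes F F1 F2 :: "real \<Rightarrow> complex"
  assumes u: "C2_on hyp3 u" and P: "P \<in> hyp3"
    and ev: "\<And>Q. Q \<in> hyp3 \<Longrightarrow> - hyp_laplacian u Q = (1 + t\<^sup>2) * u Q"
    and F: "\<And>r. (F has_vector_derivative F1 r) (at r)"
    and F1: "\<And>r. (F1 has_vector_derivative F2 r) (at r)"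
    and F2: "continuous_on UNIV F2"
    and a: "a > 0" and low: "\<And>r. r < a \<Longrightarrow> F r = 0 \<and> F1 r = 0 \<and> F2 r = 0"
    and high: "\<And>r. r > b \<Longrightarrow> F r = 0 \<and> F2 r = 0"
  shows "radial_integral P u (\<lambda>r. F2 r + t\<^sup>2 * F r) = 0"
proof -
  define \<phi> where "\<phi> Q = F (hdist P Q) /\<^sub>R sinh (hdist P Q)" for Q
  note radial = P F F1 F2 a low
  have closed: "closed (hyp_cball P b)" by (simp add: compact_imp_closed compact_hyp_cball P)
  have supp: "\<phi> Q = 0" "F2 (hdist P Q) /\<^sub>R sinh (hdist P Q) = 0" if "Q \<notin> hyp_cball P b" for Q
  proof -
    have "hdist P Q = 0 \<or> hdist P Q > b"
      using that hdist_outside[OF P, of Q] by (auto simp: hyp_cball_def)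
    then show "\<phi> Q = 0" "F2 (hdist P Q) /\<^sub>R sinh (hdist P Q) = 0" using high by (auto simp: \<phi>_def)
  qed
  have "hyp_laplacian \<phi> Q + (1 + t\<^sup>2) * \<phi> Q = (F2 (hdist P Q) + t\<^sup>2 * F (hdist P Q)) /\<^sub>R sinh (hdist P Q)" for Q
  proof (cases "Q \<in> hyp_cball P b")
    case True
    then have "hyp_laplacian \<phi> Q = (F2 (hdist P Q) - F (hdist P Q)) /\<^sub>R sinh (hdist P Q)"
      unfolding \<phi>_def by (intro hyp_laplacian_radial[OF radial]) (auto simp: hyp_cball_def)
    then show ?thesis by (simp add: \<phi>_def scaleR_conv_of_real algebra_simps)
  next
    case False
    have "hyp_laplacian \<phi> Q = 0"
      by (rule hyp_laplacian_eq_0_outside[OF closed supp(1) False])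
    moreover have "(F2 (hdist P Q) + t\<^sup>2 * F (hdist P Q)) /\<^sub>R sinh (hdist P Q)
        = F2 (hdist P Q) /\<^sub>R sinh (hdist P Q) + t\<^sup>2 * \<phi> Q"
      by (simp add: \<phi>_def scaleR_add_right)
    ultimately show ?thesis using supp[OF False] by simp
  qed
  moreover have "(\<integral>Q. u Q * (hyp_laplacian \<phi> Q + (1 + t\<^sup>2) * \<phi> Q) \<partial>hyp_vol) = 0"
  proof (rule integral_hyp_laplacian_eigenfunction_eq_0[OF u ev, where K = "hyp_cball P b"])
    show "C2_on hyp3 \<phi>" unfolding \<phi>_def by (rule C2_on_radial[OF radial])
  qed (auto simp: compact_hyp_cball P hyp_cball_subset_hyp3 supp)
  ultimately show ?thesis by (simp add: radial_integral_def)
qed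

lemma DERIV_pos_part_power:
  assumes "n \<ge> 2"
  shows "((\<lambda>x::real. max 0 x ^ n) has_real_derivative real n * max 0 x ^ (n - 1)) (at x)"
proof -
  consider (pos) "x > 0" | (neg) "x < 0" | (zero) "x = 0" by linarith
  then show ?thesis
  proof cases
    case pos
    have "((\<lambda>x::real. x ^ n) has_real_derivative real n * x ^ (n - 1)) (at x)"
      by (auto intro!: derivative_eq_intros)
    then have "((\<lambda>x::real. max 0 x ^ n) has_real_derivative real n * x ^ (n - 1)) (at x)"
      by (rule has_field_derivative_transform_within_open[where S = "{0<..}"]) (use pos in auto)
    then show ?thesis using pos by simp
  next
    case neg
    have "((\<lambda>x::real. max 0 x ^ n) has_real_derivative 0) (at x)"
      by (rule has_field_derivative_transform_within_open[where S = "{..<0}" and f = "\<lambda>_. 0"])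
         (use neg assms in auto)
    then show ?thesis using neg assms by (simp add: power_0_left)
  next
    case zero
    have "((\<lambda>y::real. (max 0 y ^ n - max 0 0 ^ n) / (y - 0)) \<longlongrightarrow> 0) (at 0)"
    proof (rule Lim_null_comparison)
      have "norm ((max 0 y ^ n - max 0 0 ^ n) / (y - 0)) \<le> \<bar>y\<bar> ^ (n - 1)" for y :: real
      proof (cases "y > 0")
        case True
        then have "y ^ n / y = y ^ (n - 1)" using assms by (simp add: power_diff)
        then show ?thesis using True assms by (simp add: power_0_left)
      qed (use assms in \<open>auto simp: power_0_left\<close>)
      then show "\<forall>\<^sub>F y in at 0. norm ((max 0 y ^ n - max 0 0 ^ n) / (y - 0)) \<le> \<bar>y\<bar> ^ (n - 1)" by simp
      have "((\<lambda>y::real. \<bar>y\<bar> ^ (n - 1)) \<longlongrightarrow> \<bar>0\<bar> ^ (n - 1)) (at 0)"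
        by (intro tendsto_intros)
      then show "((\<lambda>y::real. \<bar>y\<bar> ^ (n - 1)) \<longlongrightarrow> 0) (at 0)" using assms by (simp add: power_0_left)
    qed
    then show ?thesis using zero assms by (simp add: has_field_derivative_iff power_0_left)
  qed
qed

definition smooth_step :: "real \<Rightarrow> real" where
  "smooth_step x = max 0 (1 - max 0 (1 - x) ^ 3) ^ 3"

definition smooth_step_deriv :: "real \<Rightarrow> real" where
  "smooth_step_deriv x = 9 * (max 0 (1 - max 0 (1 - x) ^ 3) ^ 2 * max 0 (1 - x) ^ 2)"

definition smooth_step_deriv2 :: "real \<Rightarrow> real" where
  "smooth_step_deriv2 x = 54 * max 0 (1 - max 0 (1 - x) ^ 3) * max 0 (1 - x) ^ 4
     - 18 * max 0 (1 - max 0 (1 - x) ^ 3) ^ 2 * max 0 (1 - x)"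

lemma smooth_step_has_derivative: "(smooth_step has_real_derivative smooth_step_deriv x) (at x)"
  and smooth_step_deriv_has_derivative: "(smooth_step_deriv has_real_derivative smooth_step_deriv2 x) (at x)"
proof -
  have inner: "((\<lambda>x. 1 - x) has_real_derivative - 1) (at x)" for x :: real
    by (auto intro!: derivative_eq_intros)
  note power = DERIV_chain2[OF DERIV_pos_part_power]
  have outer: "((\<lambda>x. 1 - max 0 (1 - x) ^ 3) has_real_derivative 3 * max 0 (1 - x) ^ 2) (at x)" for x :: real
    by (rule derivative_eq_intros power[OF _ inner] refl)+ simp_all
  show "(smooth_step has_real_derivative smooth_step_deriv x) (at x)"
    unfolding smooth_step_def[abs_def] smooth_step_deriv_def
    by (rule DERIV_cong[OF power[OF _ outer]]) simp_all
  show "(smooth_step_deriv has_real_derivative smooth_step_deriv2 x) (at x)"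
    unfolding smooth_step_deriv_def[abs_def] smooth_step_deriv2_def
    by (rule DERIV_cong[OF DERIV_cmult[OF DERIV_mult[OF power[OF _ outer] power[OF _ inner]]]])
       (simp_all add: power2_eq_square power4_eq_xxxx algebra_simps)
qed

lemma smooth_step_eq_0: "x \<le> 0 \<Longrightarrow> smooth_step x = 0 \<and> smooth_step_deriv x = 0 \<and> smooth_step_deriv2 x = 0"
  by (simp add: smooth_step_def smooth_step_deriv_def smooth_step_deriv2_def max_absorb1 one_le_power)

lemma smooth_step_eq_1: "x \<ge> 1 \<Longrightarrow> smooth_step x = 1 \<and> smooth_step_deriv x = 0 \<and> smooth_step_deriv2 x = 0"
  by (simp add: smooth_step_def smooth_step_deriv_def smooth_step_deriv2_def max_absorb1)

lemma continuous_on_smooth_step_deriv2: "continuous_on UNIV smooth_step_deriv2"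
  unfolding smooth_step_deriv2_def by (intro continuous_intros)

lemma smooth_step_bounds:
  "0 \<le> smooth_step x" "smooth_step x \<le> 1" "\<bar>smooth_step_deriv x\<bar> \<le> 72" "\<bar>smooth_step_deriv2 x\<bar> \<le> 72"
proof -
  define q where "q = max 0 (1 - x)"
  define p where "p = max 0 (1 - q ^ 3)"
  have p: "0 \<le> p" "p \<le> 1" by (auto simp: p_def q_def)
  show "0 \<le> smooth_step x" "smooth_step x \<le> 1"
    using p by (simp_all add: smooth_step_def power_le_one flip: q_def p_def)
  show "\<bar>smooth_step_deriv x\<bar> \<le> 72" "\<bar>smooth_step_deriv2 x\<bar> \<le> 72"
  proof -
    have "\<bar>smooth_step_deriv x\<bar> \<le> 72 \<and> \<bar>smooth_step_deriv2 x\<bar> \<le> 72"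
    proof (cases "x \<le> 0")
      case False
      then have q: "0 \<le> q" "q \<le> 1" by (auto simp: q_def)
      have "0 \<le> p\<^sup>2 * q\<^sup>2" "p\<^sup>2 * q\<^sup>2 \<le> 1" "0 \<le> p * q ^ 4" "p * q ^ 4 \<le> 1" "0 \<le> p\<^sup>2 * q" "p\<^sup>2 * q \<le> 1"
        using p q by (auto intro!: mult_le_one power_le_one)
      moreover have "smooth_step_deriv x = 9 * (p\<^sup>2 * q\<^sup>2)"
        "smooth_step_deriv2 x = 54 * (p * q ^ 4) - 18 * (p\<^sup>2 * q)"
        by (simp_all add: smooth_step_deriv_def smooth_step_deriv2_def p_def q_def)
      ultimately show ?thesis by linarith
    qed (simp add: smooth_step_eq_0)
    then show "\<bar>smooth_step_deriv x\<bar> \<le> 72" "\<bar>smooth_step_deriv2 x\<bar> \<le> 72" by auto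
  qed
qed

lemma continuous_on_smooth_step_compose:
  assumes "\<eta> > 0"
  shows "continuous_on UNIV (\<lambda>r. smooth_step (r / \<eta> - 1))"
    and "continuous_on UNIV (\<lambda>r. smooth_step_deriv (r / \<eta> - 1))"
    and "continuous_on UNIV (\<lambda>r. smooth_step_deriv2 (r / \<eta> - 1))"
proof -
  have "continuous_on UNIV smooth_step" "continuous_on UNIV smooth_step_deriv"
    using DERIV_isCont[OF smooth_step_has_derivative] DERIV_isCont[OF smooth_step_deriv_has_derivative]
    by (simp_all add: continuous_at_imp_continuous_on)
  note cont = this continuous_on_smooth_step_deriv2
  show "continuous_on UNIV (\<lambda>r. smooth_step (r / \<eta> - 1))"
    "continuous_on UNIV (\<lambda>r. smooth_step_deriv (r / \<eta> - 1))"
    "continuous_on UNIV (\<lambda>r. smooth_step_deriv2 (r / \<eta> - 1))"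
    using assms by (auto intro!: continuous_on_compose2[OF cont(1)] continuous_on_compose2[OF cont(2)]
        continuous_on_compose2[OF cont(3)] continuous_intros)
qed

lemma cosh_le_1_plus_square:
  fixes x :: real assumes "0 \<le> x" "x \<le> 1" shows "cosh x \<le> 1 + x\<^sup>2"
proof -
  have "1 \<le> (1 - x + x\<^sup>2) * (1 + x)" using assms by (simp add: algebra_simps power2_eq_square)
  also have "\<dots> \<le> (1 - x + x\<^sup>2) * exp x"
    using exp_ge_add_one_self[of x] assms by (intro mult_left_mono) auto
  finally have "exp (- x) \<le> 1 - x + x\<^sup>2"
    by (simp add: exp_minus inverse_eq_divide pos_divide_le_eq)
  moreover have "exp x \<le> 1 + x + x\<^sup>2" using assms by (intro exp_bound) auto
  ultimately show ?thesis by (simp add: cosh_def)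
qed

lemma norm_radial_integral_cutoff_diff_le:
  fixes f :: "real \<Rightarrow> complex"
  assumes u: "continuous_on hyp3 u" and P: "P \<in> hyp3"
    and f: "continuous_on UNIV f" and zero: "\<And>r. r \<ge> 1 \<Longrightarrow> f r = 0"
    and B: "B \<ge> 0" "\<And>Q. Q \<in> hyp_cball P 1 \<Longrightarrow> cmod (u Q) \<le> B"
    and M: "M \<ge> 0" "\<And>r. r \<in> {0..1} \<Longrightarrow> cmod (f r) \<le> M" and \<eta>: "0 < \<eta>" "\<eta> < 1 / 2"
  shows "cmod (radial_integral P u (\<lambda>r. smooth_step (r / \<eta> - 1) *\<^sub>R f r) - radial_integral P u f)
    \<le> B * M * (4 * pi * (cosh (2 * \<eta>) - 1))"
proof -
  let ?h = "\<lambda>r. smooth_step (r / \<eta> - 1)"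
  let ?g = "\<lambda>r. (1 - ?h r) *\<^sub>R f r"
  have h: "continuous_on UNIV ?h" using \<eta> by (intro continuous_on_smooth_step_compose) auto
  have "radial_integral P u f = radial_integral P u (\<lambda>r. ?h r *\<^sub>R f r + ?g r)"
    by (simp flip: scaleR_left_distrib)
  also have "\<dots> = radial_integral P u (\<lambda>r. ?h r *\<^sub>R f r) + radial_integral P u ?g"
    using zero by (intro radial_integral_add[of u P 1] u P continuous_intros h f) auto
  finally have "cmod (radial_integral P u (\<lambda>r. ?h r *\<^sub>R f r) - radial_integral P u f)
      = cmod (radial_integral P u ?g)" by simp
  also have "\<dots> \<le> B * M * (4 * pi * (cosh (2 * \<eta>) - 1))"
  proof (rule norm_radial_integral_le[OF u P])
    show "?g \<in> borel_measurable borel"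
      by (intro borel_measurable_continuous_onI continuous_intros h f)
    show "?g r = 0" if "r > 2 * \<eta>" for r
      using that \<eta> smooth_step_eq_1[of "r / \<eta> - 1"] by (simp add: le_divide_eq)
    show "cmod (u Q) \<le> B" if "Q \<in> hyp_cball P (2 * \<eta>)" for Q
      using that \<eta> by (intro B) (auto simp: hyp_cball_def)
    show "cmod (?g r) \<le> M" if "0 \<le> r" "r \<le> 2 * \<eta>" for r
    proof -
      have "cmod (?g r) \<le> 1 * cmod (f r)"
        unfolding norm_scaleR using smooth_step_bounds(1,2)[of "r / \<eta> - 1"] by (intro mult_right_mono) auto
      also have "\<dots> \<le> 1 * M" using that \<eta> by (intro mult_left_mono M) auto
      finally show ?thesis by simp
    qed
  qed (use \<eta> B M in auto)
  finally show ?thesis .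
qed

lemma radial_integral_cutoff_tendsto:
  fixes f :: "real \<Rightarrow> complex"
  assumes u: "continuous_on hyp3 u" and P: "P \<in> hyp3"
    and f: "continuous_on UNIV f" and zero: "\<And>r. r \<ge> 1 \<Longrightarrow> f r = 0"
  shows "((\<lambda>\<eta>. radial_integral P u (\<lambda>r. smooth_step (r / \<eta> - 1) *\<^sub>R f r)) \<longlongrightarrow> radial_integral P u f) (at_right 0)"
proof -
  obtain B where B: "B \<ge> 0" "\<And>Q. Q \<in> hyp_cball P 1 \<Longrightarrow> cmod (u Q) \<le> B"
    using bounded_on_compact[OF u compact_hyp_cball[OF P] hyp_cball_subset_hyp3] by blast
  obtain M where M: "M \<ge> 0" "\<And>r. r \<in> {0..1} \<Longrightarrow> cmod (f r) \<le> M"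
    using bounded_on_compact[OF f compact_Icc subset_UNIV] by blast
  let ?I = "\<lambda>\<eta>. radial_integral P u (\<lambda>r. smooth_step (r / \<eta> - 1) *\<^sub>R f r)"
  have "\<forall>\<^sub>F \<eta> in at_right 0. \<eta> \<in> {0<..<1/2 :: real}"
    by (rule eventually_at_right_real) simp
  then have "\<forall>\<^sub>F \<eta> in at_right 0. cmod (?I \<eta> - radial_integral P u f) \<le> B * M * (4 * pi * (cosh (2 * \<eta>) - 1))"
    by eventually_elim (use norm_radial_integral_cutoff_diff_le[OF u P f zero B M] in auto)
  moreover have "((\<lambda>\<eta>. B * M * (4 * pi * (cosh (2 * \<eta>) - 1))) \<longlongrightarrow> 0) (at_right 0)"
    by (rule tendsto_eq_intros refl)+ simp
  ultimately have "((\<lambda>\<eta>. ?I \<eta> - radial_integral P u f) \<longlongrightarrow> 0) (at_right 0)"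
    by (rule Lim_null_comparison)
  then show ?thesis by (rule LIM_zero_cancel)
qed

lemma radial_integral_concentrated_tendsto_0:
  fixes \<psi> :: "real \<Rightarrow> real \<Rightarrow> complex"
  assumes v: "continuous_on hyp3 v" "v P = 0" and P: "P \<in> hyp3"
    and \<psi>: "\<And>\<eta>. \<eta> > 0 \<Longrightarrow> continuous_on UNIV (\<psi> \<eta>)"
    and zero: "\<And>\<eta> r. \<eta> > 0 \<Longrightarrow> r > 2 * \<eta> \<Longrightarrow> \<psi> \<eta> r = 0"
    and bound: "\<And>\<eta> r. 0 < \<eta> \<Longrightarrow> \<eta> \<le> 1 \<Longrightarrow> r \<ge> 0 \<Longrightarrow> cmod (\<psi> \<eta> r) \<le> K / \<eta>\<^sup>2"
  shows "((\<lambda>\<eta>. radial_integral P v (\<psi> \<eta>)) \<longlongrightarrow> 0) (at_right 0)"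
proof (rule tendstoI)
  fix e :: real assume e: "e > 0"
  have K: "K \<ge> 0" using bound[of 1 0] order_trans[OF norm_ge_zero] by force
  define D where "D = 16 * pi * K + 1"
  have D: "D > 0" unfolding D_def using K by (intro add_nonneg_pos) auto
  have "open (v -` ball 0 (e / (2 * D)) \<inter> hyp3)"
    using continuous_on_open_vimage[OF open_hyp3, of v] v(1) by simp
  then obtain r where r: "r > 0" "hyp_cball P r \<subseteq> v -` ball 0 (e / (2 * D)) \<inter> hyp3"
    using open_contains_hyp_cball[OF P] v(2) P e D by (metis Int_iff centre_in_ball divide_pos_pos mult_2 add_pos_pos vimageI)
  have "dist (radial_integral P v (\<psi> \<eta>)) 0 < e" if \<eta>: "\<eta> \<in> {0<..<min (1/2) (r/2)}" for \<eta>
  proof -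
    have \<eta>': "0 < \<eta>" "2 * \<eta> \<le> 1" "2 * \<eta> \<le> r" using \<eta> by auto
    have "cmod (radial_integral P v (\<psi> \<eta>)) \<le> e / (2 * D) * (K / \<eta>\<^sup>2) * (4 * pi * (cosh (2 * \<eta>) - 1))"
    proof (rule norm_radial_integral_le[OF v(1) P])
      show "cmod (v Q) \<le> e / (2 * D)" if "Q \<in> hyp_cball P (2 * \<eta>)" for Q
        using that r(2) \<eta>' by (force simp: hyp_cball_def)
    qed (use \<eta>' in \<open>auto intro!: borel_measurable_continuous_onI \<psi> zero bound\<close>)
    also have "\<dots> \<le> e / (2 * D) * (K / \<eta>\<^sup>2) * (4 * pi * (2 * \<eta>)\<^sup>2)"
      using cosh_le_1_plus_square[of "2 * \<eta>"] \<eta>' e D K by (intro mult_left_mono) auto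
    also have "\<dots> = e / (2 * D) * (16 * pi * K)" using \<eta>' by (simp add: power2_eq_square)
    also have "\<dots> \<le> e / (2 * D) * D" unfolding D_def using e K by (intro mult_left_mono) auto
    also have "\<dots> < e" using D e by simp
    finally show ?thesis by simp
  qed
  moreover have "\<forall>\<^sub>F \<eta> in at_right 0. \<eta> \<in> {0<..<min (1/2) (r/2)}"
    using r(1) by (intro eventually_at_right_real) auto
  ultimately show "\<forall>\<^sub>F \<eta> in at_right 0. dist (radial_integral P v (\<psi> \<eta>)) 0 < e"
    by (auto elim: eventually_mono)
qed

definition cutoff_commutator ::
  "(real \<Rightarrow> complex) \<Rightarrow> (real \<Rightarrow> complex) \<Rightarrow> real \<Rightarrow> real \<Rightarrow> complex" where
  "cutoff_commutator F F1 \<eta> r = (smooth_step_deriv2 (r / \<eta> - 1) / \<eta>\<^sup>2) *\<^sub>R F r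
     + (2 * smooth_step_deriv (r / \<eta> - 1) / \<eta>) *\<^sub>R F1 r"

context
  fixes F F1 F2 :: "real \<Rightarrow> complex" and P :: "complex \<times> real"
  assumes F: "\<And>r. (F has_vector_derivative F1 r) (at r)"
    and F1: "\<And>r. (F1 has_vector_derivative F2 r) (at r)"
    and F2: "continuous_on UNIV F2"
    and zero: "\<And>r. r \<ge> 1 \<Longrightarrow> F r = 0 \<and> F1 r = 0 \<and> F2 r = 0"
    and P: "P \<in> hyp3"
begin

lemma continuous_on_profile: "continuous_on UNIV F" "continuous_on UNIV F1" "continuous_on UNIV F2"
  using has_vector_derivative_imp_continuous_on_UNIV[OF F]
    has_vector_derivative_imp_continuous_on_UNIV[OF F1] F2 by auto

lemma continuous_on_cutoff_commutator: "\<eta> > 0 \<Longrightarrow> continuous_on UNIV (cutoff_commutator F F1 \<eta>)"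
  unfolding cutoff_commutator_def
  by (intro continuous_intros continuous_on_smooth_step_compose continuous_on_profile) auto

lemma cutoff_commutator_eq_0:
  assumes "\<eta> > 0" "r > 2 * \<eta>"
  shows "cutoff_commutator F F1 \<eta> r = 0"
  using assms smooth_step_eq_1[of "r / \<eta> - 1"] by (simp add: cutoff_commutator_def le_divide_eq)

lemma cutoff_commutator_bounded:
  obtains K where "\<And>\<eta> r. 0 < \<eta> \<Longrightarrow> \<eta> \<le> 1 \<Longrightarrow> r \<ge> 0 \<Longrightarrow> cmod (cutoff_commutator F F1 \<eta> r) \<le> K / \<eta>\<^sup>2"
proof -
  obtain M where M: "M \<ge> 0" "\<And>r. r \<in> {0..1} \<Longrightarrow> cmod (F r) \<le> M"
    using bounded_on_compact[OF continuous_on_profile(1) compact_Icc subset_UNIV] by blast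
  obtain M1 where M1: "M1 \<ge> 0" "\<And>r. r \<in> {0..1} \<Longrightarrow> cmod (F1 r) \<le> M1"
    using bounded_on_compact[OF continuous_on_profile(2) compact_Icc subset_UNIV] by blast
  have "cmod (cutoff_commutator F F1 \<eta> r) \<le> (72 * M + 144 * M1) / \<eta>\<^sup>2"
    if \<eta>: "0 < \<eta>" "\<eta> \<le> 1" and r: "r \<ge> 0" for \<eta> r
  proof -
    have bounds: "cmod (F r) \<le> M" "cmod (F1 r) \<le> M1"
      using M M1 zero[of r] r by (cases "r \<le> 1"; auto)+
    have "1 / \<eta> \<le> 1 / \<eta>\<^sup>2" using \<eta> by (simp add: field_simps power2_eq_square)
    then have "\<bar>2 * smooth_step_deriv (r / \<eta> - 1) / \<eta>\<bar> \<le> 144 * (1 / \<eta>\<^sup>2)"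
      using smooth_step_bounds(3)[of "r / \<eta> - 1"] \<eta>
      by (simp only: abs_divide abs_mult divide_inverse mult_1) (intro mult_mono; simp)
    moreover have "\<bar>smooth_step_deriv2 (r / \<eta> - 1) / \<eta>\<^sup>2\<bar> \<le> 72 * (1 / \<eta>\<^sup>2)"
      using smooth_step_bounds(4)[of "r / \<eta> - 1"] by (simp add: divide_right_mono)
    ultimately have "cmod (cutoff_commutator F F1 \<eta> r) \<le> 72 * (1 / \<eta>\<^sup>2) * M + 144 * (1 / \<eta>\<^sup>2) * M1"
      unfolding cutoff_commutator_def
      by (intro order_trans[OF norm_triangle_ineq] add_mono) (simp_all only: norm_scaleR, (intro mult_mono bounds; simp)+)
    then show ?thesis by (simp add: add_divide_distrib mult_ac)
  qed
  then show ?thesis by (rule that)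
qed

lemma radial_integral_cutoff_commutator:
  assumes u: "C2_on hyp3 u" and ev: "\<And>Q. Q \<in> hyp3 \<Longrightarrow> - hyp_laplacian u Q = (1 + t\<^sup>2) * u Q"
    and \<eta>: "\<eta> > 0"
  shows "radial_integral P u (cutoff_commutator F F1 \<eta>)
    = - radial_integral P u (\<lambda>r. smooth_step (r / \<eta> - 1) *\<^sub>R (F2 r + t\<^sup>2 * F r))"
proof -
  let ?h = "\<lambda>r. smooth_step (r / \<eta> - 1)" and ?h1 = "\<lambda>r. smooth_step_deriv (r / \<eta> - 1) / \<eta>"
    and ?h2 = "\<lambda>r. smooth_step_deriv2 (r / \<eta> - 1) / \<eta>\<^sup>2"
  define G where "G r = ?h r *\<^sub>R F r" for r
  define G1 where "G1 r = ?h1 r *\<^sub>R F r + ?h r *\<^sub>R F1 r" for r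
  define G2 where "G2 r = cutoff_commutator F F1 \<eta> r + ?h r *\<^sub>R F2 r" for r
  have lin: "((\<lambda>r. r / \<eta> - 1) has_real_derivative 1 / \<eta>) (at r)" for r
    using \<eta> by (auto intro!: derivative_eq_intros)
  have h: "(?h has_real_derivative ?h1 r) (at r)" for r
    using DERIV_chain2[OF smooth_step_has_derivative lin] by simp
  have h1: "(?h1 has_real_derivative ?h2 r) (at r)" for r
    using DERIV_cdivide[OF DERIV_chain2[OF smooth_step_deriv_has_derivative lin], of \<eta>]
    by (simp add: power2_eq_square)
  note cont = continuous_on_smooth_step_compose[OF \<eta>] continuous_on_profile
    continuous_on_cutoff_commutator[OF \<eta>]
  have "radial_integral P u (\<lambda>r. G2 r + t\<^sup>2 * G r) = 0"
  proof (rule radial_integral_ode_eq_0[OF u P ev])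
    show "(G has_vector_derivative G1 r) (at r)" for r
      unfolding G_def G1_def by (rule derivative_eq_intros h F refl)+ simp
    show "(G1 has_vector_derivative G2 r) (at r)" for r
      unfolding G1_def G2_def cutoff_commutator_def
      by (rule derivative_eq_intros h h1 F F1 refl)+ (simp add: scaleR_conv_of_real algebra_simps)
    show "continuous_on UNIV G2" unfolding G2_def by (intro continuous_intros cont)
    show "G r = 0 \<and> G1 r = 0 \<and> G2 r = 0" if "r < \<eta>" for r
      using that \<eta> smooth_step_eq_0[of "r / \<eta> - 1"]
      by (simp add: G_def G1_def G2_def cutoff_commutator_def divide_le_eq)
    show "G r = 0 \<and> G2 r = 0" if "r > 1" for r
      using that zero[of r] by (simp add: G_def G2_def cutoff_commutator_def)
  qed (use \<eta> in auto)
  moreover have "(\<lambda>r. G2 r + t\<^sup>2 * G r)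
      = (\<lambda>r. cutoff_commutator F F1 \<eta> r + ?h r *\<^sub>R (F2 r + t\<^sup>2 * F r))"
    by (simp add: G_def G2_def scaleR_add_right add_ac fun_eq_iff)
  moreover have "radial_integral P u (\<lambda>r. cutoff_commutator F F1 \<eta> r + ?h r *\<^sub>R (F2 r + t\<^sup>2 * F r))
    = radial_integral P u (cutoff_commutator F F1 \<eta>)
      + radial_integral P u (\<lambda>r. ?h r *\<^sub>R (F2 r + t\<^sup>2 * F r))"
    using zero C2_on_continuous(1)[OF u]
    by (intro radial_integral_add[of u P 1] P continuous_intros cont) (auto simp: cutoff_commutator_def)
  ultimately show ?thesis by (simp add: eq_neg_iff_add_eq_0)
qed

lemma radial_integral_cutoff_commutator_tendsto:
  assumes u: "C2_on hyp3 u" and ev: "\<And>Q. Q \<in> hyp3 \<Longrightarrow> - hyp_laplacian u Q = (1 + t\<^sup>2) * u Q"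
  shows "((\<lambda>\<eta>. radial_integral P u (cutoff_commutator F F1 \<eta>))
    \<longlongrightarrow> - radial_integral P u (\<lambda>r. F2 r + t\<^sup>2 * F r)) (at_right 0)"
proof -
  have "((\<lambda>\<eta>. - radial_integral P u (\<lambda>r. smooth_step (r / \<eta> - 1) *\<^sub>R (F2 r + t\<^sup>2 * F r)))
      \<longlongrightarrow> - radial_integral P u (\<lambda>r. F2 r + t\<^sup>2 * F r)) (at_right 0)"
    using zero C2_on_continuous(1)[OF u]
    by (intro tendsto_minus radial_integral_cutoff_tendsto continuous_intros continuous_on_profile P) auto
  then show ?thesis
    by (rule tendsto_cong[THEN iffD2, rotated])
       (auto simp: radial_integral_cutoff_commutator[OF u ev] eventually_at_filter)
qed

text \<open>On the half-space \<open>F (hdist P \<cdot>) / sinh (hdist P \<cdot>)\<close> is singular at \<open>P\<close>, where it is cut off at scale \<open>\<eta>\<close>.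
  The error is concentrated near \<open>P\<close>, so \<open>u\<close> may be replaced there by \<open>u P\<close>; the remaining mass is found
  by testing against the constant function, which is an eigenfunction for \<open>t = \<i>\<close>.\<close>

lemma radial_integral_fundamental_solution:
  assumes u: "C2_on hyp3 u" and ev: "\<And>Q. Q \<in> hyp3 \<Longrightarrow> - hyp_laplacian u Q = (1 + t\<^sup>2) * u Q"
  shows "radial_integral P u (\<lambda>r. F2 r + t\<^sup>2 * F r) = 4 * pi * F 0 * u P"
proof -
  let ?\<psi> = "cutoff_commutator F F1"
  note cu = C2_on_continuous(1)[OF u]
  have "((\<lambda>\<eta>. radial_integral P (\<lambda>_. 1) (?\<psi> \<eta>)) \<longlongrightarrow> - radial_integral P (\<lambda>_. 1) (\<lambda>r. F2 r + \<i>\<^sup>2 * F r)) (at_right 0)"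
    by (rule radial_integral_cutoff_commutator_tendsto) (simp_all add: C2_on_const hyp_laplacian_const)
  also have "radial_integral P (\<lambda>_. 1) (\<lambda>r. F2 r + \<i>\<^sup>2 * F r) = 4 * pi * F 0"
    using radial_integral_one[OF P F F1 F2 zero] by simp
  finally have one: "((\<lambda>\<eta>. radial_integral P (\<lambda>_. 1) (?\<psi> \<eta>)) \<longlongrightarrow> - (4 * pi * F 0)) (at_right 0)" .
  obtain K where K: "\<And>\<eta> r. 0 < \<eta> \<Longrightarrow> \<eta> \<le> 1 \<Longrightarrow> r \<ge> 0 \<Longrightarrow> cmod (?\<psi> \<eta> r) \<le> K / \<eta>\<^sup>2"
    using cutoff_commutator_bounded by blast
  have "((\<lambda>\<eta>. radial_integral P (\<lambda>Q. u Q - u P) (?\<psi> \<eta>)) \<longlongrightarrow> 0) (at_right 0)"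
    by (rule radial_integral_concentrated_tendsto_0[OF _ _ P continuous_on_cutoff_commutator cutoff_commutator_eq_0 K])
       (auto intro!: continuous_intros cu)
  moreover have "\<forall>\<^sub>F \<eta> in at_right 0. radial_integral P (\<lambda>Q. u Q - u P) (?\<psi> \<eta>)
      = radial_integral P u (?\<psi> \<eta>) - u P * radial_integral P (\<lambda>_. 1) (?\<psi> \<eta>)"
    using eventually_at_right_less[of 0]
  proof eventually_elim
    case (elim \<eta>)
    then show ?case
      using cutoff_commutator_eq_0[OF elim] continuous_on_cutoff_commutator[OF elim]
      by (intro radial_integral_diff_const[of u P "2 * \<eta>"] cu P) auto
  qed
  ultimately have "((\<lambda>\<eta>. radial_integral P u (?\<psi> \<eta>) - u P * radial_integral P (\<lambda>_. 1) (?\<psi> \<eta>)) \<longlongrightarrow> 0) (at_right 0)"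
    by (rule Lim_transform_eventually)
  moreover have "((\<lambda>\<eta>. radial_integral P u (?\<psi> \<eta>) - u P * radial_integral P (\<lambda>_. 1) (?\<psi> \<eta>))
      \<longlongrightarrow> - radial_integral P u (\<lambda>r. F2 r + t\<^sup>2 * F r) - u P * - (4 * pi * F 0)) (at_right 0)"
    by (intro tendsto_intros radial_integral_cutoff_commutator_tendsto[OF u ev] one)
  ultimately have "0 = - radial_integral P u (\<lambda>r. F2 r + t\<^sup>2 * F r) - u P * - (4 * pi * F 0)"
    by (rule tendsto_unique[rotated]) simp
  then show ?thesis by (simp add: algebra_simps)
qed

end

definition spherical_sin :: "complex \<Rightarrow> real \<Rightarrow> complex" where
  "spherical_sin t r = (if t = 0 then of_real r else sin (t * of_real r) / t)"

lemma spherical_sin_0 [simp]: "spherical_sin t 0 = 0"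
  by (simp add: spherical_sin_def)

lemma spherical_sin_has_derivative:
  "(spherical_sin t has_vector_derivative cos (t * of_real r)) (at r)"
proof -
  have "((\<lambda>z. if t = 0 then z else sin (t * z) / t) has_field_derivative cos (t * of_real r)) (at (of_real r))"
    by (cases "t = 0") (auto intro!: derivative_eq_intros)
  then show ?thesis
    unfolding spherical_sin_def[abs_def] by (rule has_vector_derivative_real_field)
qed

lemma spherical_cos_has_derivative:
  "((\<lambda>r. cos (t * of_real r)) has_vector_derivative - t\<^sup>2 * spherical_sin t r) (at r)"
proof -
  have "((\<lambda>z. cos (t * z)) has_field_derivative - t\<^sup>2 * spherical_sin t r) (at (of_real r))"
    by (auto intro!: derivative_eq_intros simp: spherical_sin_def power2_eq_square)
  then show ?thesis by (rule has_vector_derivative_real_field)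
qed

lemma spherical_pythagoras: "(cos (t * of_real r))\<^sup>2 + t\<^sup>2 * (spherical_sin t r)\<^sup>2 = 1"
  by (simp add: spherical_sin_def power_divide add.commute)

lemma ex_antiderivative_vanishing_beyond_1:
  fixes f :: "real \<Rightarrow> complex"
  assumes f: "continuous_on UNIV f" and zero: "\<And>r. r \<ge> 1 \<Longrightarrow> f r = 0"
  shows "\<exists>A. (\<forall>r. (A has_vector_derivative - f r) (at r)) \<and> (\<forall>r\<ge>1. A r = 0) \<and> A 0 = integral {0..1} f"
proof -
  define A where "A r = - (LBINT s=ereal 1..ereal r. f s)" for r
  have "(A has_vector_derivative - f r) (at r)" for r
  proof -
    have "((\<lambda>u. LBINT s=ereal 1..ereal u. f s) has_vector_derivative f r) (at r within {-\<bar>r\<bar>-2..\<bar>r\<bar>+2})"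
      using f by (intro interval_integral_FTC2) (auto intro: continuous_on_subset)
    then have "((\<lambda>u. LBINT s=ereal 1..ereal u. f s) has_vector_derivative f r) (at r)"
      by (subst (asm) at_within_interior) (auto simp: interior_atLeastAtMost_real)
    then show ?thesis unfolding A_def by (rule has_vector_derivative_minus)
  qed
  moreover have "A r = 0" if "r \<ge> 1" for r
  proof -
    have "(LBINT s=ereal 1..ereal r. f s) = (LBINT s=ereal 1..ereal r. 0)"
      using that zero by (intro interval_integral_cong) (auto simp: min_def max_def einterval_def)
    then show ?thesis by (simp add: A_def)
  qed
  moreover have "A 0 = integral {0..1} f"
  proof -
    have "A 0 = (LBINT s=ereal 0..ereal 1. f s)"
      unfolding A_def by (subst interval_integral_endpoints_reverse) simp
    also have "\<dots> = integral {0..1} f"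
      using f by (intro interval_integral_eq_integral)
        (auto simp: set_integrable_def intro!: borel_integrable_compact intro: continuous_on_subset)
    finally show ?thesis .
  qed
  ultimately show ?thesis by blast
qed

text \<open>Variation of constants: \<open>F r = \<integral>\<^sub>r\<^sup>1 \<kappa> s sin (t (s - r)) / t ds\<close>.\<close>

lemma ex_resolvent_vanishing_beyond_1:
  fixes \<kappa> :: "real \<Rightarrow> complex"
  assumes \<kappa>: "continuous_on UNIV \<kappa>" and zero: "\<And>r. r \<ge> 1 \<Longrightarrow> \<kappa> r = 0"
  shows "\<exists>F F1. (\<forall>r. (F has_vector_derivative F1 r) (at r)) \<and>
    (\<forall>r. (F1 has_vector_derivative \<kappa> r - t\<^sup>2 * F r) (at r)) \<and> (\<forall>r\<ge>1. F r = 0 \<and> F1 r = 0) \<and>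
    F 0 = integral {0..1} (\<lambda>s. \<kappa> s * spherical_sin t s)"
proof -
  let ?S = "spherical_sin t" and ?C = "\<lambda>r. cos (t * of_real r)"
  note S = spherical_sin_has_derivative[of t] and C = spherical_cos_has_derivative[of t]
  have \<kappa>S: "continuous_on UNIV (\<lambda>s. \<kappa> s * ?S s)" and \<kappa>C: "continuous_on UNIV (\<lambda>s. \<kappa> s * ?C s)"
    by (intro continuous_intros \<kappa> has_vector_derivative_imp_continuous_on_UNIV[OF S])+
  have zero': "\<kappa> r * ?S r = 0" "\<kappa> r * ?C r = 0" if "r \<ge> 1" for r
    using zero[OF that] by simp_all
  obtain A where A: "\<And>r. (A has_vector_derivative - (\<kappa> r * ?S r)) (at r)" "\<And>r. r \<ge> 1 \<Longrightarrow> A r = 0"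
      "A 0 = integral {0..1} (\<lambda>s. \<kappa> s * ?S s)"
    using ex_antiderivative_vanishing_beyond_1[OF \<kappa>S zero'(1)] by blast
  obtain B where B: "\<And>r. (B has_vector_derivative - (\<kappa> r * ?C r)) (at r)" "\<And>r. r \<ge> 1 \<Longrightarrow> B r = 0"
    using ex_antiderivative_vanishing_beyond_1[OF \<kappa>C zero'(2)] by blast
  define F where "F r = ?C r * A r - ?S r * B r" for r
  define F1 where "F1 r = - t\<^sup>2 * ?S r * A r - ?C r * B r" for r
  have "(F has_vector_derivative F1 r) (at r)" for r
    unfolding F_def F1_def by (rule derivative_eq_intros S C A B refl)+ (simp add: algebra_simps)
  moreover have "(F1 has_vector_derivative \<kappa> r - t\<^sup>2 * F r) (at r)" for r
  proof -
    have "(F1 has_vector_derivative \<kappa> r * ((?C r)\<^sup>2 + t\<^sup>2 * (?S r)\<^sup>2) - t\<^sup>2 * F r) (at r)"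
      unfolding F_def F1_def
      by (rule derivative_eq_intros S C A B refl)+ (simp add: algebra_simps power2_eq_square)
    then show ?thesis by (simp add: spherical_pythagoras)
  qed
  ultimately show ?thesis
    using A B by (intro exI[of _ F] exI[of _ F1]) (simp add: F_def F1_def)
qed

theorem eigenfunction_mean_value:
  assumes u: "C2_on hyp3 u" and P: "P \<in> hyp3"
    and ev: "\<And>Q. Q \<in> hyp3 \<Longrightarrow> - hyp_laplacian u Q = (1 + t\<^sup>2) * u Q"
    and \<kappa>: "continuous_on UNIV \<kappa>" and zero: "\<And>r. r \<ge> 1 \<Longrightarrow> \<kappa> r = 0"
  shows "radial_integral P u \<kappa> = 4 * pi * integral {0..1} (\<lambda>s. \<kappa> s * spherical_sin t s) * u P"
proof -
  obtain F F1 where F: "\<And>r. (F has_vector_derivative F1 r) (at r)"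
      "\<And>r. (F1 has_vector_derivative \<kappa> r - t\<^sup>2 * F r) (at r)" "\<And>r. r \<ge> 1 \<Longrightarrow> F r = 0 \<and> F1 r = 0"
    and F0: "F 0 = integral {0..1} (\<lambda>s. \<kappa> s * spherical_sin t s)"
    using ex_resolvent_vanishing_beyond_1[OF \<kappa> zero] by blast
  have "radial_integral P u (\<lambda>r. (\<kappa> r - t\<^sup>2 * F r) + t\<^sup>2 * F r) = 4 * pi * F 0 * u P"
    using F zero has_vector_derivative_imp_continuous_on_UNIV[OF F(1)]
    by (intro radial_integral_fundamental_solution[OF F(1,2) _ _ P u ev] continuous_intros \<kappa>) auto
  then show ?thesis by (simp add: F0)
qed

section \<open>The action on the half-space\<close>

lemma power2_norm_matrix: "(norm A)\<^sup>2 = (\<Sum>i\<in>UNIV. \<Sum>j\<in>UNIV. (norm (A $ i $ j))\<^sup>2)"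
  for A :: "'a::real_normed_vector^'n^'m"
  by (simp add: norm_vec_def L2_set_def sum_nonneg)

lemma norm_matrix_mult_le: "norm (A ** B) \<le> norm A * norm B"
  for A :: "complex^'n^'m" and B :: "complex^'k^'n"
proof (rule power2_le_imp_le)
  have entry: "(cmod ((A ** B) $ i $ j))\<^sup>2 \<le> (\<Sum>l\<in>UNIV. (cmod (A $ i $ l))\<^sup>2) * (\<Sum>l\<in>UNIV. (cmod (B $ l $ j))\<^sup>2)" for i j
  proof -
    have "cmod ((A ** B) $ i $ j) \<le> (\<Sum>l\<in>UNIV. cmod (A $ i $ l) * cmod (B $ l $ j))"
      by (simp add: matrix_matrix_mult_def norm_mult[symmetric] sum_norm_le)
    then have "(cmod ((A ** B) $ i $ j))\<^sup>2 \<le> (\<Sum>l\<in>UNIV. cmod (A $ i $ l) * cmod (B $ l $ j))\<^sup>2"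
      by (intro power_mono) auto
    also have "\<dots> \<le> (\<Sum>l\<in>UNIV. (cmod (A $ i $ l))\<^sup>2) * (\<Sum>l\<in>UNIV. (cmod (B $ l $ j))\<^sup>2)"
      by (rule Cauchy_Schwarz_ineq_sum)
    finally show ?thesis .
  qed
  have "(norm (A ** B))\<^sup>2 \<le> (\<Sum>i\<in>UNIV. \<Sum>j\<in>UNIV.
      (\<Sum>l\<in>UNIV. (cmod (A $ i $ l))\<^sup>2) * (\<Sum>l\<in>UNIV. (cmod (B $ l $ j))\<^sup>2))"
    unfolding power2_norm_matrix by (intro sum_mono entry)
  also have "\<dots> = (norm A)\<^sup>2 * (\<Sum>j\<in>UNIV. \<Sum>l\<in>UNIV. (cmod (B $ l $ j))\<^sup>2)"
    unfolding power2_norm_matrix[of A] sum_product by simp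
  also have "(\<Sum>j\<in>UNIV. \<Sum>l\<in>UNIV. (cmod (B $ l $ j))\<^sup>2) = (norm B)\<^sup>2"
    unfolding power2_norm_matrix by (rule sum.swap)
  finally show "(norm (A ** B))\<^sup>2 \<le> (norm A * norm B)\<^sup>2" by (simp add: power_mult_distrib)
qed simp

definition conj_transpose :: "complex^'n^'m \<Rightarrow> complex^'m^'n" where
  "conj_transpose A = (\<chi> i j. cnj (A $ j $ i))"

lemma conj_transpose_mult: "conj_transpose (A ** B) = conj_transpose B ** conj_transpose A"
  by (simp add: conj_transpose_def vec_eq_iff matrix_matrix_mult_def mult.commute)

lemma det_conj_transpose: "det (conj_transpose A) = cnj (det A)" for A :: "complex^2^2"
  by (simp add: conj_transpose_def det_2 mult.commute)

lemma matrix_add_rdistrib: "(A + B) ** C = A ** C + B ** C" for A :: "complex^'n^'m"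
  by (simp add: vec_eq_iff matrix_matrix_mult_def distrib_right sum.distrib)

lemma matrix_diff_ldistrib: "A ** (B - C) = A ** B - A ** C" for A :: "complex^'n^'m"
  by (simp add: vec_eq_iff matrix_matrix_mult_def right_diff_distrib sum_subtractf)

text \<open>The half-space as the space of positive definite Hermitian matrices of determinant \<open>1\<close>, on which
  \<open>A\<close> acts by \<open>H \<mapsto> A H A\<^sup>*\<close>.\<close>

definition hermitian_of :: "complex \<times> real \<Rightarrow> complex^2^2" where
  "hermitian_of P = vector
     [vector [of_real ((cmod (fst P))\<^sup>2 + (snd P)\<^sup>2) / of_real (snd P), fst P / of_real (snd P)],
      vector [cnj (fst P) / of_real (snd P), 1 / of_real (snd P)]]"

lemma hermitian_of_nth [simp]:
  "hermitian_of P $ 1 $ 1 = of_real ((cmod (fst P))\<^sup>2 + (snd P)\<^sup>2) / of_real (snd P)"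
  "hermitian_of P $ 1 $ 2 = fst P / of_real (snd P)"
  "hermitian_of P $ 2 $ 1 = cnj (fst P) / of_real (snd P)"
  "hermitian_of P $ 2 $ 2 = 1 / of_real (snd P)"
  by (simp_all add: hermitian_of_def)

lemma of_real_cmod_power2: "(complex_of_real (cmod z))\<^sup>2 = z * cnj z"
  by (metis complex_norm_square of_real_power)

lemma hermitian_of_sl2_act:
  assumes A: "det A = 1" and P: "P \<in> hyp3"
  shows "hermitian_of (sl2_act A P) = A ** hermitian_of P ** conj_transpose A"
proof -
  define a b c d where abcd: "a = A $ 1 $ 1" "b = A $ 1 $ 2" "c = A $ 2 $ 1" "d = A $ 2 $ 2"
  obtain z y where Pzy: "P = (z, y)" by force
  have y: "y > 0" using P by (simp add: Pzy hyp3_def)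
  have det: "a * d - b * c = 1" using A by (simp add: det_2 abcd)
  then have det_cnj: "cnj a * cnj d - cnj b * cnj c = 1"
    by (metis complex_cnj_diff complex_cnj_mult complex_cnj_one)
  define N where "N = (cmod (c * z + d))\<^sup>2 + (cmod c)\<^sup>2 * y\<^sup>2"
  define w where "w = (a * z + b) * cnj (c * z + d) + a * cnj c * of_real (y\<^sup>2)"
  define M where "M = (a * z + b) * cnj (a * z + b) + a * cnj a * of_real y ^ 2"
  have act: "sl2_act A P = (w / of_real N, y / N)"
    by (simp add: sl2_act_def Let_def Pzy abcd N_def w_def)
  have "N > 0"
    using sl2_act_mem_hyp3[OF A P] y unfolding act hyp3_def by (simp add: zero_less_divide_iff)
  then have nonzero: "complex_of_real N \<noteq> 0" "complex_of_real y \<noteq> 0" using y by simp_all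
  have N: "of_real N = (c * z + d) * cnj (c * z + d) + c * cnj c * of_real y ^ 2"
    unfolding N_def by (simp add: of_real_cmod_power2)
  have "of_real N * M - w * cnj w = of_real y ^ 2 * ((a * d - b * c) * (cnj a * cnj d - cnj b * cnj c))"
    unfolding N M_def w_def by (simp add: algebra_simps power2_eq_square)
  then have NM: "w * cnj w + of_real y ^ 2 = of_real N * M"
    using det det_cnj by (simp add: algebra_simps)
  note entries = matrix_matrix_mult_def sum_2 conj_transpose_def abcd[symmetric] Pzy of_real_cmod_power2
  have "hermitian_of (sl2_act A P) $ 1 $ 1 = (w * cnj w + of_real y ^ 2) / (of_real N * of_real y)"
    unfolding act using nonzero
    by (simp add: norm_divide power_divide of_real_cmod_power2) (simp add: field_simps power2_eq_square)
  also have "\<dots> = (A ** hermitian_of P ** conj_transpose A) $ 1 $ 1"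
    unfolding NM using nonzero by (simp add: entries M_def) (simp add: field_simps power2_eq_square)
  finally have "hermitian_of (sl2_act A P) $ 1 $ 1 = (A ** hermitian_of P ** conj_transpose A) $ 1 $ 1" .
  moreover have "hermitian_of (sl2_act A P) $ 1 $ 2 = (A ** hermitian_of P ** conj_transpose A) $ 1 $ 2"
    "hermitian_of (sl2_act A P) $ 2 $ 1 = (A ** hermitian_of P ** conj_transpose A) $ 2 $ 1"
    unfolding act using nonzero
    by (simp_all add: entries w_def) (simp_all add: field_simps power2_eq_square)
  moreover have "hermitian_of (sl2_act A P) $ 2 $ 2 = (A ** hermitian_of P ** conj_transpose A) $ 2 $ 2"
    unfolding act using nonzero
    by (simp add: entries N) (simp add: field_simps power2_eq_square)
  ultimately show ?thesis by (simp add: vec_eq_iff forall_2)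
qed

lemma hermitian_of_eq_iff:
  assumes "P \<in> hyp3" "Q \<in> hyp3"
  shows "hermitian_of P = hermitian_of Q \<longleftrightarrow> P = Q"
proof
  assume "hermitian_of P = hermitian_of Q"
  then have "hermitian_of P $ 2 $ 2 = hermitian_of Q $ 2 $ 2" "hermitian_of P $ 1 $ 2 = hermitian_of Q $ 1 $ 2"
    by simp_all
  then have "snd P = snd Q" "fst P = fst Q" using assms by (auto simp: hyp3_def)
  then show "P = Q" by (simp add: prod_eq_iff)
qed simp

lemma sl2_act_mult:
  assumes "det A = 1" "det B = 1" "P \<in> hyp3"
  shows "sl2_act (A ** B) P = sl2_act A (sl2_act B P)"
proof -
  have "hermitian_of (sl2_act (A ** B) P) = hermitian_of (sl2_act A (sl2_act B P))"
    using assms by (simp add: hermitian_of_sl2_act sl2_act_mem_hyp3 det_mul conj_transpose_mult matrix_mul_assoc)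
  then show ?thesis
    using assms by (simp add: hermitian_of_eq_iff sl2_act_mem_hyp3 det_mul)
qed

lemma det_hermitian_of_add:
  assumes "P \<in> hyp3" "Q \<in> hyp3"
  shows "det (hermitian_of P + hermitian_of Q) = of_real (2 * hcosh P Q + 2)"
proof -
  obtain z y where P: "P = (z, y)" by force
  obtain w v where Q: "Q = (w, v)" by force
  have nonzero: "complex_of_real y \<noteq> 0" "complex_of_real v \<noteq> 0"
    using assms by (auto simp: P Q hyp3_def)
  have "complex_of_real (hcosh P Q)
      = ((z - w) * cnj (z - w) + of_real y ^ 2 + of_real v ^ 2) / (2 * of_real y * of_real v)"
    by (simp add: hcosh_def P Q of_real_cmod_power2)
  then show ?thesis
    using nonzero by (simp add: det_2 P Q of_real_cmod_power2) (simp add: field_simps power2_eq_square)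
qed

lemma hcosh_sl2_act:
  assumes "det A = 1" "P \<in> hyp3" "Q \<in> hyp3"
  shows "hcosh (sl2_act A P) (sl2_act A Q) = hcosh P Q"
proof -
  have "of_real (2 * hcosh (sl2_act A P) (sl2_act A Q) + 2)
      = det (hermitian_of (sl2_act A P) + hermitian_of (sl2_act A Q))"
    using assms by (simp add: det_hermitian_of_add sl2_act_mem_hyp3)
  also have "\<dots> = det (A ** (hermitian_of P + hermitian_of Q) ** conj_transpose A)"
    using assms by (simp add: hermitian_of_sl2_act matrix_add_ldistrib matrix_add_rdistrib)
  also have "\<dots> = of_real (2 * hcosh P Q + 2)"
    using assms by (simp add: det_mul det_conj_transpose det_hermitian_of_add)
  finally show ?thesis unfolding of_real_eq_iff by simp
qed

lemma hdist_sl2_act: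
  "det A = 1 \<Longrightarrow> P \<in> hyp3 \<Longrightarrow> Q \<in> hyp3 \<Longrightarrow> hdist (sl2_act A P) (sl2_act A Q) = hdist P Q"
  by (simp add: hdist_def hcosh_sl2_act)

lemma base_point_hyp3 [simp]: "(0, 1) \<in> hyp3"
  by (simp add: hyp3_def)

lemma power2_norm_eq_hcosh:
  assumes "det A = 1"
  shows "(norm A)\<^sup>2 = 2 * hcosh (0, 1) (sl2_act A (0, 1))"
proof -
  let ?Q = "sl2_act A (0, 1)"
  have "snd ?Q > 0" using sl2_act_mem_hyp3[OF assms base_point_hyp3] by (simp add: hyp3_def)
  then have "complex_of_real (2 * hcosh (0, 1) ?Q) = hermitian_of ?Q $ 1 $ 1 + hermitian_of ?Q $ 2 $ 2"
    by (simp add: hcosh_def field_simps)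
  also have "hermitian_of (0, 1) = mat 1"
    by (simp add: vec_eq_iff forall_2 mat_def)
  then have "hermitian_of ?Q = A ** conj_transpose A"
    using hermitian_of_sl2_act[OF assms base_point_hyp3] by simp
  then have "hermitian_of ?Q $ 1 $ 1 + hermitian_of ?Q $ 2 $ 2 = of_real ((norm A)\<^sup>2)"
    by (simp add: power2_norm_matrix matrix_matrix_mult_def sum_2 conj_transpose_def of_real_cmod_power2)
  finally show ?thesis by (simp only: of_real_eq_iff)
qed

definition sl2_inv :: "complex^2^2 \<Rightarrow> complex^2^2" where
  "sl2_inv A = vector [vector [A $ 2 $ 2, - A $ 1 $ 2], vector [- A $ 2 $ 1, A $ 1 $ 1]]"

lemma sl2_inv:
  assumes "det A = 1"
  shows "A ** sl2_inv A = mat 1" "sl2_inv A ** A = mat 1" "det (sl2_inv A) = 1"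
  using assms
  by (simp_all add: sl2_inv_def vec_eq_iff forall_2 matrix_matrix_mult_def sum_2 mat_def det_2 algebra_simps)

lemma sl2_inv_sl2_inv [simp]: "sl2_inv (sl2_inv A) = A"
  by (simp add: sl2_inv_def vec_eq_iff forall_2)

lemma norm_sl2_inv: "norm (sl2_inv A) = norm A"
  by (rule power2_eq_imp_eq) (simp_all add: power2_norm_matrix sl2_inv_def sum_2)

lemma sl2_act_inv:
  assumes "det A = 1" "P \<in> hyp3"
  shows "sl2_act A (sl2_act (sl2_inv A) P) = P" "sl2_act (sl2_inv A) (sl2_act A P) = P"
  using assms sl2_inv[OF assms(1)] by (simp_all add: sl2_act_mult[symmetric] sl2_act_one)

section \<open>Discrete groups\<close>

lemma uminus_mat_1_mult: "- mat 1 ** A = - A" "A ** - mat 1 = - A" for A :: "complex^2^2"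
  by (simp_all add: vec_eq_iff forall_2 matrix_matrix_mult_def sum_2 mat_def)

lemma coset_SL2C: "{mat 1, - mat 1} #>\<^bsub>SL2C\<^esub> A = {A, - A}"
  by (auto simp: r_coset_def SL2C_def uminus_mat_1_mult)

lemma normal_center_SL2C: "{mat 1, - mat 1} \<lhd> SL2C"
proof (rule group.normalI[OF group_SL2C])
  have det: "det (- mat 1 :: complex^2^2) = 1" by (simp add: det_2 mat_def)
  show "subgroup {mat 1, - mat 1} SL2C"
  proof (rule group.subgroupI[OF group_SL2C])
    fix A assume A: "A \<in> {mat 1, - mat 1 :: complex^2^2}"
    then have "A \<otimes>\<^bsub>SL2C\<^esub> A = \<one>\<^bsub>SL2C\<^esub>" "A \<in> carrier SL2C"
      using det by (auto simp: SL2C_def uminus_mat_1_mult)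
    then have "inv\<^bsub>SL2C\<^esub> A = A" by (metis group.inv_equality group_SL2C)
    then show "inv\<^bsub>SL2C\<^esub> A \<in> {mat 1, - mat 1}" using A by simp
  qed (use det in \<open>auto simp: SL2C_def uminus_mat_1_mult\<close>)
  show "\<forall>A\<in>carrier SL2C. {mat 1, - mat 1} #>\<^bsub>SL2C\<^esub> A = A <#\<^bsub>SL2C\<^esub> {mat 1, - mat 1}"
    by (auto simp: r_coset_def l_coset_def SL2C_def uminus_mat_1_mult)
qed

lemma group_PSL2C: "group PSL2C"
  unfolding PSL2C_def by (rule normal.factorgroup_is_group[OF normal_center_SL2C])

locale discrete_PSL2C =
  fixes \<Gamma> :: "(complex^2^2) set set"
  assumes discrete: "discrete_subgroup \<Gamma>"
begin

lemma subgroup: "subgroup \<Gamma> PSL2C"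
  using discrete by (simp add: discrete_subgroup_def)

lemma lift_det: "A \<in> \<Union>\<Gamma> \<Longrightarrow> det A = 1"
  and lift_coset: "A \<in> \<Union>\<Gamma> \<Longrightarrow> {A, - A} \<in> \<Gamma>"
proof -
  assume "A \<in> \<Union>\<Gamma>"
  then obtain X where X: "A \<in> X" "X \<in> \<Gamma>" by auto
  then have "X \<in> carrier PSL2C" using subgroup subgroup.subset by blast
  then obtain B where B: "X = {B, - B}" "det B = 1" by (auto simp: PSL2C_carrier)
  then have "det (- B) = 1" by (simp add: det_2)
  then show "det A = 1" "{A, - A} \<in> \<Gamma>" using X B by (auto simp: insert_commute)
qed

lemma lift_one: "mat 1 \<in> \<Union>\<Gamma>"
proof -
  have "\<one>\<^bsub>PSL2C\<^esub> = {mat 1, - mat 1}" by (simp add: PSL2C_def FactGroup_def)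
  then have "{mat 1, - mat 1} \<in> \<Gamma>" using subgroup.one_closed[OF subgroup] by simp
  then show ?thesis by auto
qed

lemma lift_mult:
  assumes "A \<in> \<Union>\<Gamma>" "B \<in> \<Union>\<Gamma>" shows "A ** B \<in> \<Union>\<Gamma>"
proof -
  have "{A, - A} \<otimes>\<^bsub>PSL2C\<^esub> {B, - B} \<in> \<Gamma>"
    using subgroup.m_closed[OF subgroup] lift_coset assms by blast
  moreover have "A ** B \<in> {A, - A} \<otimes>\<^bsub>PSL2C\<^esub> {B, - B}"
    by (auto simp: PSL2C_def FactGroup_def set_mult_def SL2C_def)
  ultimately show ?thesis by blast
qed

lemma lift_inv:
  assumes A: "A \<in> \<Union>\<Gamma>" shows "sl2_inv A \<in> \<Union>\<Gamma>"
proof -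
  have X: "{A, - A} \<in> carrier PSL2C" using lift_coset[OF A] subgroup.subset[OF subgroup] by auto
  have inv: "inv\<^bsub>PSL2C\<^esub> {A, - A} \<in> \<Gamma>" using subgroup.m_inv_closed[OF subgroup lift_coset[OF A]] .
  then have "inv\<^bsub>PSL2C\<^esub> {A, - A} \<in> carrier PSL2C" using subgroup.subset[OF subgroup] by blast
  then obtain B where B: "inv\<^bsub>PSL2C\<^esub> {A, - A} = {B, - B}" by (auto simp: PSL2C_carrier)
  have "B ** A \<in> inv\<^bsub>PSL2C\<^esub> {A, - A} \<otimes>\<^bsub>PSL2C\<^esub> {A, - A}"
    unfolding B by (auto simp: PSL2C_def FactGroup_def set_mult_def SL2C_def)
  also have "inv\<^bsub>PSL2C\<^esub> {A, - A} \<otimes>\<^bsub>PSL2C\<^esub> {A, - A} = {mat 1, - mat 1}"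
    using group.l_inv[OF group_PSL2C X] by (simp add: PSL2C_def FactGroup_def)
  finally have "(B ** A) ** sl2_inv A = sl2_inv A \<or> (B ** A) ** sl2_inv A = - sl2_inv A"
    by (auto simp: uminus_mat_1_mult)
  moreover have "(B ** A) ** sl2_inv A = B"
    using sl2_inv[OF lift_det[OF A]] by (simp add: matrix_mul_assoc[symmetric])
  ultimately have "sl2_inv A \<in> {B, - B}" by auto
  then show ?thesis using inv B by auto
qed

lemma lift_isolated_one:
  obtains e where "e > 0" "\<And>A. A \<in> \<Union>\<Gamma> \<Longrightarrow> dist A (mat 1) < e \<Longrightarrow> A = mat 1 \<or> A = - mat 1"
proof -
  have "openin (subtopology PSL2C_topology \<Gamma>) {{mat 1, - mat 1}}"
    using discrete lift_coset[OF lift_one] by (simp add: discrete_subgroup_def)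
  then obtain U where U: "openin PSL2C_topology U" "{{mat 1, - mat 1}} = U \<inter> \<Gamma>"
    by (auto simp: openin_subtopology)
  have "openin (top_of_set (carrier SL2C)) {A \<in> carrier SL2C. {A, - A} \<in> U}"
    using U(1) unfolding PSL2C_topology_def openin_quot_topology coset_SL2C by simp
  then obtain V where V: "open V" "{A \<in> carrier SL2C. {A, - A} \<in> U} = carrier SL2C \<inter> V"
    by (auto simp: openin_open)
  have "mat 1 \<in> {A \<in> carrier SL2C. {A, - A} \<in> U}"
    using U(2) by (auto simp: SL2C_def)
  then obtain e where e: "e > 0" "ball (mat 1) e \<subseteq> V"
    using V open_contains_ball by blast
  have "A = mat 1 \<or> A = - mat 1" if A: "A \<in> \<Union>\<Gamma>" "dist A (mat 1) < e" for A
  proof -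
    have "A \<in> carrier SL2C \<inter> V" using A e lift_det by (auto simp: SL2C_def dist_commute)
    then have "{A, - A} \<in> U \<inter> \<Gamma>" using V lift_coset[OF A(1)] by blast
    then have "{A, - A} = {mat 1, - mat 1}" unfolding U(2)[symmetric] by (rule singletonD)
    then have "A \<in> {mat 1, - mat 1}" by (metis insertI1)
    then show ?thesis by simp
  qed
  then show ?thesis using that e(1) by blast
qed

lemma finite_lift_norm_le: "finite {A \<in> \<Union>\<Gamma>. norm A \<le> R}"
proof -
  obtain e where e: "e > 0" "\<And>A. A \<in> \<Union>\<Gamma> \<Longrightarrow> dist A (mat 1) < e \<Longrightarrow> A = mat 1 \<or> A = - mat 1"
    using lift_isolated_one by blast
  have norm_ge_1: "1 \<le> norm A" if "A \<in> \<Union>\<Gamma>" for A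
  proof (rule power2_le_imp_le)
    show "1\<^sup>2 \<le> (norm A)\<^sup>2"
      using power2_norm_eq_hcosh[OF lift_det[OF that]] hcosh_ge_1[of "(0, 1)" "sl2_act A (0, 1)"]
        sl2_act_mem_hyp3[OF lift_det[OF that]] by simp
  qed simp
  define \<delta> where "\<delta> = min 1 (e / max R 1)"
  have "A = B" if A: "A \<in> \<Union>\<Gamma>" "norm A \<le> R" and B: "B \<in> \<Union>\<Gamma>" "dist A B < \<delta>" for A B
  proof -
    note inv = sl2_inv[OF lift_det[OF A(1)]]
    have "dist (sl2_inv A ** B) (mat 1) = norm (sl2_inv A ** (B - A))"
      by (simp add: dist_norm matrix_diff_ldistrib inv)
    also have "\<dots> \<le> norm A * dist A B"
      using norm_matrix_mult_le[of "sl2_inv A" "B - A"]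
      by (simp add: norm_sl2_inv dist_norm norm_minus_commute)
    also have "\<dots> \<le> max R 1 * dist A B" using A by (intro mult_right_mono) auto
    also have "\<dots> < e"
      using B(2) pos_less_divide_eq[of "max R 1" "dist A B" e] by (simp add: \<delta>_def mult.commute)
    finally have "sl2_inv A ** B = mat 1 \<or> sl2_inv A ** B = - mat 1"
      using e(2) lift_mult[OF lift_inv[OF A(1)] B(1)] by blast
    then have "A ** (sl2_inv A ** B) = A \<or> A ** (sl2_inv A ** B) = - A"
      by (auto simp: uminus_mat_1_mult)
    then have "B = A \<or> B = - A" by (simp add: matrix_mul_assoc inv)
    moreover have "B \<noteq> - A"
    proof
      assume "B = - A"
      then have "dist A B = 2 * norm A" by (simp add: dist_norm flip: scaleR_2)
      then show False using norm_ge_1[OF A(1)] B(2) by (simp add: \<delta>_def)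
    qed
    ultimately show ?thesis by simp
  qed
  then have "uniform_discrete {A \<in> \<Union>\<Gamma>. norm A \<le> R}"
    unfolding uniform_discrete_def using e(1) by (intro exI[of _ \<delta>]) (auto simp: \<delta>_def)
  moreover have "bounded {A \<in> \<Union>\<Gamma>. norm A \<le> R}"
    by (auto simp: bounded_iff)
  ultimately show ?thesis using uniform_discrete_finite_iff by blast
qed

lemma countable_lift: "countable (\<Union>\<Gamma>)"
proof -
  have "\<Union>\<Gamma> \<subseteq> (\<Union>n. {A \<in> \<Union>\<Gamma>. norm A \<le> real n})"
    using real_arch_simple by blast
  then show ?thesis
    by (rule countable_subset) (rule countable_UN[OF countableI_type countable_finite[OF finite_lift_norm_le]])
qed

lemma finite_lift_cball_meets_cball:
  assumes P: "P \<in> hyp3" and P': "P' \<in> hyp3"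
  shows "finite {A \<in> \<Union>\<Gamma>. sl2_act A ` hyp_cball P r \<inter> hyp_cball P' r' \<noteq> {}}"
proof (rule finite_subset[OF _ finite_lift_norm_le])
  let ?O = "(0, 1) :: complex \<times> real"
  let ?R = "sqrt (1024 * hcosh ?O P' * cosh r' * (cosh r * hcosh P ?O))"
  show "{A \<in> \<Union>\<Gamma>. sl2_act A ` hyp_cball P r \<inter> hyp_cball P' r' \<noteq> {}} \<subseteq> {A \<in> \<Union>\<Gamma>. norm A \<le> ?R}"
  proof
    fix A assume "A \<in> {A \<in> \<Union>\<Gamma>. sl2_act A ` hyp_cball P r \<inter> hyp_cball P' r' \<noteq> {}}"
    then obtain Q where A: "A \<in> \<Union>\<Gamma>" and Q: "Q \<in> hyp_cball P r" "sl2_act A Q \<in> hyp_cball P' r'" by blast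
    note det = lift_det[OF A]
    have r: "r \<ge> 0" "r' \<ge> 0" using Q by (auto simp: hyp_cball_def intro: order_trans[OF hdist_nonneg])
    have mem: "Q \<in> hyp3" "sl2_act A Q \<in> hyp3" "sl2_act A ?O \<in> hyp3"
      using Q det by (auto simp: hyp_cball_def intro: sl2_act_mem_hyp3)
    have near: "hcosh P Q \<le> cosh r" "hcosh P' (sl2_act A Q) \<le> cosh r'"
      using Q r P P' by (simp_all add: hyp_cball_eq_hcosh)
    note pos = hcosh_ge_1[OF base_point_hyp3 P'] hcosh_ge_1[OF P base_point_hyp3]
    have "hcosh ?O (sl2_act A Q) \<le> 8 * hcosh ?O P' * hcosh P' (sl2_act A Q)"
      using mem P' by (intro hcosh_triangle) auto
    also have "\<dots> \<le> 8 * hcosh ?O P' * cosh r'" using near pos by (intro mult_left_mono) auto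
    finally have target: "hcosh ?O (sl2_act A Q) \<le> 8 * hcosh ?O P' * cosh r'" .
    have "hcosh Q ?O \<le> 8 * hcosh Q P * hcosh P ?O" using mem P by (intro hcosh_triangle) auto
    also have "\<dots> \<le> 8 * cosh r * hcosh P ?O"
      using near pos by (intro mult_right_mono) (auto simp: hcosh_commute)
    finally have source: "hcosh Q ?O \<le> 8 * cosh r * hcosh P ?O" .
    have "(norm A)\<^sup>2 = 2 * hcosh ?O (sl2_act A ?O)" by (rule power2_norm_eq_hcosh[OF det])
    also have "\<dots> \<le> 2 * (8 * hcosh ?O (sl2_act A Q) * hcosh (sl2_act A Q) (sl2_act A ?O))"
      using mem by (intro mult_left_mono hcosh_triangle) auto
    also have "hcosh (sl2_act A Q) (sl2_act A ?O) = hcosh Q ?O"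
      using mem det by (intro hcosh_sl2_act) auto
    also have "2 * (8 * hcosh ?O (sl2_act A Q) * hcosh Q ?O)
        \<le> 2 * (8 * (8 * hcosh ?O P' * cosh r') * (8 * cosh r * hcosh P ?O))"
      using target source pos hcosh_ge_1[OF mem(1) base_point_hyp3]
      by (intro mult_left_mono mult_mono) auto
    finally show "A \<in> {A \<in> \<Union>\<Gamma>. norm A \<le> ?R}"
      using A by (auto intro!: real_le_rsqrt simp: mult_ac)
  qed
qed

end

section \<open>Invariance of the hyperbolic volume\<close>

lemma sinh_gt_self:
  fixes x :: real assumes "x > 0" shows "x < sinh x"
proof -
  have "x / 2 \<le> sinh (x / 2)"
    using real_le_x_sinh[of "x / 2"] assms by (simp add: sinh_def exp_minus)
  then have "x \<le> 2 * sinh (x / 2) * 1" by simp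
  also have "\<dots> < 2 * sinh (x / 2) * cosh (x / 2)"
    using assms cosh_real_nonneg_less_iff[of 0 "x / 2"] by (intro mult_strict_left_mono) auto
  also have "\<dots> = sinh x" using sinh_double[of "x / 2"] by simp
  finally show ?thesis .
qed

definition hyp_ball_vol :: "real \<Rightarrow> ennreal" where
  "hyp_ball_vol r = ennreal (pi * (sinh (2 * r) - 2 * r))"

lemma hyp_ball_vol_pos: "r > 0 \<Longrightarrow> 0 < hyp_ball_vol r"
  using sinh_gt_self[of "2 * r"] by (simp add: hyp_ball_vol_def)

lemma hyp_ball_vol_finite: "hyp_ball_vol r < \<infinity>"
  by (simp add: hyp_ball_vol_def)

lemma hyp_ball_subset_open:
  assumes "P \<in> hyp3" "open U" "P \<in> U"
  shows "\<forall>\<^sub>F n in sequentially. hyp_ball P (inverse (real (Suc n))) \<subseteq> U"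
proof -
  obtain r where r: "r > 0" "hyp_cball P r \<subseteq> U" using open_contains_hyp_cball[OF assms] by blast
  have "\<forall>\<^sub>F n in sequentially. inverse (real (Suc n)) < r"
    using order_tendstoD(2)[OF LIMSEQ_inverse_real_of_nat] r(1) by simp
  then show ?thesis
    by eventually_elim (use r(2) in \<open>force simp: hyp_ball_def hyp_cball_def\<close>)
qed

locale uniform_hyp_measure =
  fixes M :: "(complex \<times> real) measure"
  assumes sets_M [simp, measurable_cong]: "sets M = sets borel"
    and null: "emeasure M (- hyp3) = 0"
    and ball_vol: "\<And>P r. P \<in> hyp3 \<Longrightarrow> r > 0 \<Longrightarrow> emeasure M (hyp_ball P r) = hyp_ball_vol r"
begin

lemma space_M [simp]: "space M = UNIV"
  using sets_eq_imp_space_eq[OF sets_M] by simp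

lemma null_subset: "X \<in> sets borel \<Longrightarrow> X \<subseteq> - hyp3 \<Longrightarrow> emeasure M X = 0"
  using emeasure_mono[of X "- hyp3" M] null by simp

end

definition hyp_exhaustion :: "(complex \<times> real) set set" where
  "hyp_exhaustion = insert (- hyp3) (range (\<lambda>n. hyp_ball (0, 1) (real (Suc n))))"

lemma countable_hyp_exhaustion: "countable hyp_exhaustion"
  by (simp add: hyp_exhaustion_def)

lemma Union_hyp_exhaustion: "\<Union>hyp_exhaustion = UNIV"
proof -
  have "Q \<in> \<Union>hyp_exhaustion" for Q
  proof -
    obtain n where "hdist (0, 1) Q < real n" using reals_Archimedean2 by blast
    then show ?thesis by (auto simp: hyp_exhaustion_def hyp_ball_def intro!: exI[of _ n])
  qed
  then show ?thesis by blast
qed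

lemma (in uniform_hyp_measure) emeasure_hyp_exhaustion: "X \<in> hyp_exhaustion \<Longrightarrow> emeasure M X < \<infinity>"
  using null ball_vol[OF base_point_hyp3] hyp_ball_vol_finite by (auto simp: hyp_exhaustion_def)

sublocale uniform_hyp_measure \<subseteq> sigma_finite_measure M
proof
  show "\<exists>A. countable A \<and> A \<subseteq> sets M \<and> \<Union>A = space M \<and> (\<forall>a\<in>A. emeasure M a \<noteq> \<infinity>)"
    using countable_hyp_exhaustion Union_hyp_exhaustion emeasure_hyp_exhaustion
    by (intro exI[of _ hyp_exhaustion]) (auto simp: hyp_exhaustion_def less_top)
qed

text \<open>Christensen's argument that a measure is determined by its values on balls, if these do not
  depend on the centre: by Fatou's lemma \<open>M U\<close> is at most the lower limit of the averages over \<open>U\<close> of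
  \<open>N (U \<inter> B(x, r)) / V(r)\<close> as \<open>r \<rightarrow> 0\<close>, and by Fubini's theorem these averages are at most \<open>N U\<close>.\<close>

context
  fixes M N :: "(complex \<times> real) measure"
  assumes M: "uniform_hyp_measure M" and N: "uniform_hyp_measure N"
begin

interpretation M: uniform_hyp_measure M by (fact M)
interpretation N: uniform_hyp_measure N by (fact N)
interpretation MN: pair_sigma_finite M N ..

lemma nn_integral_ball_overlap_le:
  assumes U: "open U" "U \<subseteq> hyp3" and r: "r > 0"
  shows "(\<integral>\<^sup>+x. \<integral>\<^sup>+y. indicator U x * indicator U y * indicator {..<r} (hdist x y) \<partial>N \<partial>M)
    \<le> emeasure N U * hyp_ball_vol r"
proof -
  have [measurable]: "U \<in> sets borel" using U by simp
  have [measurable]: "U \<in> sets M" "U \<in> sets N" using U by simp_all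
  define k :: "complex \<times> real \<Rightarrow> complex \<times> real \<Rightarrow> ennreal" where
    "k x y = indicator U x * indicator U y * indicator {..<r} (hdist x y)" for x y
  have "(\<lambda>p. k (fst p) (snd p)) \<in> borel_measurable (M \<Otimes>\<^sub>M N)"
    unfolding k_def by measurable
  then have "(\<integral>\<^sup>+x. \<integral>\<^sup>+y. k x y \<partial>N \<partial>M) = (\<integral>\<^sup>+y. \<integral>\<^sup>+x. k x y \<partial>M \<partial>N)"
    using MN.Fubini[of "\<lambda>p. k (fst p) (snd p)"] by simp
  also have "\<dots> \<le> (\<integral>\<^sup>+y. indicator U y * hyp_ball_vol r \<partial>N)"
  proof (rule nn_integral_mono)
    fix y
    show "(\<integral>\<^sup>+x. k x y \<partial>M) \<le> indicator U y * hyp_ball_vol r"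
    proof (cases "y \<in> U")
      case True
      then have y: "y \<in> hyp3" using U by auto
      have "(\<integral>\<^sup>+x. k x y \<partial>M) \<le> (\<integral>\<^sup>+x. indicator (hyp_ball y r) x \<partial>M)"
        using U by (intro nn_integral_mono) (auto simp: k_def indicator_def hyp_ball_def hdist_commute)
      then show ?thesis using M.ball_vol[OF y r] True by simp
    qed (simp add: k_def)
  qed
  also have "\<dots> = emeasure N U * hyp_ball_vol r" by (subst nn_integral_multc) auto
  finally show ?thesis by (simp add: k_def)
qed

lemma uniform_hyp_measure_le_open:
  assumes U: "open U" "U \<subseteq> hyp3"
  shows "emeasure M U \<le> emeasure N U"
proof -
  have [measurable]: "U \<in> sets borel" using U by simp
  have [measurable]: "U \<in> sets M" "U \<in> sets N" using U by simp_all
  define r :: "nat \<Rightarrow> real" where "r n = inverse (real (Suc n))" for n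
  have r: "r n > 0" for n by (simp add: r_def)
  define A where "A n x = (\<integral>\<^sup>+y. indicator U x * indicator U y * indicator {..<r n} (hdist x y) \<partial>N)" for n x
  let ?V = "\<lambda>n. hyp_ball_vol (r n)"
  have V: "?V n / ?V n = 1" for n
    using hyp_ball_vol_pos[OF r, of n] hyp_ball_vol_finite by (intro ennreal_divide_self) auto
  have [measurable]: "A n \<in> borel_measurable M" for n
    unfolding A_def by measurable
  have A_eq: "\<forall>\<^sub>F n in sequentially. A n x = ?V n" if x: "x \<in> U" for x
    using hyp_ball_subset_open[OF subsetD[OF U(2) x] U(1) x, folded r_def]
  proof eventually_elim
    case (elim n)
    then have "indicator U x * indicator U y * indicator {..<r n} (hdist x y) = (indicator (hyp_ball x (r n)) y :: ennreal)" for y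
      using x U(2) by (auto simp: hyp_ball_def indicator_def)
    then show ?case using N.ball_vol[OF subsetD[OF U(2) x] r] by (simp add: A_def)
  qed
  have "emeasure M U = (\<integral>\<^sup>+x. indicator U x \<partial>M)" by simp
  also have "\<dots> \<le> (\<integral>\<^sup>+x. liminf (\<lambda>n. A n x / ?V n) \<partial>M)"
  proof (rule nn_integral_mono)
    fix x
    have "1 \<le> liminf (\<lambda>n. A n x / ?V n)" if "x \<in> U"
      using A_eq[OF that] V by (intro Liminf_bounded) (auto elim: eventually_mono)
    then show "indicator U x \<le> liminf (\<lambda>n. A n x / ?V n)" by (simp split: split_indicator)
  qed
  also have "\<dots> \<le> liminf (\<lambda>n. \<integral>\<^sup>+x. A n x / ?V n \<partial>M)"
    by (rule nn_integral_liminf) measurable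
  also have "\<dots> \<le> liminf (\<lambda>n. emeasure N U)"
  proof (intro Liminf_mono always_eventually allI)
    fix n
    have "(\<integral>\<^sup>+x. A n x / ?V n \<partial>M) = (\<integral>\<^sup>+x. A n x \<partial>M) / ?V n"
      by (rule nn_integral_divide) measurable
    also have "\<dots> \<le> emeasure N U * ?V n / ?V n"
      unfolding A_def by (intro divide_right_mono_ennreal nn_integral_ball_overlap_le U r)
    also have "\<dots> = emeasure N U" using V[of n] by (simp add: ennreal_times_divide[symmetric])
    finally show "(\<integral>\<^sup>+x. A n x / ?V n \<partial>M) \<le> emeasure N U" .
  qed
  also have "\<dots> = emeasure N U" by (simp add: Liminf_const)
  finally show ?thesis .
qed

end

lemma uniform_hyp_measure_unique:
  assumes M: "uniform_hyp_measure M" and N: "uniform_hyp_measure N"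
  shows "M = N"
proof -
  interpret M: uniform_hyp_measure M by fact
  interpret N: uniform_hyp_measure N by fact
  let ?E = "{U. open U \<and> U \<subseteq> hyp3} \<union> {X \<in> sets borel. X \<subseteq> - hyp3}"
  have borel: "sets borel = sigma_sets UNIV ?E"
  proof
    have "W \<in> sigma_sets UNIV ?E" if "open W" for W
    proof -
      have "W \<inter> hyp3 \<in> sigma_sets UNIV ?E" "W - hyp3 \<in> sigma_sets UNIV ?E"
        using that open_hyp3 by (auto intro!: sigma_sets.Basic)
      then have "(W \<inter> hyp3) \<union> (W - hyp3) \<in> sigma_sets UNIV ?E" by (rule sigma_sets_Un)
      then show ?thesis by (simp add: Int_Diff_Un)
    qed
    then show "sets borel \<subseteq> sigma_sets UNIV ?E"
      unfolding borel_def by (auto intro!: sigma_sets_mono)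
    have "?E \<subseteq> sets borel" by auto
    then show "sigma_sets UNIV ?E \<subseteq> sets borel"
      using sets.sigma_sets_subset[of ?E borel] by simp
  qed
  show ?thesis
  proof (rule measure_eqI_generator_eq_countable[where E = ?E and \<Omega> = UNIV and A = hyp_exhaustion])
    show "Int_stable ?E"
    proof (rule Int_stableI)
      fix a b assume "a \<in> ?E" "b \<in> ?E"
      then consider "open (a \<inter> b)" "a \<inter> b \<subseteq> hyp3" | "a \<inter> b \<in> sets borel" "a \<inter> b \<subseteq> - hyp3" | "a \<inter> b = {}"
        by blast
      then show "a \<inter> b \<in> ?E" by cases auto
    qed
    show "emeasure M X = emeasure N X" if "X \<in> ?E" for X
      using that uniform_hyp_measure_le_open[OF M N] uniform_hyp_measure_le_open[OF N M]
        M.null_subset N.null_subset by (auto intro: antisym)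
    show "sets M = sigma_sets UNIV ?E" "sets N = sigma_sets UNIV ?E" using borel by simp_all
    show "hyp_exhaustion \<subseteq> ?E"
      using open_hyp_ball[OF base_point_hyp3] by (auto simp: hyp_exhaustion_def hyp_ball_def)
    show "emeasure M X \<noteq> \<infinity>" if "X \<in> hyp_exhaustion" for X
      using M.emeasure_hyp_exhaustion[OF that] by simp
  qed (simp_all add: countable_hyp_exhaustion Union_hyp_exhaustion)
qed

lemma uniform_hyp_measure_hyp_vol: "uniform_hyp_measure hyp_vol"
proof
  show "emeasure hyp_vol (- hyp3) = 0"
    using AE_hyp_vol_hyp3 by (subst (asm) AE_iff_measurable[where N = "- hyp3"]) auto
qed (auto simp: emeasure_hyp_ball hyp_ball_vol_def)

lemma cnj_borel [measurable]: "cnj \<in> borel_measurable borel"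
  by (intro borel_measurable_continuous_onI continuous_intros)

lemma sl2_act_borel [measurable]: "sl2_act A \<in> borel_measurable borel"
  unfolding sl2_act_def Let_def by measurable

lemma (in uniform_hyp_measure) uniform_hyp_measure_distr_sl2_act:
  assumes A: "det A = 1"
  shows "uniform_hyp_measure (distr M borel (sl2_act A))"
proof
  have [measurable]: "sl2_act A \<in> M \<rightarrow>\<^sub>M borel" by measurable
  have "sl2_act A -` (- hyp3) \<subseteq> - hyp3"
    using sl2_act_mem_hyp3[OF A] by blast
  then show "emeasure (distr M borel (sl2_act A)) (- hyp3) = 0"
    using measurable_sets[OF sl2_act_borel, of "- hyp3" A] by (subst emeasure_distr) (auto intro!: null_subset)
  fix P and r :: real assume P: "P \<in> hyp3" and r: "r > 0"
  define Q where "Q = sl2_act (sl2_inv A) P"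
  have Q: "Q \<in> hyp3" "sl2_act A Q = P"
    using sl2_act_mem_hyp3[OF sl2_inv(3)[OF A] P] sl2_act_inv(1)[OF A P] by (simp_all add: Q_def)
  have "sl2_act A -` hyp_ball P r \<inter> hyp3 = hyp_ball Q r"
    using hdist_sl2_act[OF A Q(1)] Q(2) sl2_act_mem_hyp3[OF A] by (auto simp: hyp_ball_def)
  then have ball: "sl2_act A -` hyp_ball P r = hyp_ball Q r \<union> (sl2_act A -` hyp_ball P r - hyp3)"
    by blast
  have "sl2_act A -` hyp_ball P r \<in> sets borel"
    using measurable_sets[OF sl2_act_borel hyp_ball_borel, of A P r] by simp
  then have "sl2_act A -` hyp_ball P r - hyp3 \<in> null_sets M"
    by (auto intro!: null_setsI null_subset)
  then have "emeasure M (hyp_ball Q r \<union> (sl2_act A -` hyp_ball P r - hyp3)) = emeasure M (hyp_ball Q r)"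
    by (intro emeasure_Un_null_set) auto
  then show "emeasure (distr M borel (sl2_act A)) (hyp_ball P r) = hyp_ball_vol r"
    using ball_vol[OF Q(1) r] by (subst emeasure_distr) (auto simp flip: ball)
qed simp

theorem hyp_vol_invariant:
  assumes "det A = 1"
  shows "distr hyp_vol borel (sl2_act A) = hyp_vol"
  by (intro uniform_hyp_measure_unique uniform_hyp_measure_hyp_vol assms
      uniform_hyp_measure.uniform_hyp_measure_distr_sl2_act)

section \<open>Fundamental domains and unfolding\<close>

text \<open>A measurable total order on the half-space: a fundamental domain is formed by the least
  elements of the orbits.\<close>

definition orbit_key :: "complex \<times> real \<Rightarrow> real list" where
  "orbit_key P = [hdist (0, 1) P, Re (fst P), Im (fst P), snd P]"

lemma orbit_key_eq_iff [simp]: "orbit_key P = orbit_key Q \<longleftrightarrow> P = Q"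
proof
  assume "orbit_key P = orbit_key Q"
  then show "P = Q" by (simp add: orbit_key_def prod_eq_iff complex_eq_iff)
qed simp

lemma orbit_key_le_imp_hdist_le: "orbit_key P \<le> orbit_key Q \<Longrightarrow> hdist (0, 1) P \<le> hdist (0, 1) Q"
  by (auto simp: orbit_key_def)

context discrete_PSL2C
begin

lemma hyp_orbit_subset_hyp3: "P \<in> hyp3 \<Longrightarrow> hyp_orbit \<Gamma> P \<subseteq> hyp3"
  using lift_det sl2_act_mem_hyp3 unfolding hyp_orbit_def by blast

lemma self_mem_hyp_orbit: "P \<in> hyp_orbit \<Gamma> P"
  using lift_one unfolding hyp_orbit_def by (metis image_eqI sl2_act_one)

lemma hyp_orbit_sl2_act:
  assumes A: "A \<in> \<Union>\<Gamma>" and P: "P \<in> hyp3"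
  shows "hyp_orbit \<Gamma> (sl2_act A P) = hyp_orbit \<Gamma> P"
proof -
  have subset: "hyp_orbit \<Gamma> (sl2_act A P) \<subseteq> hyp_orbit \<Gamma> P" if "A \<in> \<Union>\<Gamma>" "P \<in> hyp3" for A P
    unfolding hyp_orbit_def[of \<Gamma> "sl2_act A P"]
  proof (rule image_subsetI)
    fix B assume B: "B \<in> \<Union>\<Gamma>"
    then have "sl2_act B (sl2_act A P) = sl2_act (B ** A) P"
      using that by (simp add: sl2_act_mult lift_det)
    then show "sl2_act B (sl2_act A P) \<in> hyp_orbit \<Gamma> P"
      using lift_mult[OF B that(1)] unfolding hyp_orbit_def by blast
  qed
  have "hyp_orbit \<Gamma> (sl2_act (sl2_inv A) (sl2_act A P)) \<subseteq> hyp_orbit \<Gamma> (sl2_act A P)"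
    using A P by (intro subset lift_inv sl2_act_mem_hyp3 lift_det)
  then show ?thesis
    using subset[OF A P] P by (simp add: sl2_act_inv(2)[OF lift_det[OF A]])
qed

lemma finite_orbit_near_base_point:
  assumes P: "P \<in> hyp3"
  shows "finite {Q \<in> hyp_orbit \<Gamma> P. hdist (0, 1) Q \<le> r}"
proof -
  have "P \<in> hyp_cball P 0" using P by (intro center_in_hyp_cball) simp_all
  then have "A \<in> \<Union>\<Gamma> \<Longrightarrow> hdist (0, 1) (sl2_act A P) \<le> r \<Longrightarrow>
      A \<in> {A \<in> \<Union>\<Gamma>. sl2_act A ` hyp_cball P 0 \<inter> hyp_cball (0, 1) r \<noteq> {}}" for A
    using sl2_act_mem_hyp3[OF lift_det P] by (auto simp: hyp_cball_def[of "(0, 1)"])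
  then have "{Q \<in> hyp_orbit \<Gamma> P. hdist (0, 1) Q \<le> r}
      \<subseteq> (\<lambda>A. sl2_act A P) ` {A \<in> \<Union>\<Gamma>. sl2_act A ` hyp_cball P 0 \<inter> hyp_cball (0, 1) r \<noteq> {}}"
    unfolding hyp_orbit_def by blast
  then show ?thesis
    using finite_lift_cball_meets_cball[OF P base_point_hyp3] by (meson finite_imageI finite_subset)
qed

lemma ex_least_orbit_point:
  assumes P: "P \<in> hyp3"
  shows "\<exists>Q\<in>hyp_orbit \<Gamma> P. \<forall>R\<in>hyp_orbit \<Gamma> P. orbit_key Q \<le> orbit_key R"
proof -
  define S where "S = {Q \<in> hyp_orbit \<Gamma> P. hdist (0, 1) Q \<le> hdist (0, 1) P}"
  have S: "finite (orbit_key ` S)" "P \<in> S"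
    using finite_orbit_near_base_point[OF P] self_mem_hyp_orbit by (auto simp: S_def)
  then obtain Q where Q: "Q \<in> S" "orbit_key Q = Min (orbit_key ` S)"
    using Min_in[of "orbit_key ` S"] by fastforce
  then have least: "orbit_key Q \<le> orbit_key R" if "R \<in> S" for R
    using S(1) that by simp
  have "orbit_key Q \<le> orbit_key R" if R: "R \<in> hyp_orbit \<Gamma> P" for R
  proof (cases "R \<in> S")
    case False
    then have "\<not> orbit_key R \<le> orbit_key P"
      using R orbit_key_le_imp_hdist_le[of R P] by (auto simp: S_def)
    then show ?thesis using least[OF S(2)] by order
  qed (rule least)
  then show ?thesis using Q(1) unfolding S_def by blast
qed

lemma ex_fundamental_domain: "\<exists>F. fundamental_domain \<Gamma> F"
proof -
  define F where "F = {P \<in> hyp3. \<forall>A\<in>\<Union>\<Gamma>. orbit_key P \<le> orbit_key (sl2_act A P)}"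
  have F_iff: "P \<in> F \<longleftrightarrow> P \<in> hyp3 \<and> (\<forall>Q\<in>hyp_orbit \<Gamma> P. orbit_key P \<le> orbit_key Q)" for P
    by (auto simp: F_def hyp_orbit_def)
  have "{P \<in> space borel. orbit_key P \<le> orbit_key (sl2_act A P)} \<in> sets borel" for A
    unfolding orbit_key_def Cons_le_Cons list.simps by measurable
  then have "(\<Inter>A\<in>\<Union>\<Gamma>. {P \<in> space borel. orbit_key P \<le> orbit_key (sl2_act A P)}) \<in> sets borel"
    using lift_one by (intro sets.countable_INT'[OF countable_lift]) blast+
  moreover have "F = hyp3 \<inter> (\<Inter>A\<in>\<Union>\<Gamma>. {P \<in> space borel. orbit_key P \<le> orbit_key (sl2_act A P)})"
    by (auto simp: F_def)
  ultimately have "F \<in> sets borel" by simp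
  moreover have "\<exists>!Q. Q \<in> F \<inter> hyp_orbit \<Gamma> P" if P: "P \<in> hyp3" for P
  proof -
    have orbit: "hyp_orbit \<Gamma> Q = hyp_orbit \<Gamma> P" if "Q \<in> hyp_orbit \<Gamma> P" for Q
      using that hyp_orbit_sl2_act[OF _ P] by (auto simp: hyp_orbit_def[of \<Gamma> P])
    obtain Q where Q: "Q \<in> hyp_orbit \<Gamma> P" "\<forall>R\<in>hyp_orbit \<Gamma> P. orbit_key Q \<le> orbit_key R"
      using ex_least_orbit_point[OF P] by blast
    then have "Q \<in> F" using orbit[OF Q(1)] hyp_orbit_subset_hyp3[OF P] by (auto simp: F_iff)
    moreover have "R = Q" if "R \<in> F \<inter> hyp_orbit \<Gamma> P" for R
    proof -
      have "orbit_key R \<le> orbit_key Q" using that Q(1) orbit[of R] by (auto simp: F_iff)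
      moreover have "orbit_key Q \<le> orbit_key R" using that Q(2) by blast
      ultimately show ?thesis by (metis antisym orbit_key_eq_iff)
    qed
    ultimately show ?thesis using Q(1) by blast
  qed
  ultimately show ?thesis
    unfolding fundamental_domain_def by (intro exI[of _ F]) (auto simp: F_iff)
qed

definition fund_dom :: "(complex \<times> real) set" where
  "fund_dom = (SOME F. fundamental_domain \<Gamma> F)"

lemma fundamental_domain_fund_dom: "fundamental_domain \<Gamma> fund_dom"
  unfolding fund_dom_def using ex_fundamental_domain by (rule someI_ex)

lemma fund_dom_borel [measurable]: "fund_dom \<in> sets borel"
  and fund_dom_subset_hyp3: "fund_dom \<subseteq> hyp3"
  using fundamental_domain_fund_dom by (auto simp: fundamental_domain_def)

lemma ex_lift_inv_mem_fund_dom: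
  assumes "P \<in> hyp3"
  shows "\<exists>A\<in>\<Union>\<Gamma>. sl2_act (sl2_inv A) P \<in> fund_dom"
proof -
  obtain A where "A \<in> \<Union>\<Gamma>" "sl2_act A P \<in> fund_dom"
    using fundamental_domain_fund_dom assms unfolding fundamental_domain_def hyp_orbit_def by blast
  then show ?thesis by (intro bexI[of _ "sl2_inv A"] lift_inv) auto
qed

lemma hyp_orbit_measurable:
  "hyp_orbit \<Gamma> \<in> restrict_space borel hyp3 \<rightarrow>\<^sub>M borel_of_topology (orbit_topology \<Gamma>)"
  unfolding borel_of_topology_def
proof (rule measurable_measure_of)
  show "{U. openin (orbit_topology \<Gamma>) U} \<subseteq> Pow (topspace (orbit_topology \<Gamma>))"
    using openin_subset by blast
  show "hyp_orbit \<Gamma> \<in> space (restrict_space borel hyp3) \<rightarrow> topspace (orbit_topology \<Gamma>)"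
    by (auto simp: space_restrict_space orbit_topology_def)
  fix U assume "U \<in> {U. openin (orbit_topology \<Gamma>) U}"
  then have "openin (top_of_set hyp3) {P \<in> hyp3. hyp_orbit \<Gamma> P \<in> U}"
    by (simp add: orbit_topology_def openin_quot_topology)
  then have "open {P \<in> hyp3. hyp_orbit \<Gamma> P \<in> U}"
    using open_hyp3 openin_open_trans by blast
  moreover have "hyp_orbit \<Gamma> -` U \<inter> space (restrict_space borel hyp3) = hyp3 \<inter> {P \<in> hyp3. hyp_orbit \<Gamma> P \<in> U}"
    by (auto simp: space_restrict_space)
  ultimately show "hyp_orbit \<Gamma> -` U \<inter> space (restrict_space borel hyp3) \<in> sets (restrict_space borel hyp3)"
    unfolding sets_restrict_space by auto
qed

lemma orbit_vol_eq:
  "orbit_vol \<Gamma> = distr (restrict_space hyp_vol fund_dom) (borel_of_topology (orbit_topology \<Gamma>)) (hyp_orbit \<Gamma>)"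
  by (simp add: orbit_vol_def fund_dom_def)

lemma borel_measurable_lift:
  fixes g :: "(complex \<times> real) set \<Rightarrow> 'b::{real_normed_vector, second_countable_topology}"
  assumes "g \<in> borel_measurable (orbit_vol \<Gamma>)"
  shows "(\<lambda>Q. indicator hyp3 Q *\<^sub>R g (hyp_orbit \<Gamma> Q)) \<in> borel_measurable borel"
proof -
  have "g \<in> borel_measurable (borel_of_topology (orbit_topology \<Gamma>))"
    using assms by (simp add: orbit_vol_eq)
  from measurable_compose[OF hyp_orbit_measurable this] show ?thesis
    by (simp add: borel_measurable_restrict_space_iff)
qed

lemma nn_integral_orbit_vol:
  fixes g :: "(complex \<times> real) set \<Rightarrow> ennreal"
  assumes "g \<in> borel_measurable (orbit_vol \<Gamma>)"
  shows "(\<integral>\<^sup>+x. g x \<partial>orbit_vol \<Gamma>) = (\<integral>\<^sup>+Q. g (hyp_orbit \<Gamma> Q) * indicator fund_dom Q \<partial>hyp_vol)"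
proof -
  have "g \<in> borel_measurable (borel_of_topology (orbit_topology \<Gamma>))"
    using assms by (simp add: orbit_vol_eq)
  moreover have "hyp_orbit \<Gamma> \<in> restrict_space hyp_vol fund_dom \<rightarrow>\<^sub>M borel_of_topology (orbit_topology \<Gamma>)"
    using measurable_restrict_mono[OF hyp_orbit_measurable fund_dom_subset_hyp3] by simp
  ultimately have "(\<integral>\<^sup>+x. g x \<partial>orbit_vol \<Gamma>) = (\<integral>\<^sup>+Q. g (hyp_orbit \<Gamma> Q) \<partial>restrict_space hyp_vol fund_dom)"
    unfolding orbit_vol_eq by (intro nn_integral_distr) simp_all
  also have "\<dots> = (\<integral>\<^sup>+Q. g (hyp_orbit \<Gamma> Q) * indicator fund_dom Q \<partial>hyp_vol)"
    by (rule nn_integral_restrict_space) simp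
  finally show ?thesis .
qed

definition cball_multiplicity :: "complex \<times> real \<Rightarrow> real \<Rightarrow> nat" where
  "cball_multiplicity P r = card {A \<in> \<Union>\<Gamma>. sl2_act A ` hyp_cball P r \<inter> hyp_cball P r \<noteq> {}}"

lemma card_lift_into_cball_le:
  fixes r :: real
  assumes P: "P \<in> hyp3" and Q: "Q \<in> hyp3"
  defines "T \<equiv> {A \<in> \<Union>\<Gamma>. sl2_act A Q \<in> hyp_cball P r}"
  shows "finite T" and "card T \<le> cball_multiplicity P r"
proof -
  let ?K = "{A \<in> \<Union>\<Gamma>. sl2_act A ` hyp_cball P r \<inter> hyp_cball P r \<noteq> {}}"
  have K: "finite ?K" by (intro finite_lift_cball_meets_cball P)
  have "finite T \<and> card T \<le> card ?K"
  proof (cases "T = {}")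
    case False
    then obtain A0 where A0: "A0 \<in> \<Union>\<Gamma>" "sl2_act A0 Q \<in> hyp_cball P r" by (auto simp: T_def)
    note inv = sl2_inv[OF lift_det[OF A0(1)]]
    have inj: "inj_on (\<lambda>A. A ** sl2_inv A0) T"
    proof (rule inj_onI)
      fix A A' assume "A ** sl2_inv A0 = A' ** sl2_inv A0"
      then have "A ** (sl2_inv A0 ** A0) = A' ** (sl2_inv A0 ** A0)" by (simp add: matrix_mul_assoc)
      then show "A = A'" by (simp add: inv)
    qed
    have image: "(\<lambda>A. A ** sl2_inv A0) ` T \<subseteq> ?K"
    proof (rule image_subsetI)
      fix A assume A: "A \<in> T"
      have "sl2_act (A ** sl2_inv A0) (sl2_act A0 Q) = sl2_act A (sl2_act (sl2_inv A0) (sl2_act A0 Q))"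
        using A A0 Q lift_det inv by (intro sl2_act_mult sl2_act_mem_hyp3) (auto simp: T_def)
      also have "\<dots> = sl2_act A Q" using sl2_act_inv(2)[OF lift_det[OF A0(1)] Q] by simp
      finally have "sl2_act A Q \<in> sl2_act (A ** sl2_inv A0) ` hyp_cball P r \<inter> hyp_cball P r"
        using A A0(2) by (auto simp: T_def intro!: image_eqI[where x = "sl2_act A0 Q"])
      moreover have "A ** sl2_inv A0 \<in> \<Union>\<Gamma>"
        using A A0(1) by (intro lift_mult lift_inv) (auto simp: T_def)
      ultimately show "A ** sl2_inv A0 \<in> ?K" by blast
    qed
    have "finite T" using finite_subset[OF image K] inj by (rule finite_imageD)
    then show ?thesis using card_inj_on_le[OF inj image K] by blast
  qed simp
  then show "finite T" "card T \<le> cball_multiplicity P r" by (simp_all add: cball_multiplicity_def)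
qed

lemma cball_multiplicity_pos:
  assumes P: "P \<in> hyp3" and r: "r \<ge> 0"
  shows "cball_multiplicity P r > 0"
proof -
  have "mat 1 \<in> {A \<in> \<Union>\<Gamma>. sl2_act A P \<in> hyp_cball P r}"
    using lift_one center_in_hyp_cball[OF P r] by (simp add: sl2_act_one)
  then have "card {A \<in> \<Union>\<Gamma>. sl2_act A P \<in> hyp_cball P r} > 0"
    using card_lift_into_cball_le(1)[OF P P] by (auto simp: card_gt_0_iff)
  then show ?thesis using card_lift_into_cball_le(2)[OF P P] by (rule less_le_trans)
qed

lemma nn_integral_sl2_act:
  assumes A: "det A = 1" and g: "g \<in> borel_measurable borel"
  shows "(\<integral>\<^sup>+Q. g Q \<partial>hyp_vol) = (\<integral>\<^sup>+Q. g (sl2_act A Q) \<partial>hyp_vol)"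
proof -
  have "(\<integral>\<^sup>+Q. g Q \<partial>hyp_vol) = (\<integral>\<^sup>+Q. g Q \<partial>distr hyp_vol borel (sl2_act A))"
    by (simp only: hyp_vol_invariant[OF A])
  then show ?thesis using g by (simp add: nn_integral_distr)
qed

lemma indicator_le_nn_integral_fund_dom:
  "indicator hyp3 Q \<le> (\<integral>\<^sup>+A. indicator fund_dom (sl2_act (sl2_inv A) Q) \<partial>count_space (\<Union>\<Gamma>))"
proof (cases "Q \<in> hyp3")
  case True
  then obtain A where A: "A \<in> \<Union>\<Gamma>" "sl2_act (sl2_inv A) Q \<in> fund_dom"
    using ex_lift_inv_mem_fund_dom by blast
  then show ?thesis
    using nn_integral_ge_point[OF A(1), of "\<lambda>A. indicator fund_dom (sl2_act (sl2_inv A) Q)"] True by simp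
qed simp

lemma nn_integral_count_space_lift_le:
  assumes P: "P \<in> hyp3" and Q: "Q \<in> hyp3"
  shows "(\<integral>\<^sup>+A. indicator (hyp_cball P r) (sl2_act A Q) \<partial>count_space (\<Union>\<Gamma>)) \<le> of_nat (cball_multiplicity P r)"
proof -
  define T where "T = {A \<in> \<Union>\<Gamma>. sl2_act A Q \<in> hyp_cball P r}"
  have T: "finite T" "card T \<le> cball_multiplicity P r" "T \<subseteq> \<Union>\<Gamma>"
    using card_lift_into_cball_le[OF P Q] by (auto simp: T_def)
  have "(\<integral>\<^sup>+A. indicator (hyp_cball P r) (sl2_act A Q) \<partial>count_space (\<Union>\<Gamma>))
      = (\<integral>\<^sup>+A. indicator T A \<partial>count_space (\<Union>\<Gamma>))"
    by (intro nn_integral_cong) (auto simp: T_def indicator_def)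
  also have "\<dots> = of_nat (card T)" using T by simp
  finally show ?thesis using T(2) by simp
qed

lemma nn_integral_fund_dom_translate:
  fixes f :: "complex \<times> real \<Rightarrow> ennreal"
  assumes [measurable]: "f \<in> borel_measurable borel" "B \<in> sets borel" and A: "A \<in> \<Union>\<Gamma>"
    and inv: "\<And>Q. Q \<in> hyp3 \<Longrightarrow> f (sl2_act A Q) = f Q"
  shows "(\<integral>\<^sup>+Q. f Q * indicator B Q * indicator fund_dom (sl2_act (sl2_inv A) Q) \<partial>hyp_vol)
    = (\<integral>\<^sup>+Q. f Q * indicator fund_dom Q * indicator B (sl2_act A Q) \<partial>hyp_vol)"
proof -
  let ?g = "\<lambda>Q. f Q * indicator B Q * indicator fund_dom (sl2_act (sl2_inv A) Q)"
  have "(\<integral>\<^sup>+Q. ?g Q \<partial>hyp_vol) = (\<integral>\<^sup>+Q. ?g (sl2_act A Q) \<partial>hyp_vol)"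
    by (rule nn_integral_sl2_act[OF lift_det[OF A]]) measurable
  also have "\<dots> = (\<integral>\<^sup>+Q. f Q * indicator fund_dom Q * indicator B (sl2_act A Q) \<partial>hyp_vol)"
  proof (rule nn_integral_cong_AE)
    show "AE Q in hyp_vol. ?g (sl2_act A Q) = f Q * indicator fund_dom Q * indicator B (sl2_act A Q)"
      using AE_hyp_vol_hyp3
      by eventually_elim (simp add: inv sl2_act_inv[OF lift_det[OF A]] mult_ac)
  qed
  finally show ?thesis .
qed

text \<open>Unfolding: the ball is covered by the translates of the fundamental domain, and each point of the
  fundamental domain has at most \<open>cball_multiplicity P r\<close> translates in the ball.\<close>

lemma nn_integral_hyp_cball_le_fund_dom:
  fixes f :: "complex \<times> real \<Rightarrow> ennreal"
  assumes P: "P \<in> hyp3" and f [measurable]: "f \<in> borel_measurable borel"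
    and inv: "\<And>A Q. A \<in> \<Union>\<Gamma> \<Longrightarrow> Q \<in> hyp3 \<Longrightarrow> f (sl2_act A Q) = f Q"
  shows "(\<integral>\<^sup>+Q. f Q * indicator (hyp_cball P r) Q \<partial>hyp_vol)
    \<le> of_nat (cball_multiplicity P r) * (\<integral>\<^sup>+Q. f Q * indicator fund_dom Q \<partial>hyp_vol)"
proof -
  let ?B = "hyp_cball P r" and ?L = "\<Union>\<Gamma>"
  let ?g = "\<lambda>A Q. f Q * indicator ?B Q * indicator fund_dom (sl2_act (sl2_inv A) Q)"
  have "(\<integral>\<^sup>+Q. f Q * indicator ?B Q \<partial>hyp_vol) \<le> (\<integral>\<^sup>+Q. \<integral>\<^sup>+A. ?g A Q \<partial>count_space ?L \<partial>hyp_vol)"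
  proof (rule nn_integral_mono)
    fix Q
    have "f Q * indicator ?B Q = f Q * indicator ?B Q * indicator hyp3 Q"
      using hyp_cball_subset_hyp3[of P r] by (auto simp: indicator_def)
    also have "\<dots> \<le> f Q * indicator ?B Q * (\<integral>\<^sup>+A. indicator fund_dom (sl2_act (sl2_inv A) Q) \<partial>count_space ?L)"
      by (intro mult_left_mono indicator_le_nn_integral_fund_dom) simp
    finally show "f Q * indicator ?B Q \<le> (\<integral>\<^sup>+A. ?g A Q \<partial>count_space ?L)"
      by (simp add: nn_integral_cmult)
  qed
  also have "\<dots> = (\<integral>\<^sup>+A. \<integral>\<^sup>+Q. ?g A Q \<partial>hyp_vol \<partial>count_space ?L)"
    by (rule nn_integral_count_space_nn_integral[OF countable_lift]) measurable
  also have "\<dots> = (\<integral>\<^sup>+A. \<integral>\<^sup>+Q. f Q * indicator fund_dom Q * indicator ?B (sl2_act A Q) \<partial>hyp_vol \<partial>count_space ?L)"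
    using inv by (intro nn_integral_cong nn_integral_fund_dom_translate) auto
  also have "\<dots> = (\<integral>\<^sup>+Q. \<integral>\<^sup>+A. f Q * indicator fund_dom Q * indicator ?B (sl2_act A Q) \<partial>count_space ?L \<partial>hyp_vol)"
    by (rule nn_integral_count_space_nn_integral[OF countable_lift, symmetric]) measurable
  also have "\<dots> \<le> (\<integral>\<^sup>+Q. f Q * indicator fund_dom Q * of_nat (cball_multiplicity P r) \<partial>hyp_vol)"
  proof (rule nn_integral_mono)
    fix Q
    show "(\<integral>\<^sup>+A. f Q * indicator fund_dom Q * indicator ?B (sl2_act A Q) \<partial>count_space ?L)
        \<le> f Q * indicator fund_dom Q * of_nat (cball_multiplicity P r)"
    proof (cases "Q \<in> fund_dom")
      case True
      then have "Q \<in> hyp3" using fund_dom_subset_hyp3 by blast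
      then show ?thesis
        by (subst nn_integral_cmult) (auto intro: mult_left_mono nn_integral_count_space_lift_le[OF P])
    qed simp
  qed
  also have "\<dots> = of_nat (cball_multiplicity P r) * (\<integral>\<^sup>+Q. f Q * indicator fund_dom Q \<partial>hyp_vol)"
    by (subst nn_integral_multc) (measurable, rule mult.commute)
  finally show ?thesis .
qed

lemma nn_integral_hyp_cball_le_orbit_vol:
  fixes w :: "(complex \<times> real) set \<Rightarrow> complex"
  assumes P: "P \<in> hyp3" and w: "w \<in> borel_measurable (orbit_vol \<Gamma>)"
  shows "(\<integral>\<^sup>+Q. ennreal ((cmod (w (hyp_orbit \<Gamma> Q)))\<^sup>2) * indicator (hyp_cball P r) Q \<partial>hyp_vol)
    \<le> of_nat (cball_multiplicity P r) * (\<integral>\<^sup>+x. ennreal ((cmod (w x))\<^sup>2) \<partial>orbit_vol \<Gamma>)"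
proof -
  define f where "f Q = ennreal ((cmod (indicator hyp3 Q *\<^sub>R w (hyp_orbit \<Gamma> Q)))\<^sup>2)" for Q
  have [measurable]: "f \<in> borel_measurable borel"
    using borel_measurable_lift[OF w] unfolding f_def by measurable
  have f: "f Q * indicator S Q = ennreal ((cmod (w (hyp_orbit \<Gamma> Q)))\<^sup>2) * indicator S Q" if "S \<subseteq> hyp3" for Q S
    using that by (auto simp: f_def indicator_def)
  have "(\<integral>\<^sup>+Q. f Q * indicator (hyp_cball P r) Q \<partial>hyp_vol)
      \<le> of_nat (cball_multiplicity P r) * (\<integral>\<^sup>+Q. f Q * indicator fund_dom Q \<partial>hyp_vol)"
  proof (rule nn_integral_hyp_cball_le_fund_dom[OF P])
    fix A Q assume A: "A \<in> \<Union>\<Gamma>" and Q: "Q \<in> hyp3"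
    then show "f (sl2_act A Q) = f Q"
      using sl2_act_mem_hyp3[OF lift_det[OF A] Q] by (simp add: f_def hyp_orbit_sl2_act)
  qed measurable
  moreover have "(\<lambda>x. ennreal ((cmod (w x))\<^sup>2)) \<in> borel_measurable (orbit_vol \<Gamma>)"
    using w by measurable
  ultimately show ?thesis
    by (simp add: f fund_dom_subset_hyp3 hyp_cball_subset_hyp3 nn_integral_orbit_vol)
qed

end

section \<open>The local Weyl bound\<close>

lemma square_integrable_mult_cnj:
  assumes f: "square_integrable M f" and g: "square_integrable M g"
  shows "integrable M (\<lambda>x. f x * cnj (g x))"
proof (rule Bochner_Integration.integrable_bound)
  show "integrable M (\<lambda>x. (cmod (f x))\<^sup>2 + (cmod (g x))\<^sup>2)"
    using f g by (auto simp: square_integrable_def)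
  have [measurable]: "f \<in> borel_measurable M" "g \<in> borel_measurable M"
    using f g by (auto simp: square_integrable_def)
  show "(\<lambda>x. f x * cnj (g x)) \<in> borel_measurable M" by measurable
  have "cmod (f x * cnj (g x)) \<le> (cmod (f x))\<^sup>2 + (cmod (g x))\<^sup>2" for x
  proof -
    have "2 * (cmod (f x) * cmod (g x)) \<le> (cmod (f x))\<^sup>2 + (cmod (g x))\<^sup>2"
      using zero_le_power2[of "cmod (f x) - cmod (g x)"] unfolding power2_diff by simp
    moreover have "0 \<le> cmod (f x) * cmod (g x)" by simp
    ultimately show ?thesis unfolding norm_mult complex_mod_cnj by linarith
  qed
  then show "AE x in M. cmod (f x * cnj (g x)) \<le> norm ((cmod (f x))\<^sup>2 + (cmod (g x))\<^sup>2)"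
    by simp
qed

lemma
  assumes sq: "\<And>j. square_integrable M (u j)"
    and on: "\<And>i j. (\<integral>x. u i x * cnj (u j x) \<partial>M) = (if i = j then 1 else 0)"
    and J: "finite J"
  shows integrable_orthonormal_sum: "integrable M (\<lambda>x. (cmod (\<Sum>j\<in>J. c j * u j x))\<^sup>2)"
    and integral_orthonormal_sum: "(\<integral>x. (cmod (\<Sum>j\<in>J. c j * u j x))\<^sup>2 \<partial>M) = (\<Sum>j\<in>J. (cmod (c j))\<^sup>2)"
proof -
  have eq: "complex_of_real ((cmod (\<Sum>j\<in>J. c j * u j x))\<^sup>2)
      = (\<Sum>i\<in>J. \<Sum>j\<in>J. (c i * cnj (c j)) * (u i x * cnj (u j x)))" for x
    unfolding complex_norm_square cnj_sum sum_product by (intro sum.cong refl) (simp add: mult_ac)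
  have int: "integrable M (\<lambda>x. (c i * cnj (c j)) * (u i x * cnj (u j x)))" for i j
    by (intro integrable_mult_right square_integrable_mult_cnj sq)
  have "integrable M (\<lambda>x. complex_of_real ((cmod (\<Sum>j\<in>J. c j * u j x))\<^sup>2))"
    unfolding eq by (intro Bochner_Integration.integrable_sum int)
  from integrable_Re[OF this] show "integrable M (\<lambda>x. (cmod (\<Sum>j\<in>J. c j * u j x))\<^sup>2)" by simp
  have "complex_of_real (\<integral>x. (cmod (\<Sum>j\<in>J. c j * u j x))\<^sup>2 \<partial>M)
      = (\<integral>x. (\<Sum>i\<in>J. \<Sum>j\<in>J. (c i * cnj (c j)) * (u i x * cnj (u j x))) \<partial>M)"
    unfolding eq[symmetric] by (rule integral_complex_of_real[symmetric])
  also have "\<dots> = (\<Sum>i\<in>J. \<Sum>j\<in>J. (c i * cnj (c j)) * (if i = j then 1 else 0))"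
    by (simp only: Bochner_Integration.integral_sum Bochner_Integration.integrable_sum int
        integral_mult_right_zero on)
  also have "\<dots> = (\<Sum>i\<in>J. c i * cnj (c i))"
    using J by (intro sum.cong refl) (simp add: if_distrib sum.delta' cong: if_cong)
  also have "\<dots> = complex_of_real (\<Sum>j\<in>J. (cmod (c j))\<^sup>2)"
    by (simp add: complex_norm_square del: of_real_power)
  finally show "(\<integral>x. (cmod (\<Sum>j\<in>J. c j * u j x))\<^sup>2 \<partial>M) = (\<Sum>j\<in>J. (cmod (c j))\<^sup>2)"
    unfolding of_real_eq_iff .
qed

lemma radial_integral_sum:
  assumes "\<And>j. j \<in> J \<Longrightarrow> continuous_on hyp3 (v j)" "P \<in> hyp3" "continuous_on UNIV f" "b \<ge> 0"
    "\<And>r. r > b \<Longrightarrow> f r = 0"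
  shows "radial_integral P (\<lambda>Q. \<Sum>j\<in>J. c j * v j Q) f = (\<Sum>j\<in>J. c j * radial_integral P (v j) f)"
proof -
  have "radial_integral P (\<lambda>Q. \<Sum>j\<in>J. c j * v j Q) f
      = (\<integral>Q. (\<Sum>j\<in>J. c j * (v j Q * (f (hdist P Q) /\<^sub>R sinh (hdist P Q)))) \<partial>hyp_vol)"
    by (simp add: radial_integral_def sum_distrib_right mult.assoc scaleR_sum_right)
  also have "\<dots> = (\<Sum>j\<in>J. c j * radial_integral P (v j) f)"
    unfolding radial_integral_def integral_mult_right_zero[symmetric]
    using assms by (intro Bochner_Integration.integral_sum integrable_mult_right integrable_radial_kernel)
  finally show ?thesis .
qed

lemma nn_integral_radial_kernel_square_le:
  fixes \<kappa> :: "real \<Rightarrow> complex"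
  assumes P: "P \<in> hyp3" and \<kappa>: "continuous_on UNIV \<kappa>" and zero: "\<And>r. r \<ge> 1 \<Longrightarrow> \<kappa> r = 0"
    and b: "\<And>r. r \<ge> 0 \<Longrightarrow> cmod (\<kappa> r) \<le> b"
  shows "(\<integral>\<^sup>+Q. ennreal ((cmod (\<kappa> (hdist P Q) /\<^sub>R sinh (hdist P Q)))\<^sup>2) \<partial>hyp_vol) \<le> ennreal (4 * pi * b\<^sup>2)"
proof -
  have [measurable]: "\<kappa> \<in> borel_measurable borel" by (rule borel_measurable_continuous_onI[OF \<kappa>])
  have "(\<integral>\<^sup>+Q. ennreal ((cmod (\<kappa> (hdist P Q) /\<^sub>R sinh (hdist P Q)))\<^sup>2) \<partial>hyp_vol)
      = (\<integral>\<^sup>+r. ennreal (indicator {0..} r * (4 * pi * (sinh r)\<^sup>2)) * ennreal ((cmod (\<kappa> r /\<^sub>R sinh r))\<^sup>2) \<partial>lborel)"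
    by (rule nn_integral_radial[OF P]) measurable
  also have "\<dots> \<le> (\<integral>\<^sup>+r. ennreal (4 * pi * b\<^sup>2) * indicator {0..1::real} r \<partial>lborel)"
  proof (rule nn_integral_mono)
    fix r :: real
    have "(cmod (\<kappa> r))\<^sup>2 \<le> b\<^sup>2" if "r \<ge> 0" using b[OF that] by (intro power_mono) auto
    then have "indicator {0..} r * (4 * pi * (sinh r)\<^sup>2) * (cmod (\<kappa> r /\<^sub>R sinh r))\<^sup>2 \<le> 4 * pi * b\<^sup>2 * indicator {0..1} r"
      using zero[of r] by (cases "r = 0") (auto simp: indicator_def power_mult_distrib power_inverse mult.assoc[symmetric])
    then show "ennreal (indicator {0..} r * (4 * pi * (sinh r)\<^sup>2)) * ennreal ((cmod (\<kappa> r /\<^sub>R sinh r))\<^sup>2)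
        \<le> ennreal (4 * pi * b\<^sup>2) * indicator {0..1} r"
      by (simp add: ennreal_mult'[symmetric] ennreal_leI flip: ennreal_indicator)
  qed
  also have "\<dots> = ennreal (4 * pi * b\<^sup>2)" by (subst nn_integral_cmult_indicator) auto
  finally show ?thesis .
qed

context discrete_PSL2C
begin

lemma radial_integral_power2_le:
  assumes P: "P \<in> hyp3" and w: "w \<in> borel_measurable (orbit_vol \<Gamma>)"
    and \<kappa>: "continuous_on UNIV \<kappa>" "\<And>r. r \<ge> 1 \<Longrightarrow> \<kappa> r = 0" "\<And>r. r \<ge> 0 \<Longrightarrow> cmod (\<kappa> r) \<le> b"
  shows "ennreal ((cmod (radial_integral P (\<lambda>Q. w (hyp_orbit \<Gamma> Q)) \<kappa>))\<^sup>2)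
    \<le> of_nat (cball_multiplicity P 1) * (\<integral>\<^sup>+x. ennreal ((cmod (w x))\<^sup>2) \<partial>orbit_vol \<Gamma>) * ennreal (4 * pi * b\<^sup>2)"
proof -
  define W where "W Q = indicator (hyp_cball P 1) Q *\<^sub>R w (hyp_orbit \<Gamma> Q)" for Q
  define k where "k Q = \<kappa> (hdist P Q) /\<^sub>R sinh (hdist P Q)" for Q
  have [measurable]: "(\<lambda>Q. indicator hyp3 Q *\<^sub>R w (hyp_orbit \<Gamma> Q)) \<in> borel_measurable borel"
    using w by (rule borel_measurable_lift)
  have W: "W = (\<lambda>Q. indicator (hyp_cball P 1) Q *\<^sub>R (indicator hyp3 Q *\<^sub>R w (hyp_orbit \<Gamma> Q)))"
    using hyp_cball_subset_hyp3[of P 1] by (auto simp: W_def indicator_def fun_eq_iff)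
  have [measurable]: "W \<in> borel_measurable borel" unfolding W by measurable
  have [measurable]: "\<kappa> \<in> borel_measurable borel" by (rule borel_measurable_continuous_onI[OF \<kappa>(1)])
  have [measurable]: "k \<in> borel_measurable borel" unfolding k_def by measurable
  have local: "w (hyp_orbit \<Gamma> Q) * k Q = W Q * k Q" for Q
    using \<kappa>(2)[of "hdist P Q"] hdist_outside[OF P, of Q]
    by (cases "hdist P Q \<ge> 1") (auto simp: W_def k_def hyp_cball_def indicator_def)
  have "ennreal (cmod (radial_integral P (\<lambda>Q. w (hyp_orbit \<Gamma> Q)) \<kappa>)) = ennreal (cmod (\<integral>Q. W Q * k Q \<partial>hyp_vol))"
    by (simp only: radial_integral_def k_def[symmetric] local)
  also have "\<dots> \<le> (\<integral>\<^sup>+Q. ennreal (cmod (W Q * k Q)) \<partial>hyp_vol)"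
    by (cases "integrable hyp_vol (\<lambda>Q. W Q * k Q)")
       (simp_all add: integral_norm_bound_ennreal not_integrable_integral_eq)
  finally have "ennreal (cmod (radial_integral P (\<lambda>Q. w (hyp_orbit \<Gamma> Q)) \<kappa>))
      \<le> (\<integral>\<^sup>+Q. ennreal (cmod (W Q)) * ennreal (cmod (k Q)) \<partial>hyp_vol)"
    by (simp add: norm_mult ennreal_mult)
  from power_mono[OF this, of 2]
  have "ennreal ((cmod (radial_integral P (\<lambda>Q. w (hyp_orbit \<Gamma> Q)) \<kappa>))\<^sup>2)
      \<le> (\<integral>\<^sup>+Q. ennreal (cmod (W Q)) * ennreal (cmod (k Q)) \<partial>hyp_vol)\<^sup>2"
    by (simp add: ennreal_power)
  also have "\<dots> \<le> (\<integral>\<^sup>+Q. (ennreal (cmod (W Q)))\<^sup>2 \<partial>hyp_vol) * (\<integral>\<^sup>+Q. (ennreal (cmod (k Q)))\<^sup>2 \<partial>hyp_vol)"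
    by (rule Cauchy_Schwarz_nn_integral) measurable
  also have "(\<integral>\<^sup>+Q. (ennreal (cmod (W Q)))\<^sup>2 \<partial>hyp_vol)
      = (\<integral>\<^sup>+Q. ennreal ((cmod (w (hyp_orbit \<Gamma> Q)))\<^sup>2) * indicator (hyp_cball P 1) Q \<partial>hyp_vol)"
    by (intro nn_integral_cong) (simp add: W_def ennreal_power indicator_def)
  also have "\<dots> * (\<integral>\<^sup>+Q. (ennreal (cmod (k Q)))\<^sup>2 \<partial>hyp_vol)
      \<le> of_nat (cball_multiplicity P 1) * (\<integral>\<^sup>+x. ennreal ((cmod (w x))\<^sup>2) \<partial>orbit_vol \<Gamma>) * ennreal (4 * pi * b\<^sup>2)"
    using nn_integral_radial_kernel_square_le[OF P \<kappa>] nn_integral_hyp_cball_le_orbit_vol[OF P w]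
    by (intro mult_mono) (simp_all add: k_def ennreal_power)
  finally show ?thesis .
qed

text \<open>Bessel's inequality for the automorphic kernel \<open>\<Sum>\<^sub>\<gamma> \<kappa>(d(P, \<gamma> Q)) / sinh d(P, \<gamma> Q)\<close>, in dual form:
  the kernel is tested against \<open>\<Sum>\<^sub>j cnj (h\<^sub>j u\<^sub>j(P)) u\<^sub>j\<close>, where \<open>h\<^sub>j\<close> is its eigenvalue.\<close>

lemma bessel_automorphic_kernel:
  assumes P: "P \<in> hyp3" and sp: "spectral_system \<Gamma> u t" and J: "finite J"
    and \<kappa>: "continuous_on UNIV \<kappa>" "\<And>r. r \<ge> 1 \<Longrightarrow> \<kappa> r = 0" "\<And>r. r \<ge> 0 \<Longrightarrow> cmod (\<kappa> r) \<le> b"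
  defines "h j \<equiv> 4 * pi * integral {0..1} (\<lambda>s. \<kappa> s * spherical_sin (t j) s)"
  shows "(\<Sum>j\<in>J. (cmod (h j * u j (hyp_orbit \<Gamma> P)))\<^sup>2) \<le> real (cball_multiplicity P 1) * (4 * pi * b\<^sup>2)"
proof -
  let ?K = "real (cball_multiplicity P 1)"
  have sq: "\<And>j. square_integrable (orbit_vol \<Gamma>) (u j)"
    and on: "\<And>i j. (\<integral>x. u i x * cnj (u j x) \<partial>orbit_vol \<Gamma>) = (if i = j then 1 else 0)"
    and ev: "\<And>j. laplace_eigenfunction \<Gamma> (1 + (t j)\<^sup>2) (u j)"
    using sp by (simp_all add: spectral_system_def complete_orthonormal_def)
  have C2: "C2_on hyp3 (\<lambda>Q. u j (hyp_orbit \<Gamma> Q))"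
    and eigen: "\<And>Q. Q \<in> hyp3 \<Longrightarrow> - hyp_laplacian (\<lambda>Q. u j (hyp_orbit \<Gamma> Q)) Q = (1 + (t j)\<^sup>2) * u j (hyp_orbit \<Gamma> Q)" for j
    using ev[of j] by (simp_all add: laplace_eigenfunction_def o_def)
  define c where "c j = cnj (h j * u j (hyp_orbit \<Gamma> P))" for j
  define w where "w x = (\<Sum>j\<in>J. c j * u j x)" for x
  define X where "X = (\<Sum>j\<in>J. (cmod (c j))\<^sup>2)"
  have X: "X \<ge> 0" by (simp add: X_def sum_nonneg)
  have [measurable]: "u j \<in> borel_measurable (orbit_vol \<Gamma>)" for j
    using sq by (simp add: square_integrable_def)
  have w: "w \<in> borel_measurable (orbit_vol \<Gamma>)" unfolding w_def by measurable
  have "radial_integral P (\<lambda>Q. w (hyp_orbit \<Gamma> Q)) \<kappa>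
      = (\<Sum>j\<in>J. c j * radial_integral P (\<lambda>Q. u j (hyp_orbit \<Gamma> Q)) \<kappa>)"
    unfolding w_def using \<kappa> C2_on_continuous(1)[OF C2] by (intro radial_integral_sum[of _ _ _ _ 1] P) auto
  also have "\<dots> = (\<Sum>j\<in>J. c j * (h j * u j (hyp_orbit \<Gamma> P)))"
    unfolding h_def by (intro sum.cong refl arg_cong2[where f = "(*)"] eigenfunction_mean_value C2 P eigen \<kappa>(1,2))
  also have "\<dots> = complex_of_real X"
    by (simp add: X_def c_def complex_norm_square mult.commute del: of_real_power complex_cnj_mult)
  finally have "ennreal (X\<^sup>2) \<le> of_nat (cball_multiplicity P 1)
      * (\<integral>\<^sup>+x. ennreal ((cmod (w x))\<^sup>2) \<partial>orbit_vol \<Gamma>) * ennreal (4 * pi * b\<^sup>2)"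
    using radial_integral_power2_le[OF P w \<kappa>] by simp
  also have "(\<integral>\<^sup>+x. ennreal ((cmod (w x))\<^sup>2) \<partial>orbit_vol \<Gamma>) = ennreal X"
    unfolding w_def X_def using integrable_orthonormal_sum[OF sq on J] integral_orthonormal_sum[OF sq on J]
    by (subst nn_integral_eq_integral) auto
  also have "of_nat (cball_multiplicity P 1) * ennreal X * ennreal (4 * pi * b\<^sup>2) = ennreal (?K * X * (4 * pi * b\<^sup>2))"
    using X by (simp add: ennreal_mult ennreal_of_nat_eq_real_of_nat)
  finally have "X\<^sup>2 \<le> ?K * X * (4 * pi * b\<^sup>2)"
    using X by (subst (asm) ennreal_le_iff) auto
  then have "X * X \<le> (?K * (4 * pi * b\<^sup>2)) * X"
    by (simp only: power2_eq_square mult_ac)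
  then have "X \<le> ?K * (4 * pi * b\<^sup>2)"
    using X by (cases "X = 0") auto
  then show ?thesis by (simp add: X_def c_def del: complex_cnj_mult)
qed

lemma sum_eigenfunctions_le_of_transform:
  assumes P: "P \<in> hyp3" and sp: "spectral_system \<Gamma> u t" and J: "finite J"
    and \<kappa>: "continuous_on UNIV \<kappa>" "\<And>r. r \<ge> 1 \<Longrightarrow> \<kappa> r = 0" "\<And>r. r \<ge> 0 \<Longrightarrow> cmod (\<kappa> r) \<le> b"
    and h: "h > 0" "\<And>j. j \<in> J \<Longrightarrow> h \<le> cmod (integral {0..1} (\<lambda>s. \<kappa> s * spherical_sin (t j) s))"
  shows "(\<Sum>j\<in>J. (cmod (u j (hyp_orbit \<Gamma> P)))\<^sup>2) \<le> real (cball_multiplicity P 1) * b\<^sup>2 / h\<^sup>2"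
proof -
  let ?I = "\<lambda>j. integral {0..1} (\<lambda>s. \<kappa> s * spherical_sin (t j) s)" and ?K = "real (cball_multiplicity P 1)"
  have "(4 * pi * h)\<^sup>2 * (\<Sum>j\<in>J. (cmod (u j (hyp_orbit \<Gamma> P)))\<^sup>2)
      \<le> (\<Sum>j\<in>J. (cmod (4 * pi * ?I j * u j (hyp_orbit \<Gamma> P)))\<^sup>2)"
    unfolding sum_distrib_left
  proof (rule sum_mono)
    fix j assume "j \<in> J"
    then have "(4 * pi * h)\<^sup>2 \<le> (cmod (4 * pi * ?I j))\<^sup>2"
      using h by (intro power_mono) (auto simp: norm_mult)
    then show "(4 * pi * h)\<^sup>2 * (cmod (u j (hyp_orbit \<Gamma> P)))\<^sup>2 \<le> (cmod (4 * pi * ?I j * u j (hyp_orbit \<Gamma> P)))\<^sup>2"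
      unfolding norm_mult[of "4 * pi * ?I j"] power_mult_distrib[of _ "cmod (u j (hyp_orbit \<Gamma> P))"]
      by (rule mult_right_mono) simp
  qed
  also have "\<dots> \<le> ?K * (4 * pi * b\<^sup>2)"
    by (rule bessel_automorphic_kernel[OF P sp J \<kappa>])
  also have "\<dots> = 4 * pi * (?K * b\<^sup>2)" by simp
  also have "\<dots> \<le> (4 * pi)\<^sup>2 * (?K * b\<^sup>2)"
    using pi_gt3 by (intro mult_right_mono self_le_power) auto
  finally have "(4 * pi)\<^sup>2 * (h\<^sup>2 * (\<Sum>j\<in>J. (cmod (u j (hyp_orbit \<Gamma> P)))\<^sup>2)) \<le> (4 * pi)\<^sup>2 * (?K * b\<^sup>2)"
    by (simp only: power_mult_distrib mult.assoc)
  then show ?thesis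
    using h(1) by (simp add: pos_le_divide_eq mult.commute)
qed

end

lemma cos_ge_half:
  fixes x :: real assumes "\<bar>x\<bar> \<le> 1" shows "cos x \<ge> 1 / 2"
proof -
  have "cos (pi / 3) \<le> cos \<bar>x\<bar>" using assms pi_gt3 by (intro cos_monotone_0_pi_le) auto
  then show ?thesis by (simp add: cos_60)
qed

lemma Re_spherical_sin_ge:
  assumes t: "\<bar>Re t\<bar> \<le> 4" and s: "0 \<le> s" "s \<le> 1 / 4"
  shows "s / 2 \<le> Re (spherical_sin t s)"
proof -
  have deriv: "((\<lambda>x. Re (spherical_sin t x) - x / 2) has_real_derivative Re (cos (t * of_real x)) - 1 / 2) (at x)" for x
    using bounded_linear.has_vector_derivative[OF bounded_linear_Re spherical_sin_has_derivative]
    by (intro DERIV_diff) (auto simp: has_real_derivative_iff_has_vector_derivative[symmetric] intro!: derivative_eq_intros)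
  have "1 / 2 \<le> Re (cos (t * of_real x))" if x: "0 \<le> x" "x \<le> s" for x
  proof -
    have "\<bar>Re t * x\<bar> \<le> 4 * (1 / 4)" unfolding abs_mult using t s x by (intro mult_mono) auto
    then have "1 / 2 \<le> cos (Re t * x)" by (intro cos_ge_half) simp
    moreover have "1 \<le> cosh (Im t * x)" by (rule cosh_real_ge_1)
    ultimately have "1 / 2 * 1 \<le> cos (Re t * x) * cosh (Im t * x)" by (intro mult_mono) auto
    then show ?thesis by (simp add: Re_cos cosh_def)
  qed
  then have "\<exists>y. ((\<lambda>x. Re (spherical_sin t x) - x / 2) has_real_derivative y) (at x) \<and> 0 \<le> y"
    if "0 \<le> x" "x \<le> s" for x
    using that by (intro exI[of _ "Re (cos (t * of_real x)) - 1 / 2"] conjI deriv) simp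
  from DERIV_nonneg_imp_nondecreasing[OF s(1) this] show ?thesis by simp
qed

lemma low_frequency_transform_ge:
  assumes t: "\<bar>Re t\<bar> \<le> 4"
  shows "1 / 768 \<le> cmod (integral {0..1} (\<lambda>s. of_real (max 0 (1 / 4 - s)) * spherical_sin t s))"
proof -
  let ?f = "\<lambda>s. complex_of_real (max 0 (1 / 4 - s)) * spherical_sin t s"
  let ?g = "\<lambda>s. max 0 (1 / 4 - s) * (s / 2) :: real"
  have f: "?f integrable_on {0..1}"
    by (intro integrable_continuous_interval continuous_intros
        continuous_on_subset[OF has_vector_derivative_imp_continuous_on_UNIV[OF spherical_sin_has_derivative]]) auto
  have "((\<lambda>s :: real. (1 / 4 - s) * (s / 2)) has_integral
      ((1 / 4)\<^sup>2 / 16 - (1 / 4) ^ 3 / 6) - (0\<^sup>2 / 16 - 0 ^ 3 / 6)) {0..1 / 4}"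
    by (rule fundamental_theorem_of_calculus)
       (auto intro!: derivative_eq_intros has_vector_derivative_at_within
         simp: has_real_derivative_iff_has_vector_derivative[symmetric] power2_eq_square field_simps)
  from integral_unique[OF this] have "1 / 768 = integral {0..1 / 4} (\<lambda>s :: real. (1 / 4 - s) * (s / 2))"
    by (simp add: power2_eq_square power3_eq_cube)
  also have "\<dots> = integral {0..1 / 4} ?g" by (intro integral_cong) auto
  also have "\<dots> \<le> integral {0..1} ?g"
    by (intro integral_subset_le integrable_continuous_interval continuous_intros) auto
  also have "\<dots> \<le> integral {0..1} (\<lambda>s. Re (?f s))"
  proof (rule integral_le)
    show "?g integrable_on {0..1}" by (intro integrable_continuous_interval continuous_intros) auto
    show "(\<lambda>s. Re (?f s)) integrable_on {0..1}"
      using integrable_linear[OF f bounded_linear_Re] by (simp add: o_def)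
    show "?g s \<le> Re (?f s)" if "s \<in> {0..1}" for s
      using Re_spherical_sin_ge[OF t, of s] that
      by (cases "s \<le> 1 / 4") (auto simp: max_def mult_left_mono simp del: times_divide_eq_right)
  qed
  also have "\<dots> = Re (integral {0..1} ?f)"
    using integral_linear[OF f bounded_linear_Re] by (simp add: o_def)
  also have "\<dots> \<le> cmod (integral {0..1} ?f)" by (rule complex_Re_le_cmod)
  finally show ?thesis .
qed

lemma integral_hat_mult_cos:
  fixes q :: real assumes q: "q \<noteq> 0"
  shows "integral {0..1} (\<lambda>s. (1 - s) * cos (q * s)) = (1 - cos q) / q\<^sup>2"
proof -
  let ?F = "\<lambda>s. (1 - s) * sin (q * s) / q - cos (q * s) / q\<^sup>2"
  have "((\<lambda>s. (1 - s) * cos (q * s)) has_integral ?F 1 - ?F 0) {0..1}"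
  proof (rule fundamental_theorem_of_calculus)
    fix s :: real
    have "(?F has_real_derivative (1 - s) * cos (q * s)) (at s)"
      using q by (auto intro!: derivative_eq_intros simp: field_simps power2_eq_square)
    then show "(?F has_vector_derivative (1 - s) * cos (q * s)) (at s within {0..1})"
      by (simp add: has_real_derivative_iff_has_vector_derivative has_vector_derivative_at_within)
  qed simp
  then show ?thesis by (simp add: integral_unique diff_divide_distrib)
qed

lemma integral_hat_mult_cos_ge:
  fixes q :: real assumes q: "\<bar>q\<bar> \<le> 1"
  shows "1 / 4 \<le> integral {0..1} (\<lambda>s. (1 - s) * cos (q * s))"
proof -
  have "((\<lambda>s :: real. (1 - s) * (1 / 2)) has_integral (1 / 2 - 1\<^sup>2 / 4) - (0 / 2 - 0\<^sup>2 / 4)) {0..1}"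
    by (rule fundamental_theorem_of_calculus)
       (auto intro!: derivative_eq_intros has_vector_derivative_at_within
         simp: has_real_derivative_iff_has_vector_derivative[symmetric] field_simps)
  from integral_unique[OF this] have "1 / 4 = integral {0..1} (\<lambda>s :: real. (1 - s) * (1 / 2))"
    by simp
  also have "\<dots> \<le> integral {0..1} (\<lambda>s. (1 - s) * cos (q * s))"
  proof (rule integral_le)
    fix s :: real assume s: "s \<in> {0..1}"
    have "\<bar>q * s\<bar> \<le> 1 * 1" unfolding abs_mult using q s by (intro mult_mono) auto
    then have "cos (q * s) \<ge> 1 / 2" by (intro cos_ge_half) simp
    then show "(1 - s) * (1 / 2) \<le> (1 - s) * cos (q * s)" using s by (intro mult_left_mono) auto
  qed (intro integrable_continuous_interval continuous_intros)+
  finally show ?thesis .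
qed

lemma high_frequency_integral_ge:
  fixes \<tau> a :: real
  assumes \<tau>: "\<tau> \<ge> 3" and a: "\<bar>a - \<tau>\<bar> \<le> 1"
  shows "1 / 16 \<le> integral {0..1} (\<lambda>s. \<tau> * sin (\<tau> * s) * max 0 (1 - s) * (sin (a * s) / a))"
proof -
  have bounds: "a \<ge> 2" "a \<le> \<tau> + 1" "\<tau> + a \<ge> 5" using a \<tau> by auto
  let ?I = "\<lambda>q. integral {0..1} (\<lambda>s. (1 - s) * cos (q * s))"
  have int: "(\<lambda>s. (1 - s) * cos (q * s)) integrable_on {0..1}" for q :: real
    by (intro integrable_continuous_interval continuous_intros)
  have "?I (\<tau> + a) = (1 - cos (\<tau> + a)) / (\<tau> + a)\<^sup>2"
    using bounds by (intro integral_hat_mult_cos) auto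
  also have "\<dots> \<le> 2 / 5\<^sup>2"
    using bounds cos_ge_minus_one[of "\<tau> + a"] by (intro frac_le power_mono) auto
  finally have "17 / 100 \<le> ?I (\<tau> - a) - ?I (\<tau> + a)"
    using integral_hat_mult_cos_ge[of "\<tau> - a"] a unfolding abs_minus_commute[of a] by simp
  moreover have "3 / 8 \<le> \<tau> / (2 * a)" using \<tau> bounds by (simp add: field_simps)
  ultimately have "1 / 16 \<le> \<tau> / (2 * a) * (?I (\<tau> - a) - ?I (\<tau> + a))"
    using mult_mono[of "3 / 8" "\<tau> / (2 * a)" "17 / 100" "?I (\<tau> - a) - ?I (\<tau> + a)"] by simp
  also have "\<dots> = integral {0..1} (\<lambda>s. \<tau> / (2 * a) * ((1 - s) * cos ((\<tau> - a) * s) - (1 - s) * cos ((\<tau> + a) * s)))"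
    by (simp only: integral_mult_right Henstock_Kurzweil_Integration.integral_diff[OF int int])
  also have "\<dots> = integral {0..1} (\<lambda>s. \<tau> * sin (\<tau> * s) * max 0 (1 - s) * (sin (a * s) / a))"
  proof (rule integral_cong)
    fix s :: real assume s: "s \<in> {0..1}"
    have "cos ((\<tau> - a) * s) - cos ((\<tau> + a) * s) = 2 * (sin (\<tau> * s) * sin (a * s))"
      unfolding sin_times_sin by (simp add: left_diff_distrib distrib_right)
    then show "\<tau> / (2 * a) * ((1 - s) * cos ((\<tau> - a) * s) - (1 - s) * cos ((\<tau> + a) * s))
        = \<tau> * sin (\<tau> * s) * max 0 (1 - s) * (sin (a * s) / a)"
      unfolding right_diff_distrib[of "1 - s", symmetric] using s bounds by simp
  qed
  finally show ?thesis .
qed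

lemma high_frequency_transform_ge:
  assumes \<tau>: "\<tau> \<ge> 3" and t: "Im t = 0" "\<bar>\<bar>Re t\<bar> - \<tau>\<bar> \<le> 1"
  shows "1 / 16 \<le> cmod (integral {0..1} (\<lambda>s. of_real (\<tau> * sin (\<tau> * s) * max 0 (1 - s)) * spherical_sin t s))"
proof -
  let ?f = "\<lambda>s. \<tau> * sin (\<tau> * s) * max 0 (1 - s) * (sin (\<bar>Re t\<bar> * s) / \<bar>Re t\<bar>)"
  have real: "t = of_real (Re t)" using t(1) by (simp add: complex_eq_iff)
  have "Re t \<noteq> 0" using t(2) \<tau> by auto
  then have "spherical_sin t s = of_real (sin (\<bar>Re t\<bar> * s) / \<bar>Re t\<bar>)" for s
    by (subst real) (simp add: spherical_sin_def abs_if sin_of_real[symmetric] del: sin_of_real)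
  then have "integral {0..1} (\<lambda>s. of_real (\<tau> * sin (\<tau> * s) * max 0 (1 - s)) * spherical_sin t s)
      = integral {0..1} (\<lambda>s. complex_of_real (?f s))" by simp
  also have "\<dots> = of_real (integral {0..1} ?f)"
  proof -
    have "?f integrable_on {0..1}"
      by (intro integrable_continuous_interval continuous_intros) (use \<open>Re t \<noteq> 0\<close> in auto)
    from integral_linear[OF this bounded_linear_of_real[where 'a = complex]] show ?thesis
      by (simp only: o_def)
  qed
  finally have "integral {0..1} (\<lambda>s. of_real (\<tau> * sin (\<tau> * s) * max 0 (1 - s)) * spherical_sin t s)
      = complex_of_real (integral {0..1} ?f)" .
  then show ?thesis
    using high_frequency_integral_ge[OF \<tau> t(2)] by (simp only: norm_of_real)
qed

context discrete_PSL2C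
begin

definition weyl_constant :: "complex \<times> real \<Rightarrow> real" where
  "weyl_constant P = 768\<^sup>2 * real (cball_multiplicity P 1)"

lemma weyl_constant_pos: "P \<in> hyp3 \<Longrightarrow> weyl_constant P > 0"
  by (simp add: weyl_constant_def cball_multiplicity_pos)

lemma low_frequency_weyl_bound:
  assumes P: "P \<in> hyp3" and sp: "spectral_system \<Gamma> u t" and J: "finite J"
    and t: "\<And>j. j \<in> J \<Longrightarrow> \<bar>Re (t j)\<bar> \<le> 4"
  shows "(\<Sum>j\<in>J. (cmod (u j (hyp_orbit \<Gamma> P)))\<^sup>2) \<le> weyl_constant P"
proof -
  have "(\<Sum>j\<in>J. (cmod (u j (hyp_orbit \<Gamma> P)))\<^sup>2) \<le> real (cball_multiplicity P 1) * 1\<^sup>2 / (1 / 768)\<^sup>2"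
  proof (rule sum_eigenfunctions_le_of_transform[OF P sp J])
    show "1 / 768 \<le> cmod (integral {0..1} (\<lambda>s. of_real (max 0 (1 / 4 - s)) * spherical_sin (t j) s))"
      if "j \<in> J" for j using t[OF that] by (rule low_frequency_transform_ge)
  qed (auto intro!: continuous_intros)
  then show ?thesis by (simp add: weyl_constant_def power_divide)
qed

lemma high_frequency_weyl_bound:
  assumes P: "P \<in> hyp3" and sp: "spectral_system \<Gamma> u t" and J: "finite J" and \<tau>: "\<tau> \<ge> 3"
    and t: "\<And>j. j \<in> J \<Longrightarrow> Im (t j) = 0 \<and> \<bar>\<bar>Re (t j)\<bar> - \<tau>\<bar> \<le> 1"
  shows "(\<Sum>j\<in>J. (cmod (u j (hyp_orbit \<Gamma> P)))\<^sup>2) \<le> 256 * real (cball_multiplicity P 1) * \<tau>\<^sup>2"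
proof -
  have "(\<Sum>j\<in>J. (cmod (u j (hyp_orbit \<Gamma> P)))\<^sup>2) \<le> real (cball_multiplicity P 1) * \<tau>\<^sup>2 / (1 / 16)\<^sup>2"
  proof (rule sum_eigenfunctions_le_of_transform[OF P sp J])
    show "1 / 16 \<le> cmod (integral {0..1} (\<lambda>s. of_real (\<tau> * sin (\<tau> * s) * max 0 (1 - s)) * spherical_sin (t j) s))"
      if "j \<in> J" for j using \<tau> t[OF that] by (intro high_frequency_transform_ge) auto
    show "cmod (of_real (\<tau> * sin (\<tau> * s) * max 0 (1 - s))) \<le> \<tau>" if "s \<ge> 0" for s
    proof -
      have "\<bar>\<tau> * sin (\<tau> * s) * max 0 (1 - s)\<bar> \<le> \<tau> * 1 * 1"
        unfolding abs_mult using \<tau> that by (intro mult_mono) auto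
      then show ?thesis by (simp only: norm_of_real mult_1_right)
    qed
  qed (auto intro!: continuous_intros)
  then show ?thesis by (simp add: power_divide)
qed

theorem local_weyl_bound:
  assumes P: "P \<in> hyp3" and sp: "spectral_system \<Gamma> u t" and J: "finite J" and \<tau>: "\<tau> \<ge> 0"
    and t: "\<And>j. j \<in> J \<Longrightarrow> Im (t j) = 0 \<and> \<bar>\<bar>Re (t j)\<bar> - \<tau>\<bar> \<le> 1"
  shows "(\<Sum>j\<in>J. (cmod (u j (hyp_orbit \<Gamma> P)))\<^sup>2) \<le> weyl_constant P * (1 + \<tau>)\<^sup>2"
proof (cases "\<tau> \<ge> 3")
  case True
  have "256 * real (cball_multiplicity P 1) * \<tau>\<^sup>2 \<le> weyl_constant P * (1 + \<tau>)\<^sup>2"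
    unfolding weyl_constant_def using \<tau> by (intro mult_mono power_mono) auto
  then show ?thesis using high_frequency_weyl_bound[OF P sp J True t] by linarith
next
  case False
  have "\<bar>Re (t j)\<bar> \<le> 4" if "j \<in> J" for j using t[OF that] False by linarith
  then have "(\<Sum>j\<in>J. (cmod (u j (hyp_orbit \<Gamma> P)))\<^sup>2) \<le> weyl_constant P * 1"
    using low_frequency_weyl_bound[OF P sp J] by simp
  also have "\<dots> \<le> weyl_constant P * (1 + \<tau>)\<^sup>2"
    using \<tau> weyl_constant_pos[OF P] by (intro mult_left_mono) (auto simp: one_le_power)
  finally show ?thesis .
qed

end

section \<open>The large sieve for exponential sums\<close>

lemma DERIV_cmod_power2:
  assumes "(f has_vector_derivative f') (at x)"
  shows "((\<lambda>x. (cmod (f x))\<^sup>2) has_real_derivative 2 * (f x \<bullet> f')) (at x)"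
proof -
  note deriv = assms[unfolded has_vector_derivative_def]
  have "((\<lambda>x. f x \<bullet> f x) has_real_derivative f x \<bullet> f' + f' \<bullet> f x) (at x)"
    unfolding has_field_derivative_def
    by (rule has_derivative_eq_rhs[OF has_derivative_inner[OF deriv deriv]])
       (auto simp: fun_eq_iff algebra_simps)
  then show ?thesis by (simp add: power2_norm_eq_inner inner_commute)
qed

lemma inner_le_weighted_squares:
  fixes z w :: complex
  assumes "T > 0"
  shows "\<bar>2 * (z \<bullet> w)\<bar> \<le> T * (cmod z)\<^sup>2 + (cmod w)\<^sup>2 / T"
proof -
  have "0 \<le> (T * cmod z - cmod w)\<^sup>2 / T" using assms by simp
  also have "\<dots> = T * (cmod z)\<^sup>2 + (cmod w)\<^sup>2 / T - 2 * (cmod z * cmod w)"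
    using assms by (simp add: field_simps power2_eq_square)
  finally show ?thesis using Cauchy_Schwarz_ineq2[of z w] by (simp add: abs_mult)
qed

context
  fixes f f' :: "real \<Rightarrow> complex" and T \<delta> :: real
  assumes f: "\<And>y. (f has_vector_derivative f' y) (at y)" and f': "continuous_on UNIV f'"
    and T: "T > 0" and \<delta>: "\<delta> > 0"
begin

lemma set_integrable_sobolev_integrand:
  "set_integrable lborel {a..b} (\<lambda>v. (1 / \<delta> + T) * (cmod (f v))\<^sup>2 + (cmod (f' v))\<^sup>2 / T)"
  unfolding set_integrable_def using T
  by (intro borel_integrable_compact continuous_intros continuous_on_subset[OF f']
      continuous_on_subset[OF has_vector_derivative_imp_continuous_on_UNIV[OF f]]) auto

lemma sobolev_pointwise:
  "(cmod (f y))\<^sup>2 \<le> (LBINT v:{y..y + \<delta>}. (1 / \<delta> + T) * (cmod (f v))\<^sup>2 + (cmod (f' v))\<^sup>2 / T)"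
proof -
  define \<phi> where "\<phi> v = (v - y - \<delta>) / \<delta> * (cmod (f v))\<^sup>2" for v
  define \<phi>' where "\<phi>' v = (cmod (f v))\<^sup>2 / \<delta> + (v - y - \<delta>) / \<delta> * (2 * (f v \<bullet> f' v))" for v
  have deriv: "(\<phi> has_vector_derivative \<phi>' v) (at v)" for v
  proof -
    have "((\<lambda>v. (v - y - \<delta>) / \<delta>) has_real_derivative 1 / \<delta>) (at v)"
      using \<delta> by (auto intro!: derivative_eq_intros)
    from DERIV_mult[OF this DERIV_cmod_power2[OF f]] show ?thesis
      unfolding \<phi>_def \<phi>'_def by (simp add: mult_ac has_real_derivative_iff_has_vector_derivative[symmetric])
  qed
  have cont: "continuous_on {y..y + \<delta>} \<phi>'"
    unfolding \<phi>'_def using \<delta>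
    by (intro continuous_intros continuous_on_subset[OF f']
        continuous_on_subset[OF has_vector_derivative_imp_continuous_on_UNIV[OF f]]) auto
  have "(cmod (f y))\<^sup>2 = \<phi> (y + \<delta>) - \<phi> y" using \<delta> by (simp add: \<phi>_def)
  also have "\<dots> = (LBINT v:{y..y + \<delta>}. \<phi>' v)"
    unfolding set_lebesgue_integral_def using \<delta> cont
    by (intro integral_FTC_Icc[symmetric] has_vector_derivative_at_within[OF deriv]) auto
  also have "\<dots> \<le> (LBINT v:{y..y + \<delta>}. (1 / \<delta> + T) * (cmod (f v))\<^sup>2 + (cmod (f' v))\<^sup>2 / T)"
  proof (rule set_integral_mono)
    show "set_integrable lborel {y..y + \<delta>} \<phi>'"
      unfolding set_integrable_def using cont by (intro borel_integrable_compact) auto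
    fix v assume v: "v \<in> {y..y + \<delta>}"
    have "\<bar>(v - y - \<delta>) / \<delta>\<bar> \<le> 1" using v \<delta> by (auto simp: abs_le_iff field_simps)
    then have "\<bar>(v - y - \<delta>) / \<delta> * (2 * (f v \<bullet> f' v))\<bar> \<le> 1 * \<bar>2 * (f v \<bullet> f' v)\<bar>"
      unfolding abs_mult by (intro mult_right_mono) auto
    then have "(v - y - \<delta>) / \<delta> * (2 * (f v \<bullet> f' v)) \<le> T * (cmod (f v))\<^sup>2 + (cmod (f' v))\<^sup>2 / T"
      using inner_le_weighted_squares[OF T, of "f v" "f' v"] by linarith
    then show "\<phi>' v \<le> (1 / \<delta> + T) * (cmod (f v))\<^sup>2 + (cmod (f' v))\<^sup>2 / T"
      by (simp add: \<phi>'_def algebra_simps)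
  qed (rule set_integrable_sobolev_integrand)
  finally show ?thesis .
qed

lemma gallagher_inequality:
  fixes y :: "'k \<Rightarrow> real"
  assumes A: "finite A" and sep: "\<And>k l. k \<in> A \<Longrightarrow> l \<in> A \<Longrightarrow> k \<noteq> l \<Longrightarrow> \<bar>y k - y l\<bar> > \<delta>"
    and range: "\<And>k. k \<in> A \<Longrightarrow> a \<le> y k \<and> y k + \<delta> \<le> b"
  shows "(\<Sum>k\<in>A. (cmod (f (y k)))\<^sup>2)
    \<le> (1 / \<delta> + T) * (LBINT v:{a..b}. (cmod (f v))\<^sup>2) + (LBINT v:{a..b}. (cmod (f' v))\<^sup>2) / T"
proof -
  let ?G = "\<lambda>v. (1 / \<delta> + T) * (cmod (f v))\<^sup>2 + (cmod (f' v))\<^sup>2 / T" and ?I = "\<lambda>k. {y k..y k + \<delta>}"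
  have "(\<Sum>k\<in>A. (cmod (f (y k)))\<^sup>2) \<le> (\<Sum>k\<in>A. LBINT v:?I k. ?G v)"
    by (intro sum_mono sobolev_pointwise)
  also have "\<dots> = (LBINT v:(\<Union>k\<in>A. ?I k). ?G v)"
  proof (rule set_integral_finite_Union[symmetric, OF A])
    show "disjoint_family_on ?I A"
      unfolding disjoint_family_on_def using sep by (fastforce simp: abs_if split: if_splits)
  qed (auto intro: set_integrable_sobolev_integrand)
  also have "\<dots> \<le> (LBINT v:{a..b}. ?G v)"
  proof -
    have sub: "(\<Union>k\<in>A. ?I k) \<subseteq> {a..b}" using range by fastforce
    have "0 \<le> ?G v" for v using T \<delta> by (intro add_nonneg_nonneg) auto
    then have "indicator (\<Union>k\<in>A. ?I k) v *\<^sub>R ?G v \<le> indicator {a..b} v *\<^sub>R ?G v" for v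
      using sub by (simp add: indicator_def subset_iff del: UN_iff)
    moreover have "set_integrable lborel (\<Union>k\<in>A. ?I k) ?G"
      by (rule set_integrable_subset[OF set_integrable_sobolev_integrand _ sub]) (use A in auto)
    ultimately show ?thesis
      using set_integrable_sobolev_integrand unfolding set_lebesgue_integral_def set_integrable_def
      by (intro integral_mono)
  qed
  also have "\<dots> = (1 / \<delta> + T) * (LBINT v:{a..b}. (cmod (f v))\<^sup>2) + (LBINT v:{a..b}. (cmod (f' v))\<^sup>2) / T"
  proof -
    have "set_integrable lborel {a..b} (\<lambda>v. (cmod (f v))\<^sup>2)" "set_integrable lborel {a..b} (\<lambda>v. (cmod (f' v))\<^sup>2)"
      unfolding set_integrable_def
      by (intro borel_integrable_compact continuous_intros continuous_on_subset[OF f']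
          continuous_on_subset[OF has_vector_derivative_imp_continuous_on_UNIV[OF f]]; simp)+
    then show ?thesis by (subst set_integral_add) simp_all
  qed
  finally show ?thesis .
qed

end

lemma card_separated_le:
  fixes y :: "'k \<Rightarrow> real"
  assumes "\<delta> > 0" "finite A" "\<And>k l. k \<in> A \<Longrightarrow> l \<in> A \<Longrightarrow> k \<noteq> l \<Longrightarrow> \<bar>y k - y l\<bar> > \<delta>"
    and "\<And>k. k \<in> A \<Longrightarrow> a \<le> y k \<and> y k + \<delta> \<le> b" and "T > 0" "a \<le> b"
  shows "real (card A) \<le> (1 / \<delta> + T) * (b - a)"
  using gallagher_inequality[of "\<lambda>_. 1" "\<lambda>_. 0" T \<delta> A y a b] assms
  by (simp add: set_lebesgue_integral_def)

lemma
  assumes z: "Re z > 0"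
  shows set_integrable_exp_minus: "set_integrable lborel {0<..} (\<lambda>y. exp (- (z * of_real y)))"
    and set_integral_exp_minus: "(LBINT y:{0<..}. exp (- (z * of_real y))) = 1 / z"
proof -
  have decay: "((\<lambda>y. exp (- (Re z * y))) \<longlongrightarrow> 0) at_top" using z by real_asymp
  have deriv: "((\<lambda>y. - exp (- (Re z * y)) / Re z) has_real_derivative exp (- (Re z * y))) (at y)" for y
    using z by (auto intro!: derivative_eq_intros)
  have "set_integrable lborel (einterval 0 \<infinity>) (\<lambda>y. exp (- (Re z * y)))"
  proof (rule interval_integral_FTC_nonneg(1)[OF _ deriv])
    show "(((\<lambda>y. - exp (- (Re z * y)) / Re z) \<circ> real_of_ereal) \<longlongrightarrow> - exp 0 / Re z) (at_right 0)"
      unfolding zero_ereal_def ereal_tendsto_simps1 using z by (auto intro!: tendsto_eq_intros)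
    show "(((\<lambda>y. - exp (- (Re z * y)) / Re z) \<circ> real_of_ereal) \<longlongrightarrow> - 0 / Re z) (at_left \<infinity>)"
      unfolding ereal_tendsto_simps1 using z by (intro tendsto_intros decay) auto
  qed auto
  then have "set_integrable lborel {0<..} (\<lambda>y. exp (- (Re z * y)))" by (simp add: zero_ereal_def)
  then show int: "set_integrable lborel {0<..} (\<lambda>y. exp (- (z * of_real y)))"
    by (rule set_integrable_bound) (auto simp: set_borel_measurable_def norm_exp_eq_Re)
  have "(LBINT y=0..\<infinity>. exp (- (z * of_real y))) = - 0 / z - (- exp 0 / z)"
  proof (rule interval_integral_FTC_integrable)
    show "((\<lambda>y. - exp (- (z * of_real y)) / z) has_vector_derivative exp (- (z * of_real y))) (at y)" for y
      using z by (auto intro!: derivative_eq_intros has_vector_derivative_real_field)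
    show "(((\<lambda>y. - exp (- (z * of_real y)) / z) \<circ> real_of_ereal) \<longlongrightarrow> - exp 0 / z) (at_right 0)"
      unfolding zero_ereal_def ereal_tendsto_simps1 using z by (auto intro!: tendsto_eq_intros)
    have "((\<lambda>y. exp (- (z * of_real y))) \<longlongrightarrow> 0) at_top"
      using decay by (subst tendsto_norm_zero_iff[symmetric]) (simp add: norm_exp_eq_Re)
    then show "(((\<lambda>y. - exp (- (z * of_real y)) / z) \<circ> real_of_ereal) \<longlongrightarrow> - 0 / z) (at_left \<infinity>)"
      unfolding ereal_tendsto_simps1 using z by (intro tendsto_intros) auto
    show "set_integrable lborel (einterval 0 \<infinity>) (\<lambda>y. exp (- (z * of_real y)))"
      using int by (simp add: zero_ereal_def)
  qed (auto intro!: continuous_intros)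
  then show "(LBINT y:{0<..}. exp (- (z * of_real y))) = 1 / z"
    by (simp add: interval_lebesgue_integral_0_infty)
qed

lemma
  fixes \<tau> :: real
  shows integrable_exp_abs_exp: "integrable lborel (\<lambda>y. of_real (exp (- \<bar>y\<bar>)) * exp (\<i> * of_real (\<tau> * y)))" (is "integrable lborel ?f")
    and integral_exp_abs_exp: "(\<integral>y. of_real (exp (- \<bar>y\<bar>)) * exp (\<i> * of_real (\<tau> * y)) \<partial>lborel) = 2 / (1 + \<tau>\<^sup>2)"
proof -
  define g where "g \<tau> y = indicator {0<..} y *\<^sub>R exp (- ((1 - \<i> * of_real \<tau>) * of_real y))" for \<tau> y :: real
  have g: "integrable lborel (g \<tau>)" "(\<integral>y. g \<tau> y \<partial>lborel) = 1 / (1 - \<i> * of_real \<tau>)" for \<tau>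
    using set_integrable_exp_minus[of "1 - \<i> * of_real \<tau>"] set_integral_exp_minus[of "1 - \<i> * of_real \<tau>"]
    by (simp_all add: g_def[abs_def] set_integrable_def set_lebesgue_integral_def)
  have reflect: "integrable lborel (\<lambda>y. g \<tau> (- y))" "(\<integral>y. g \<tau> (- y) \<partial>lborel) = (\<integral>y. g \<tau> y \<partial>lborel)" for \<tau>
    using lborel_integrable_real_affine[OF g(1), of "-1" \<tau> 0] lborel_integral_real_affine[of "-1" "g \<tau>" 0] by simp_all
  have split: "AE y in lborel. ?f y = g \<tau> y + g (- \<tau>) (- y)"
    using AE_lborel_singleton[of 0]
    by eventually_elim (auto simp: g_def indicator_def abs_if exp_of_real[symmetric] algebra_simps simp flip: exp_add)
  have meas: "?f \<in> borel_measurable lborel" by measurable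
  have meas': "(\<lambda>y. g \<tau> y + g (- \<tau>) (- y)) \<in> borel_measurable lborel"
    by (intro borel_measurable_add borel_measurable_integrable[OF g(1)] borel_measurable_integrable[OF reflect(1)])
  show "integrable lborel ?f"
    using g(1) reflect(1) by (subst integrable_cong_AE[OF meas meas' split]) auto
  have "(\<integral>y. ?f y \<partial>lborel) = (\<integral>y. g \<tau> y + g (- \<tau>) (- y) \<partial>lborel)"
    by (rule integral_cong_AE[OF meas meas' split])
  also have "\<dots> = 1 / (1 - \<i> * of_real \<tau>) + 1 / (1 + \<i> * of_real \<tau>)"
    using g reflect by (simp add: Bochner_Integration.integral_add)
  also have "\<dots> = 2 / (1 + \<tau>\<^sup>2)"
  proof -
    have "(1 - \<i> * complex_of_real \<tau>) * (1 + \<i> * of_real \<tau>) = of_real (1 + \<tau>\<^sup>2)"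
      by (simp add: algebra_simps power2_eq_square)
    moreover have "1 - \<i> * complex_of_real \<tau> \<noteq> 0" "1 + \<i> * complex_of_real \<tau> \<noteq> 0"
      by (auto simp: complex_eq_iff)
    ultimately show ?thesis by (simp add: add_frac_eq)
  qed
  finally show "(\<integral>y. ?f y \<partial>lborel) = 2 / (1 + \<tau>\<^sup>2)" .
qed

lemma cmod_exponential_sum_power2:
  fixes c :: "'j \<Rightarrow> complex" and t :: "'j \<Rightarrow> real"
  shows "complex_of_real ((cmod (\<Sum>j\<in>J. c j * exp (\<i> * of_real (t j * y))))\<^sup>2)
    = (\<Sum>j\<in>J. \<Sum>l\<in>J. (c j * cnj (c l)) * exp (\<i> * of_real ((t j - t l) * y)))"
  unfolding complex_norm_square cnj_sum sum_product
  by (intro sum.cong refl) (simp add: exp_cnj algebra_simps flip: exp_add)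

lemma mean_square_exponential_sum:
  fixes c :: "'j \<Rightarrow> complex" and t :: "'j \<Rightarrow> real"
  shows "(LBINT y:{-1..1}. (cmod (\<Sum>j\<in>J. c j * exp (\<i> * of_real (t j * y))))\<^sup>2)
    \<le> 6 * (\<Sum>j\<in>J. \<Sum>l\<in>J. cmod (c j) * cmod (c l) / (1 + (t j - t l)\<^sup>2))"
proof -
  define S where "S y = (\<Sum>j\<in>J. c j * exp (\<i> * of_real (t j * y)))" for y :: real
  let ?w = "\<lambda>y :: real. exp (- \<bar>y\<bar>)"
  let ?e = "\<lambda>j l y. (c j * cnj (c l)) * (of_real (?w y) * exp (\<i> * of_real ((t j - t l) * y)))"
  have expand: "complex_of_real (?w y * (cmod (S y))\<^sup>2) = (\<Sum>j\<in>J. \<Sum>l\<in>J. ?e j l y)" for y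
    unfolding of_real_mult[of "?w y"] S_def cmod_exponential_sum_power2 by (simp add: sum_distrib_left mult_ac)
  have e: "integrable lborel (?e j l)" for j l
    by (intro integrable_mult_right integrable_exp_abs_exp)
  have "integrable lborel (\<lambda>y. complex_of_real (?w y * (cmod (S y))\<^sup>2))"
    unfolding expand by (intro Bochner_Integration.integrable_sum e)
  from integrable_Re[OF this] have w: "integrable lborel (\<lambda>y. ?w y * (cmod (S y))\<^sup>2)" by simp
  have "exp (-1) * (LBINT y:{-1..1}. (cmod (S y))\<^sup>2) = (LBINT y:{-1..1}. exp (-1) * (cmod (S y))\<^sup>2)"
    by simp
  also have "\<dots> \<le> (\<integral>y. ?w y * (cmod (S y))\<^sup>2 \<partial>lborel)"
    unfolding set_lebesgue_integral_def
  proof (rule integral_mono)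
    show "integrable lborel (\<lambda>y. indicator {-1..1} y *\<^sub>R (exp (-1) * (cmod (S y))\<^sup>2))"
      unfolding S_def by (intro borel_integrable_compact continuous_intros) auto
    show "indicator {-1..1} y *\<^sub>R (exp (-1) * (cmod (S y))\<^sup>2) \<le> ?w y * (cmod (S y))\<^sup>2" for y
      by (auto simp: indicator_def intro!: mult_right_mono)
  qed (rule w)
  also have "\<dots> \<le> cmod (\<integral>y. complex_of_real (?w y * (cmod (S y))\<^sup>2) \<partial>lborel)"
    by (simp only: integral_complex_of_real norm_of_real abs_ge_self)
  also have "(\<integral>y. complex_of_real (?w y * (cmod (S y))\<^sup>2) \<partial>lborel)
      = (\<Sum>j\<in>J. \<Sum>l\<in>J. (c j * cnj (c l)) * of_real (2 / (1 + (t j - t l)\<^sup>2)))"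
    unfolding expand
    by (simp only: Bochner_Integration.integral_sum Bochner_Integration.integrable_sum e
        integral_mult_right_zero integral_exp_abs_exp)
  also have "cmod \<dots> \<le> (\<Sum>j\<in>J. \<Sum>l\<in>J. cmod (c j) * cmod (c l) * (2 / (1 + (t j - t l)\<^sup>2)))"
    by (intro order_trans[OF norm_sum] sum_mono) (simp only: norm_mult norm_of_real complex_mod_cnj, simp add: add_nonneg_nonneg)
  also have "\<dots> = 2 * (\<Sum>j\<in>J. \<Sum>l\<in>J. cmod (c j) * cmod (c l) / (1 + (t j - t l)\<^sup>2))" (is "_ = 2 * ?D")
    by (simp add: sum_distrib_left mult_ac)
  finally have "(LBINT y:{-1..1}. (cmod (S y))\<^sup>2) \<le> exp 1 * (2 * ?D)"
    by (simp add: exp_minus field_simps)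
  also have "\<dots> \<le> 3 * (2 * ?D)"
    using exp_le by (intro mult_right_mono mult_nonneg_nonneg sum_nonneg divide_nonneg_pos add_pos_nonneg) auto
  finally show ?thesis by (simp add: S_def)
qed

lemma schur_test_symmetric:
  fixes K :: "'j \<Rightarrow> 'j \<Rightarrow> real"
  assumes K: "\<And>j l. j \<in> J \<Longrightarrow> l \<in> J \<Longrightarrow> K j l \<ge> 0" "\<And>j l. j \<in> J \<Longrightarrow> l \<in> J \<Longrightarrow> K j l = K l j"
    and W: "\<And>j. j \<in> J \<Longrightarrow> (\<Sum>l\<in>J. (\<beta> l)\<^sup>2 * K j l) \<le> W"
  shows "(\<Sum>j\<in>J. \<Sum>l\<in>J. (\<alpha> j * \<beta> j) * (\<alpha> l * \<beta> l) * K j l) \<le> W * (\<Sum>j\<in>J. (\<alpha> j)\<^sup>2)"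
proof -
  let ?Z = "\<Sum>j\<in>J. \<Sum>l\<in>J. (\<alpha> j)\<^sup>2 * (\<beta> l)\<^sup>2 * K j l"
    and ?L = "\<Sum>j\<in>J. \<Sum>l\<in>J. (\<alpha> j * \<beta> j) * (\<alpha> l * \<beta> l) * K j l"
  have "2 * ?L \<le> (\<Sum>j\<in>J. \<Sum>l\<in>J. (\<alpha> j)\<^sup>2 * (\<beta> l)\<^sup>2 * K j l + (\<alpha> l)\<^sup>2 * (\<beta> j)\<^sup>2 * K l j)"
    unfolding sum_distrib_left
  proof (intro sum_mono)
    fix j l assume jl: "j \<in> J" "l \<in> J"
    have "2 * ((\<alpha> j * \<beta> j) * (\<alpha> l * \<beta> l)) \<le> (\<alpha> j)\<^sup>2 * (\<beta> l)\<^sup>2 + (\<alpha> l)\<^sup>2 * (\<beta> j)\<^sup>2"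
      using zero_le_power2[of "\<alpha> j * \<beta> l - \<alpha> l * \<beta> j"] by (simp add: power2_eq_square algebra_simps)
    from mult_right_mono[OF this K(1)[OF jl]]
    show "2 * ((\<alpha> j * \<beta> j) * (\<alpha> l * \<beta> l) * K j l) \<le> (\<alpha> j)\<^sup>2 * (\<beta> l)\<^sup>2 * K j l + (\<alpha> l)\<^sup>2 * (\<beta> j)\<^sup>2 * K l j"
      unfolding K(2)[OF jl(2,1)] by (simp add: algebra_simps)
  qed
  also have "\<dots> = ?Z + (\<Sum>j\<in>J. \<Sum>l\<in>J. (\<alpha> l)\<^sup>2 * (\<beta> j)\<^sup>2 * K l j)" by (simp only: sum.distrib)
  also have "(\<Sum>j\<in>J. \<Sum>l\<in>J. (\<alpha> l)\<^sup>2 * (\<beta> j)\<^sup>2 * K l j) = ?Z" by (rule sum.swap)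
  finally have "?L \<le> ?Z" by simp
  also have "?Z = (\<Sum>j\<in>J. (\<alpha> j)\<^sup>2 * (\<Sum>l\<in>J. (\<beta> l)\<^sup>2 * K j l))"
    by (simp add: sum_distrib_left mult_ac)
  also have "\<dots> \<le> (\<Sum>j\<in>J. (\<alpha> j)\<^sup>2 * W)" using W by (intro sum_mono mult_left_mono) auto
  also have "\<dots> = W * (\<Sum>j\<in>J. (\<alpha> j)\<^sup>2)" by (simp add: sum_distrib_left mult.commute)
  finally show ?thesis .
qed

lemma mean_square_schur:
  fixes c :: "'j \<Rightarrow> complex" and t \<alpha> \<beta> :: "'j \<Rightarrow> real"
  assumes c: "\<And>j. j \<in> J \<Longrightarrow> cmod (c j) \<le> \<alpha> j * \<beta> j"
    and W: "\<And>j. j \<in> J \<Longrightarrow> (\<Sum>l\<in>J. (\<beta> l)\<^sup>2 / (1 + (t j - t l)\<^sup>2)) \<le> W"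
  shows "(LBINT y:{-1..1}. (cmod (\<Sum>j\<in>J. c j * exp (\<i> * of_real (t j * y))))\<^sup>2) \<le> 6 * W * (\<Sum>j\<in>J. (\<alpha> j)\<^sup>2)"
proof -
  let ?K = "\<lambda>j l. 1 / (1 + (t j - t l)\<^sup>2)"
  have K: "?K j l \<ge> 0" for j l by (intro divide_nonneg_pos add_pos_nonneg) auto
  have "(\<Sum>j\<in>J. \<Sum>l\<in>J. cmod (c j) * cmod (c l) / (1 + (t j - t l)\<^sup>2))
      \<le> (\<Sum>j\<in>J. \<Sum>l\<in>J. (\<alpha> j * \<beta> j) * (\<alpha> l * \<beta> l) * ?K j l)"
  proof (intro sum_mono)
    fix j l assume "j \<in> J" "l \<in> J"
    then have "cmod (c j) * cmod (c l) \<le> (\<alpha> j * \<beta> j) * (\<alpha> l * \<beta> l)"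
      using c by (intro mult_mono) (auto intro: order_trans[OF norm_ge_zero])
    from mult_right_mono[OF this K] show "cmod (c j) * cmod (c l) / (1 + (t j - t l)\<^sup>2)
        \<le> (\<alpha> j * \<beta> j) * (\<alpha> l * \<beta> l) * ?K j l" by simp
  qed
  also have "\<dots> \<le> W * (\<Sum>j\<in>J. (\<alpha> j)\<^sup>2)"
    using K W by (intro schur_test_symmetric) (auto simp: power2_commute)
  finally show ?thesis using mean_square_exponential_sum[of c t J] by linarith
qed

lemma weighted_large_sieve:
  fixes t :: "'j \<Rightarrow> real" and a b :: "'j \<Rightarrow> complex" and y :: "'k \<Rightarrow> real"
  assumes T: "T > 0" and t: "\<And>j. j \<in> J \<Longrightarrow> \<bar>t j\<bar> \<le> T"
    and W: "\<And>j. j \<in> J \<Longrightarrow> (\<Sum>l\<in>J. (cmod (b l))\<^sup>2 / (1 + (t j - t l)\<^sup>2)) \<le> W"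
    and \<delta>: "\<delta> > 0" and A: "finite A" and sep: "\<And>k l. k \<in> A \<Longrightarrow> l \<in> A \<Longrightarrow> k \<noteq> l \<Longrightarrow> \<bar>y k - y l\<bar> > \<delta>"
    and range: "\<And>k. k \<in> A \<Longrightarrow> -1 \<le> y k \<and> y k + \<delta> \<le> 1"
  shows "(\<Sum>k\<in>A. (cmod (\<Sum>j\<in>J. a j * b j * exp (\<i> * of_real (t j * y k))))\<^sup>2)
    \<le> 6 * W * (1 / \<delta> + 2 * T) * (\<Sum>j\<in>J. (cmod (a j))\<^sup>2)"
proof -
  let ?a = "\<Sum>j\<in>J. (cmod (a j))\<^sup>2"
  define S where "S v = (\<Sum>j\<in>J. (a j * b j) * exp (\<i> * of_real (t j * v)))" for v :: real
  define S' where "S' v = (\<Sum>j\<in>J. (\<i> * of_real (t j) * (a j * b j)) * exp (\<i> * of_real (t j * v)))" for v :: real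
  have S: "(S has_vector_derivative S' v) (at v)" for v
  proof -
    have "((\<lambda>z. \<Sum>j\<in>J. (a j * b j) * exp (\<i> * (of_real (t j) * z))) has_field_derivative
        (\<Sum>j\<in>J. (\<i> * of_real (t j) * (a j * b j)) * exp (\<i> * (of_real (t j) * of_real v)))) (at (of_real v))"
      by (auto intro!: derivative_eq_intros sum.cong simp: mult_ac)
    from has_vector_derivative_real_field[OF this] show ?thesis
      by (simp add: S_def[abs_def] S'_def)
  qed
  have S': "continuous_on UNIV S'" unfolding S'_def by (intro continuous_intros)
  have int_S: "(LBINT v:{-1..1}. (cmod (S v))\<^sup>2) \<le> 6 * W * ?a"
    unfolding S_def by (rule mean_square_schur[OF _ W]) (simp add: norm_mult)
  have "(LBINT v:{-1..1}. (cmod (S' v))\<^sup>2) \<le> 6 * W * (\<Sum>j\<in>J. (T * cmod (a j))\<^sup>2)"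
    unfolding S'_def
  proof (rule mean_square_schur[OF _ W])
    show "cmod (\<i> * of_real (t j) * (a j * b j)) \<le> T * cmod (a j) * cmod (b j)" if "j \<in> J" for j
      using t[OF that] by (simp add: norm_mult mult.assoc mult_right_mono)
  qed
  then have int_S': "(LBINT v:{-1..1}. (cmod (S' v))\<^sup>2) \<le> 6 * W * (T\<^sup>2 * ?a)"
    by (simp add: power_mult_distrib sum_distrib_left)
  have "(\<Sum>k\<in>A. (cmod (S (y k)))\<^sup>2)
      \<le> (1 / \<delta> + T) * (LBINT v:{-1..1}. (cmod (S v))\<^sup>2) + (LBINT v:{-1..1}. (cmod (S' v))\<^sup>2) / T"
    by (rule gallagher_inequality[OF S S' T \<delta> A sep range])
  also have "\<dots> \<le> (1 / \<delta> + T) * (6 * W * ?a) + (6 * W * (T\<^sup>2 * ?a)) / T"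
    using \<delta> T by (intro add_mono mult_left_mono divide_right_mono int_S int_S') auto
  also have "\<dots> = 6 * W * (1 / \<delta> + 2 * T) * ?a"
    using T \<delta> by (simp add: field_simps power2_eq_square)
  finally show ?thesis by (simp add: S_def)
qed

section \<open>Sums over unit intervals\<close>

lemma sum_inverse_one_plus_square_le_5:
  "(\<Sum>n\<in>{- int k..int k}. 1 / (1 + (real_of_int n)\<^sup>2)) \<le> 5 - 4 / (real k + 1)"
proof (induction k)
  case (Suc k)
  have "{- int (Suc k)..int (Suc k)} = insert (- int (Suc k)) (insert (int (Suc k)) {- int k..int k})" by auto
  then have "(\<Sum>n\<in>{- int (Suc k)..int (Suc k)}. 1 / (1 + (real_of_int n)\<^sup>2))
      = 2 / (1 + (real k + 1)\<^sup>2) + (\<Sum>n\<in>{- int k..int k}. 1 / (1 + (real_of_int n)\<^sup>2))"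
    by (simp add: power2_eq_square algebra_simps)
  also have "\<dots> \<le> 2 / (1 + (real k + 1)\<^sup>2) + (5 - 4 / (real k + 1))" using Suc by simp
  also have "2 / (1 + (real k + 1)\<^sup>2) \<le> 4 / ((real k + 1) * (real k + 2))"
    by (simp add: power2_eq_square divide_le_eq le_divide_eq add_pos_nonneg) (simp add: algebra_simps)
  also have "4 / ((real k + 1) * (real k + 2)) = 4 / (real k + 1) - 4 / (real (Suc k) + 1)"
    by (simp add: field_simps)
  finally show ?case by simp
qed simp

lemma sum_inverse_one_plus_square_diff_le_5:
  fixes N :: "int set" and m :: int
  assumes "finite N"
  shows "(\<Sum>n\<in>N. 1 / (1 + (real_of_int (n - m))\<^sup>2)) \<le> 5"
proof -
  have fin: "finite ((\<lambda>n. \<bar>n - m\<bar>) ` N)" using assms by simp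
  define k where "k = nat (Max (insert 0 ((\<lambda>n. \<bar>n - m\<bar>) ` N)))"
  have k: "(\<lambda>n. n - m) ` N \<subseteq> {- int k..int k}"
  proof (rule image_subsetI)
    fix n assume "n \<in> N"
    then have "\<bar>n - m\<bar> \<le> int k"
      using fin Max_ge[of "insert 0 ((\<lambda>n. \<bar>n - m\<bar>) ` N)" "\<bar>n - m\<bar>"] by (simp add: k_def)
    then show "n - m \<in> {- int k..int k}" by auto
  qed
  have "(\<Sum>n\<in>N. 1 / (1 + (real_of_int (n - m))\<^sup>2)) = (\<Sum>n\<in>(\<lambda>n. n - m) ` N. 1 / (1 + (real_of_int n)\<^sup>2))"
    by (subst sum.reindex) (auto simp: inj_on_def)
  also have "\<dots> \<le> (\<Sum>n\<in>{- int k..int k}. 1 / (1 + (real_of_int n)\<^sup>2))"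
    using k by (intro sum_mono2) (auto intro!: divide_nonneg_nonneg add_nonneg_nonneg)
  also have "\<dots> \<le> 5 - 4 / (real k + 1)" by (rule sum_inverse_one_plus_square_le_5)
  also have "\<dots> \<le> 5" by simp
  finally show ?thesis .
qed

lemma inverse_one_plus_square_floor_le:
  fixes x y :: real
  shows "1 / (1 + (x - y)\<^sup>2) \<le> 3 / (1 + (of_int (\<lfloor>y\<rfloor> - \<lfloor>x\<rfloor>))\<^sup>2)"
proof -
  define d where "d = \<bar>x - y\<bar>"
  define e :: real where "e = of_int (\<lfloor>y\<rfloor> - \<lfloor>x\<rfloor>)"
  have "\<bar>e\<bar> \<le> d + 1" unfolding e_def d_def by linarith
  then have "e\<^sup>2 \<le> (d + 1)\<^sup>2" by (metis abs_ge_zero power2_abs power_mono)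
  moreover have "0 \<le> (d - 1)\<^sup>2 + d\<^sup>2" by simp
  ultimately have "1 + e\<^sup>2 \<le> 3 * (1 + d\<^sup>2)" by (simp add: power2_eq_square algebra_simps)
  then have "1 / (1 + d\<^sup>2) \<le> 3 / (1 + e\<^sup>2)"
    by (simp add: divide_le_eq le_divide_eq add_pos_nonneg)
  then show ?thesis by (simp add: d_def e_def)
qed

lemma sum_div_one_plus_square_le:
  fixes v t :: "'j \<Rightarrow> real"
  assumes J: "finite J" and v: "\<And>l. l \<in> J \<Longrightarrow> v l \<ge> 0"
    and local: "\<And>n. n \<in> (\<lambda>l. \<lfloor>t l\<rfloor>) ` J \<Longrightarrow> (\<Sum>l\<in>{l \<in> J. \<lfloor>t l\<rfloor> = n}. v l) \<le> B" and B: "B \<ge> 0"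
  shows "(\<Sum>l\<in>J. v l / (1 + (x - t l)\<^sup>2)) \<le> 15 * B"
proof -
  let ?N = "(\<lambda>l. \<lfloor>t l\<rfloor>) ` J" and ?c = "\<lambda>n. 3 / (1 + (real_of_int (n - \<lfloor>x\<rfloor>))\<^sup>2)"
  have "(\<Sum>l\<in>J. v l / (1 + (x - t l)\<^sup>2)) = (\<Sum>n\<in>?N. \<Sum>l\<in>{l \<in> J. \<lfloor>t l\<rfloor> = n}. v l / (1 + (x - t l)\<^sup>2))"
    using J by (intro sum.group[symmetric]) auto
  also have "\<dots> \<le> (\<Sum>n\<in>?N. B * ?c n)"
  proof (rule sum_mono)
    fix n assume n: "n \<in> ?N"
    have "(\<Sum>l\<in>{l \<in> J. \<lfloor>t l\<rfloor> = n}. v l / (1 + (x - t l)\<^sup>2)) \<le> (\<Sum>l\<in>{l \<in> J. \<lfloor>t l\<rfloor> = n}. v l * ?c n)"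
    proof (rule sum_mono)
      fix l assume "l \<in> {l \<in> J. \<lfloor>t l\<rfloor> = n}"
      then show "v l / (1 + (x - t l)\<^sup>2) \<le> v l * ?c n"
        using mult_left_mono[OF inverse_one_plus_square_floor_le[of x "t l"] v[of l]] by simp
    qed
    also have "\<dots> = (\<Sum>l\<in>{l \<in> J. \<lfloor>t l\<rfloor> = n}. v l) * ?c n" by (rule sum_distrib_right[symmetric])
    also have "\<dots> \<le> B * ?c n"
      by (intro mult_right_mono local n divide_nonneg_nonneg add_nonneg_nonneg) auto
    finally show "(\<Sum>l\<in>{l \<in> J. \<lfloor>t l\<rfloor> = n}. v l / (1 + (x - t l)\<^sup>2)) \<le> B * ?c n" .
  qed
  also have "\<dots> = 3 * B * (\<Sum>n\<in>?N. 1 / (1 + (real_of_int (n - \<lfloor>x\<rfloor>))\<^sup>2))"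
    by (simp add: sum_distrib_left mult_ac)
  also have "\<dots> \<le> 3 * B * 5"
    using J B by (intro mult_left_mono sum_inverse_one_plus_square_diff_le_5) auto
  finally show ?thesis by simp
qed

section \<open>The spectral large sieve\<close>

lemma abs_ln_diff_gt:
  fixes p q X :: real
  assumes p: "0 < p" "p \<le> 2 * X" and q: "0 < q" "q \<le> 2 * X" and e: "\<epsilon> > 0" "\<epsilon> < \<bar>p - q\<bar>"
  shows "\<epsilon> / (2 * X) < \<bar>ln p - ln q\<bar>"
proof -
  have gap: "\<epsilon> / (2 * X) < ln b - ln a" if "0 < a" "b \<le> 2 * X" "\<epsilon> < b - a" for a b
  proof -
    have b: "b > 0" using that e(1) by linarith
    have "\<epsilon> / (2 * X) \<le> \<epsilon> / b" using that b e(1) by (intro divide_left_mono) auto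
    also have "\<dots> < (b - a) / b" using that b by (intro divide_strict_right_mono)
    also have "\<dots> = 1 - a / b" using b by (simp add: field_simps)
    also have "\<dots> \<le> - ln (a / b)" using ln_le_minus_one[of "a / b"] that b by simp
    also have "\<dots> = ln b - ln a" using that b by (simp add: ln_div)
    finally show ?thesis .
  qed
  from e(2) consider "\<epsilon> < p - q" | "\<epsilon> < q - p" by linarith
  then show ?thesis using gap[of q p] gap[of p q] p q by cases auto
qed

context discrete_PSL2C
begin

lemma sum_eigenfunctions_div_one_plus_square_le:
  assumes P: "P \<in> hyp3" and sp: "spectral_system \<Gamma> u t" and T: "T > 1" and J: "finite J"
    and t: "\<And>j. j \<in> J \<Longrightarrow> Im (t j) = 0 \<and> \<bar>Re (t j)\<bar> \<le> T"
  shows "(\<Sum>l\<in>J. (cmod (u l (hyp_orbit \<Gamma> P)))\<^sup>2 / (1 + (x - Re (t l))\<^sup>2)) \<le> 135 * weyl_constant P * T\<^sup>2"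
proof -
  let ?B = "weyl_constant P * (3 * T)\<^sup>2"
  have "(\<Sum>l\<in>J. (cmod (u l (hyp_orbit \<Gamma> P)))\<^sup>2 / (1 + (x - Re (t l))\<^sup>2)) \<le> 15 * ?B"
  proof (rule sum_div_one_plus_square_le[OF J])
    fix n assume "n \<in> (\<lambda>l. \<lfloor>Re (t l)\<rfloor>) ` J"
    then obtain l where l: "l \<in> J" "\<lfloor>Re (t l)\<rfloor> = n" by auto
    let ?Jn = "{l \<in> J. \<lfloor>Re (t l)\<rfloor> = n}"
    have "(\<Sum>l\<in>?Jn. (cmod (u l (hyp_orbit \<Gamma> P)))\<^sup>2) \<le> weyl_constant P * (1 + \<bar>of_int n\<bar>)\<^sup>2"
    proof (rule local_weyl_bound[OF P sp])
      fix j assume "j \<in> ?Jn"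
      then have j: "j \<in> J" "\<lfloor>Re (t j)\<rfloor> = n" by auto
      from j(2) have "\<bar>\<bar>Re (t j)\<bar> - \<bar>of_int n\<bar>\<bar> \<le> 1" by linarith
      then show "Im (t j) = 0 \<and> \<bar>\<bar>Re (t j)\<bar> - \<bar>real_of_int n\<bar>\<bar> \<le> 1" using t[OF j(1)] by simp
    qed (use J in auto)
    also have "\<dots> \<le> ?B"
    proof (intro mult_left_mono power_mono)
      show "1 + \<bar>real_of_int n\<bar> \<le> 3 * T" using t[OF l(1)] l(2) T by linarith
    qed (use weyl_constant_pos[OF P] in auto)
    finally show "(\<Sum>l\<in>?Jn. (cmod (u l (hyp_orbit \<Gamma> P)))\<^sup>2) \<le> ?B" .
  qed (use weyl_constant_pos[OF P] in auto)
  then show ?thesis by (simp add: power_mult_distrib)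
qed

lemma tempered_large_sieve:
  fixes y :: "'k \<Rightarrow> real"
  assumes P: "P \<in> hyp3" and sp: "spectral_system \<Gamma> u t" and T: "T > 1" and J: "finite J"
    and t: "\<And>j. j \<in> J \<Longrightarrow> Im (t j) = 0 \<and> \<bar>Re (t j)\<bar> \<le> T"
    and \<delta>: "\<delta> > 0" and A: "finite A" and sep: "\<And>k l. k \<in> A \<Longrightarrow> l \<in> A \<Longrightarrow> k \<noteq> l \<Longrightarrow> \<bar>y k - y l\<bar> > \<delta>"
    and range: "\<And>k. k \<in> A \<Longrightarrow> c - 1 \<le> y k \<and> y k + \<delta> \<le> c + 1"
  shows "(\<Sum>k\<in>A. (cmod (\<Sum>j\<in>J. a j * exp (\<i> * t j * of_real (y k)) * u j (hyp_orbit \<Gamma> P)))\<^sup>2)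
    \<le> 810 * weyl_constant P * T\<^sup>2 * (1 / \<delta> + 2 * T) * (\<Sum>j\<in>J. (cmod (a j))\<^sup>2)"
proof -
  define b where "b j = u j (hyp_orbit \<Gamma> P) * exp (\<i> * of_real (Re (t j) * c))" for j
  have recentre: "(\<Sum>j\<in>J. a j * exp (\<i> * t j * of_real (y k)) * u j (hyp_orbit \<Gamma> P))
      = (\<Sum>j\<in>J. a j * b j * exp (\<i> * of_real (Re (t j) * (y k - c))))" for k
  proof (intro sum.cong refl)
    fix j assume "j \<in> J"
    then have "t j = of_real (Re (t j))" using t by (simp add: complex_eq_iff)
    then have "\<i> * t j * of_real (y k) = \<i> * of_real (Re (t j)) * of_real (y k)" by (rule arg_cong)
    also have "\<dots> = \<i> * of_real (Re (t j) * c) + \<i> * of_real (Re (t j) * (y k - c))"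
      by (simp add: algebra_simps)
    finally show "a j * exp (\<i> * t j * of_real (y k)) * u j (hyp_orbit \<Gamma> P)
        = a j * b j * exp (\<i> * of_real (Re (t j) * (y k - c)))"
      by (simp only: b_def exp_add mult_ac)
  qed
  have "(\<Sum>k\<in>A. (cmod (\<Sum>j\<in>J. a j * b j * exp (\<i> * of_real (Re (t j) * (y k - c)))))\<^sup>2)
      \<le> 6 * (135 * weyl_constant P * T\<^sup>2) * (1 / \<delta> + 2 * T) * (\<Sum>j\<in>J. (cmod (a j))\<^sup>2)"
  proof (rule weighted_large_sieve[OF _ _ _ \<delta> A])
    have "cmod (b l) = cmod (u l (hyp_orbit \<Gamma> P))" for l by (simp add: b_def norm_mult)
    then show "(\<Sum>l\<in>J. (cmod (b l))\<^sup>2 / (1 + (Re (t j) - Re (t l))\<^sup>2)) \<le> 135 * weyl_constant P * T\<^sup>2" for j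
      using sum_eigenfunctions_div_one_plus_square_le[OF P sp T J t] by simp
    show "- 1 \<le> y k - c \<and> y k - c + \<delta> \<le> 1" if "k \<in> A" for k using range[OF that] by linarith
  qed (use T t sep in auto)
  then show ?thesis by (simp add: recentre)
qed

lemma exceptional_sum_power2_le:
  assumes P: "P \<in> hyp3" and sp: "spectral_system \<Gamma> u t" and J: "finite J"
    and t: "\<And>j. j \<in> J \<Longrightarrow> Re (t j) = 0 \<and> Im (t j) \<ge> 0" and y: "y \<ge> 0"
  shows "(cmod (\<Sum>j\<in>J. a j * exp (\<i> * t j * of_real y) * u j (hyp_orbit \<Gamma> P)))\<^sup>2
    \<le> weyl_constant P * (\<Sum>j\<in>J. (cmod (a j))\<^sup>2)"
proof -
  have "cmod (\<Sum>j\<in>J. a j * exp (\<i> * t j * of_real y) * u j (hyp_orbit \<Gamma> P))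
      \<le> (\<Sum>j\<in>J. cmod (a j) * cmod (u j (hyp_orbit \<Gamma> P)))"
  proof (rule sum_norm_le)
    fix j assume "j \<in> J"
    then have "cmod (exp (\<i> * t j * of_real y)) \<le> 1" using t y by (simp add: norm_exp_eq_Re)
    then have "cmod (a j) * cmod (exp (\<i> * t j * of_real y)) * cmod (u j (hyp_orbit \<Gamma> P))
        \<le> cmod (a j) * 1 * cmod (u j (hyp_orbit \<Gamma> P))"
      by (intro mult_right_mono mult_left_mono) auto
    then show "cmod (a j * exp (\<i> * t j * of_real y) * u j (hyp_orbit \<Gamma> P)) \<le> cmod (a j) * cmod (u j (hyp_orbit \<Gamma> P))"
      by (simp add: norm_mult)
  qed
  then have "(cmod (\<Sum>j\<in>J. a j * exp (\<i> * t j * of_real y) * u j (hyp_orbit \<Gamma> P)))\<^sup>2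
      \<le> (\<Sum>j\<in>J. cmod (a j) * cmod (u j (hyp_orbit \<Gamma> P)))\<^sup>2"
    by (intro power_mono) auto
  also have "\<dots> \<le> (\<Sum>j\<in>J. (cmod (a j))\<^sup>2) * (\<Sum>j\<in>J. (cmod (u j (hyp_orbit \<Gamma> P)))\<^sup>2)"
    by (rule Cauchy_Schwarz_ineq_sum)
  also have "\<dots> \<le> (\<Sum>j\<in>J. (cmod (a j))\<^sup>2) * weyl_constant P"
    using low_frequency_weyl_bound[OF P sp J] t by (intro mult_left_mono sum_nonneg) auto
  finally show ?thesis by (simp add: mult.commute)
qed

lemma exceptional_large_sieve:
  fixes y :: "'k \<Rightarrow> real"
  assumes P: "P \<in> hyp3" and sp: "spectral_system \<Gamma> u t" and T: "T > 0" and J: "finite J"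
    and t: "\<And>j. j \<in> J \<Longrightarrow> Re (t j) = 0 \<and> Im (t j) \<ge> 0"
    and \<delta>: "\<delta> > 0" and A: "finite A" and sep: "\<And>k l. k \<in> A \<Longrightarrow> l \<in> A \<Longrightarrow> k \<noteq> l \<Longrightarrow> \<bar>y k - y l\<bar> > \<delta>"
    and range: "\<And>k. k \<in> A \<Longrightarrow> c - 1 \<le> y k \<and> y k + \<delta> \<le> c + 1" and nonneg: "\<And>k. k \<in> A \<Longrightarrow> y k \<ge> 0"
  shows "(\<Sum>k\<in>A. (cmod (\<Sum>j\<in>J. a j * exp (\<i> * t j * of_real (y k)) * u j (hyp_orbit \<Gamma> P)))\<^sup>2)
    \<le> 2 * weyl_constant P * (1 / \<delta> + T) * (\<Sum>j\<in>J. (cmod (a j))\<^sup>2)"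
proof -
  let ?M = "weyl_constant P * (\<Sum>j\<in>J. (cmod (a j))\<^sup>2)"
  have "(\<Sum>k\<in>A. (cmod (\<Sum>j\<in>J. a j * exp (\<i> * t j * of_real (y k)) * u j (hyp_orbit \<Gamma> P)))\<^sup>2)
      \<le> real (card A) * ?M"
    by (intro sum_bounded_above exceptional_sum_power2_le[OF P sp J t] nonneg)
  also have "\<dots> \<le> (1 / \<delta> + T) * (c + 1 - (c - 1)) * ?M"
    using weyl_constant_pos[OF P] T
    by (intro mult_right_mono card_separated_le[OF \<delta> A sep range] mult_nonneg_nonneg sum_nonneg) auto
  finally show ?thesis by (simp add: algebra_simps)
qed

lemma logarithmic_spectral_large_sieve:
  fixes y :: "'k \<Rightarrow> real"
  assumes P: "P \<in> hyp3" and sp: "spectral_system \<Gamma> u t" and T: "T > 1" and J: "finite J"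
    and t: "\<And>j. j \<in> J \<Longrightarrow> cmod (t j) \<le> T"
    and \<delta>: "\<delta> > 0" and A: "finite A" and sep: "\<And>k l. k \<in> A \<Longrightarrow> l \<in> A \<Longrightarrow> k \<noteq> l \<Longrightarrow> \<bar>y k - y l\<bar> > \<delta>"
    and range: "\<And>k. k \<in> A \<Longrightarrow> c - 1 \<le> y k \<and> y k + \<delta> \<le> c + 1" and nonneg: "\<And>k. k \<in> A \<Longrightarrow> y k \<ge> 0"
  shows "(\<Sum>k\<in>A. (cmod (\<Sum>j\<in>J. a j * exp (\<i> * t j * of_real (y k)) * u j (hyp_orbit \<Gamma> P)))\<^sup>2)
    \<le> 3240 * weyl_constant P * (T ^ 3 + T\<^sup>2 / \<delta>) * (\<Sum>j\<in>J. (cmod (a j))\<^sup>2)"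
proof -
  define tempered where "tempered = {j \<in> J. Im (t j) = 0}"
  define exceptional where "exceptional = {j \<in> J. Im (t j) \<noteq> 0}"
  let ?K = "weyl_constant P" and ?Q = "T ^ 3 + T\<^sup>2 / \<delta>"
  let ?S = "\<lambda>I k. \<Sum>j\<in>I. a j * exp (\<i> * t j * of_real (y k)) * u j (hyp_orbit \<Gamma> P)"
  let ?a = "\<lambda>I. \<Sum>j\<in>I. (cmod (a j))\<^sup>2"
  have split: "sum f J = sum f tempered + sum f exceptional" for f :: "nat \<Rightarrow> 'b :: comm_monoid_add"
    using J unfolding tempered_def exceptional_def
    by (subst sum.union_disjoint[symmetric]) (auto intro: sum.cong)
  have a: "?a I \<ge> 0" for I by (intro sum_nonneg) auto
  have K: "?K > 0" by (rule weyl_constant_pos[OF P])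
  have "(\<Sum>k\<in>A. (cmod (?S tempered k))\<^sup>2) \<le> 810 * ?K * T\<^sup>2 * (1 / \<delta> + 2 * T) * ?a tempered"
    using J abs_Re_le_cmod t
    by (intro tempered_large_sieve[OF P sp T _ _ \<delta> A sep range]) (force simp: tempered_def intro: order_trans)+
  also have "\<dots> \<le> 1620 * ?K * ?Q * ?a tempered"
  proof (rule mult_right_mono[OF _ a])
    have "T\<^sup>2 * (1 / \<delta> + 2 * T) \<le> 2 * ?Q"
      using \<delta> by (simp add: algebra_simps power2_eq_square power3_eq_cube divide_right_mono)
    from mult_left_mono[OF this, of "810 * ?K"] show "810 * ?K * T\<^sup>2 * (1 / \<delta> + 2 * T) \<le> 1620 * ?K * ?Q"
      using K by (simp only: mult_ac) simp
  qed
  finally have tempered: "(\<Sum>k\<in>A. (cmod (?S tempered k))\<^sup>2) \<le> 1620 * ?K * ?Q * ?a tempered" .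
  have "(\<Sum>k\<in>A. (cmod (?S exceptional k))\<^sup>2) \<le> 2 * ?K * (1 / \<delta> + T) * ?a exceptional"
    using sp T J
    by (intro exceptional_large_sieve[OF P sp _ _ _ \<delta> A sep range nonneg])
       (auto simp: exceptional_def spectral_system_def)
  also have "\<dots> \<le> 1620 * ?K * ?Q * ?a exceptional"
  proof (intro mult_right_mono mult_mono a)
    show "1 / \<delta> + T \<le> ?Q"
      using T \<delta> self_le_power[of T 3] divide_right_mono[of 1 "T\<^sup>2" \<delta>] by (simp add: one_le_power)
  qed (use K T \<delta> in auto)
  finally have exceptional: "(\<Sum>k\<in>A. (cmod (?S exceptional k))\<^sup>2) \<le> 1620 * ?K * ?Q * ?a exceptional" .
  have "(\<Sum>k\<in>A. (cmod (?S J k))\<^sup>2) \<le> (\<Sum>k\<in>A. 2 * (cmod (?S tempered k))\<^sup>2 + 2 * (cmod (?S exceptional k))\<^sup>2)"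
    unfolding split by (intro sum_mono norm_add_power2_le)
  also have "\<dots> = 2 * (\<Sum>k\<in>A. (cmod (?S tempered k))\<^sup>2) + 2 * (\<Sum>k\<in>A. (cmod (?S exceptional k))\<^sup>2)"
    by (simp only: sum.distrib sum_distrib_left)
  also have "\<dots> \<le> 2 * (1620 * ?K * ?Q * ?a tempered) + 2 * (1620 * ?K * ?Q * ?a exceptional)"
    using tempered exceptional by linarith
  also have "\<dots> = 3240 * ?K * ?Q * ?a J" unfolding split by (simp add: algebra_simps add_divide_distrib)
  finally show ?thesis .
qed

theorem spectral_large_sieve:
  fixes x :: "'k \<Rightarrow> real"
  assumes P: "P \<in> hyp3" and sp: "spectral_system \<Gamma> u t" and X: "X > 1" and T: "T > 1" and \<epsilon>: "\<epsilon> > 0"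
    and J: "finite J" and t: "\<And>j. j \<in> J \<Longrightarrow> cmod (t j) \<le> T" and A: "finite A"
    and x: "\<And>k. k \<in> A \<Longrightarrow> x k \<in> {X..2 * X}"
    and sep: "\<And>k l. k \<in> A \<Longrightarrow> l \<in> A \<Longrightarrow> k \<noteq> l \<Longrightarrow> \<bar>x k - x l\<bar> > \<epsilon>"
  shows "(\<Sum>k\<in>A. (cmod (\<Sum>j\<in>J. a j * of_real (x k) powr (\<i> * t j) * u j (hyp_orbit \<Gamma> P)))\<^sup>2)
    \<le> 6480 * weyl_constant P * (T ^ 3 + X * T\<^sup>2 / \<epsilon>) * (\<Sum>j\<in>J. (cmod (a j))\<^sup>2)"
proof -
  define \<delta> where "\<delta> = min 1 (\<epsilon> / (2 * X))"
  have \<delta>: "\<delta> > 0" "\<delta> \<le> 1" "\<delta> \<le> \<epsilon> / (2 * X)" using \<epsilon> X by (auto simp: \<delta>_def)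
  have "ln X \<le> ln (x k) \<and> ln (x k) \<le> ln X + 1" if "k \<in> A" for k
  proof -
    have "ln (x k) \<le> ln (2 * X)" using x[OF that] X by simp
    also have "\<dots> = ln X + ln 2" using X by (simp add: ln_mult)
    finally show ?thesis using x[OF that] X ln_le_minus_one[of "2 :: real"] by simp
  qed
  note ln_x = this
  have "of_real (x k) powr (\<i> * t j) = exp (\<i> * t j * of_real (ln (x k)))" if "k \<in> A" for k j
    using x[OF that] X by (simp add: powr_def Ln_of_real)
  then have "(\<Sum>k\<in>A. (cmod (\<Sum>j\<in>J. a j * of_real (x k) powr (\<i> * t j) * u j (hyp_orbit \<Gamma> P)))\<^sup>2)
      = (\<Sum>k\<in>A. (cmod (\<Sum>j\<in>J. a j * exp (\<i> * t j * of_real (ln (x k))) * u j (hyp_orbit \<Gamma> P)))\<^sup>2)"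
    by simp
  also have "\<dots> \<le> 3240 * weyl_constant P * (T ^ 3 + T\<^sup>2 / \<delta>) * (\<Sum>j\<in>J. (cmod (a j))\<^sup>2)"
  proof (rule logarithmic_spectral_large_sieve[OF P sp T J t \<delta>(1) A])
    fix k assume k: "k \<in> A"
    show "ln X + 1 - 1 \<le> ln (x k) \<and> ln (x k) + \<delta> \<le> ln X + 1 + 1" using ln_x[OF k] \<delta> by linarith
    show "ln (x k) \<ge> 0" using x[OF k] X by simp
    show "\<delta> < \<bar>ln (x k) - ln (x l)\<bar>" if "l \<in> A" "k \<noteq> l" for l
      using abs_ln_diff_gt[OF _ _ _ _ \<epsilon> sep[OF k that]] x[OF k] x[OF that(1)] X \<delta>(3) by force
  qed
  also have "\<dots> \<le> 3240 * weyl_constant P * (2 * (T ^ 3 + X * T\<^sup>2 / \<epsilon>)) * (\<Sum>j\<in>J. (cmod (a j))\<^sup>2)"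
  proof (intro mult_right_mono mult_left_mono sum_nonneg)
    have "T\<^sup>2 / \<delta> \<le> T\<^sup>2 * (1 + 2 * X / \<epsilon>)"
      using \<epsilon> X by (cases "\<epsilon> / (2 * X) \<le> 1") (auto simp: \<delta>_def min_def field_simps)
    also have "\<dots> = T\<^sup>2 + 2 * (X * T\<^sup>2 / \<epsilon>)" by (simp add: algebra_simps)
    also have "\<dots> \<le> T ^ 3 + 2 * (X * T\<^sup>2 / \<epsilon>)" using power_increasing[of 2 3 T] T by simp
    finally show "T ^ 3 + T\<^sup>2 / \<delta> \<le> 2 * (T ^ 3 + X * T\<^sup>2 / \<epsilon>)" by simp
  qed (use weyl_constant_pos[OF P] in auto)
  finally show ?thesis by (simp add: algebra_simps)
qed

end

theorem theorem6:
  fixes \<Gamma> :: "(complex^2^2) set set" and p :: "(complex \<times> real) set"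
  assumes "discrete_subgroup \<Gamma>" and "cocompact \<Gamma>" and "p \<in> orbit_space \<Gamma>"
  shows "\<exists>C>0. \<forall>u t. spectral_system \<Gamma> u t \<longrightarrow>
    (\<forall>(X::real) (T::real) (\<epsilon>::real) (R::nat) (x :: nat \<Rightarrow> real) (a :: nat \<Rightarrow> complex).
       X > 1 \<and> T > 1 \<and> \<epsilon> > 0 \<and>
       (\<forall>k\<in>{1..R}. x k \<in> {X..2 * X}) \<and>
       (\<forall>k\<in>{1..R}. \<forall>l\<in>{1..R}. k \<noteq> l \<longrightarrow> \<bar>x k - x l\<bar> > \<epsilon>) \<longrightarrow>
       (\<Sum>k = 1..R. (cmod (\<Sum>j | cmod (t j) \<le> T.
            a j * complex_of_real (x k) powr (\<i> * t j) * u j p))\<^sup>2)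
       \<le> C * (T ^ 3 + X * T\<^sup>2 / \<epsilon>) * (\<Sum>j | cmod (t j) \<le> T. (cmod (a j))\<^sup>2))"
proof -
  interpret discrete_PSL2C \<Gamma> using assms(1) by unfold_locales
  obtain P where P: "P \<in> hyp3" and p: "p = hyp_orbit \<Gamma> P" using assms(3) by (auto simp: orbit_space_def)
  have "(\<Sum>k = 1..R. (cmod (\<Sum>j | cmod (t j) \<le> T. a j * complex_of_real (x k) powr (\<i> * t j) * u j p))\<^sup>2)
      \<le> 6480 * weyl_constant P * (T ^ 3 + X * T\<^sup>2 / \<epsilon>) * (\<Sum>j | cmod (t j) \<le> T. (cmod (a j))\<^sup>2)"
    if "spectral_system \<Gamma> u t" "X > 1" "T > 1" "\<epsilon> > 0" "\<forall>k\<in>{1..R}. x k \<in> {X..2 * X}"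
      "\<forall>k\<in>{1..R}. \<forall>l\<in>{1..R}. k \<noteq> l \<longrightarrow> \<bar>x k - x l\<bar> > \<epsilon>" for u t X T \<epsilon> and R :: nat and x a
  proof (cases "finite {j. cmod (t j) \<le> T}")
    case True
    then show ?thesis unfolding p using that by (intro spectral_large_sieve[OF P]) auto
  next
    case False
    then show ?thesis by simp
  qed
  then show ?thesis
    using weyl_constant_pos[OF P] by (intro exI[of _ "6480 * weyl_constant P"]) auto
qed

end
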